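(* Let $p$ be a prime, let $n$ be a positive integer, and let $G$ be a non-abelian group of order $p^n$ with generalized corank $s(G)\in\{0,1\}$. Then the $\mathbb{C}$-twist isomorphism class of $G$ is a singleton, i.e. it consists of only one group up to isomorphism: if $H$ is a group of order $p^n$ with $G\sim_{\mathbb{C}}H$, then $H\cong G$.
   Context: For a finite group $G$, $H^2(G,\mathbb{C}^\times)$ is the second cohomology group with trivial action (the Schur multiplier of $G$). For a 2-cocycle $\alpha\in Z^2(G,\mathbb{C}^\times)$, $\mathbb{C}^\alpha G$ is the twisted group algebra: the $\mathbb{C}$-algebra with basis $\{u_g\}_{g\in G}$ and multiplication $u_gu_h=\alpha(g,h)u_{gh}$; up to isomorphism it depends only on the class $[\alpha]\in H^2(G,\mathbb{C}^\times)$. For finite groups $G,H$ write $G\sim_{\mathbb{C}}H$ if there is a group isomorphism $\psi:H^2(G,\mathbb{C}^\times)\to H^2(H,\mathbb{C}^\times)$ such that $\mathbb{C}^{\alpha}G\cong\mathbb{C}^{\psi(\alpha)}H$ as $\mathbb{C}$-algebras for every $[\alpha]\in H^2(G,\mathbb{C}^\times)$. The equivalence classes of this relation on groups of a given order are called $\mathbb{C}$-twist isomorphism classes. For a non-abelian group $G$ of order $p^n$, the generalized corank $s(G)$ is the integer defined by $|H^2(G,\mathbb{C}^\times)|=p^{\frac{(n-1)(n-2)}{2}+1-s(G)}$ (it is known that $s(G)\ge 0$). *)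

theory Defs
  imports Complex_Main "HOL-Algebra.Algebra"
begin

section \<open>The Schur multiplier\<close>

definition complex_units :: "complex monoid" where
  "complex_units = \<lparr>carrier = UNIV - {0}, monoid.mult = (*), one = 1\<rparr>"

text \<open>Cochains are extensional (\<open>undefined\<close> off the carrier), so that equality of cochains is
  equality of functions on the carrier.\<close>

definition cochains1 :: "('a, 'm) monoid_scheme \<Rightarrow> ('a \<Rightarrow> complex) monoid" where
  "cochains1 G = product_group (carrier G) (\<lambda>_. complex_units)"

definition cochains2 :: "('a, 'm) monoid_scheme \<Rightarrow> ('a \<times> 'a \<Rightarrow> complex) monoid" where
  "cochains2 G = product_group (carrier G \<times> carrier G) (\<lambda>_. complex_units)"

definition cocycles2 :: "('a, 'm) monoid_scheme \<Rightarrow> ('a \<times> 'a \<Rightarrow> complex) set" where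
  "cocycles2 G = {\<alpha> \<in> carrier (cochains2 G).
     \<forall>g\<in>carrier G. \<forall>h\<in>carrier G. \<forall>k\<in>carrier G.
       \<alpha> (g, h) * \<alpha> (g \<otimes>\<^bsub>G\<^esub> h, k) = \<alpha> (h, k) * \<alpha> (g, h \<otimes>\<^bsub>G\<^esub> k)}"

definition coboundary :: "('a, 'm) monoid_scheme \<Rightarrow> ('a \<Rightarrow> complex) \<Rightarrow> ('a \<times> 'a \<Rightarrow> complex)" where
  "coboundary G f = (\<lambda>(g, h)\<in>carrier G \<times> carrier G. f g * f h / f (g \<otimes>\<^bsub>G\<^esub> h))"

definition coboundaries2 :: "('a, 'm) monoid_scheme \<Rightarrow> ('a \<times> 'a \<Rightarrow> complex) set" where
  "coboundaries2 G = coboundary G ` carrier (cochains1 G)"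

definition Z2 :: "('a, 'm) monoid_scheme \<Rightarrow> ('a \<times> 'a \<Rightarrow> complex) monoid" where
  "Z2 G = (cochains2 G)\<lparr>carrier := cocycles2 G\<rparr>"

definition H2 :: "('a, 'm) monoid_scheme \<Rightarrow> ('a \<times> 'a \<Rightarrow> complex) set monoid" where
  "H2 G = Z2 G Mod coboundaries2 G"


section \<open>Twisted group algebras\<close>

text \<open>The element \<open>\<Sum>\<^sub>g x(g) u\<^sub>g\<close> is encoded as its coefficient function \<open>x\<close>. Cocycles are not assumed
  to be normalized, so the unit is \<open>\<alpha>(1,1)\<^sup>-\<^sup>1 u\<^sub>1\<close>.\<close>

definition twisted_group_algebra ::
  "('a, 'm) monoid_scheme \<Rightarrow> ('a \<times> 'a \<Rightarrow> complex) \<Rightarrow> (complex, 'a \<Rightarrow> complex) module" where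
  "twisted_group_algebra G \<alpha> =
    \<lparr>carrier = carrier G \<rightarrow>\<^sub>E UNIV,
     monoid.mult = (\<lambda>x y. \<lambda>k\<in>carrier G.
       \<Sum>(g, h)\<in>{(g, h). g \<in> carrier G \<and> h \<in> carrier G \<and> g \<otimes>\<^bsub>G\<^esub> h = k}. x g * y h * \<alpha> (g, h)),
     monoid.one = (\<lambda>k\<in>carrier G. if k = \<one>\<^bsub>G\<^esub> then inverse (\<alpha> (\<one>\<^bsub>G\<^esub>, \<one>\<^bsub>G\<^esub>)) else 0),
     ring.zero = (\<lambda>k\<in>carrier G. 0),
     ring.add = (\<lambda>x y. \<lambda>k\<in>carrier G. x k + y k),
     module.smult = (\<lambda>c x. \<lambda>k\<in>carrier G. c * x k)\<rparr>"

definition algebra_isomorphic ::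
  "(complex, 'a, 'm) module_scheme \<Rightarrow> (complex, 'b, 'n) module_scheme \<Rightarrow> bool" where
  "algebra_isomorphic A B \<longleftrightarrow>
     (\<exists>\<phi>\<in>ring_iso A B. \<forall>c. \<forall>x\<in>carrier A. \<phi> (c \<odot>\<^bsub>A\<^esub> x) = c \<odot>\<^bsub>B\<^esub> \<phi> x)"


section \<open>Twist isomorphism and generalized corank\<close>

text \<open>A class is a coset of cocycles; by \<open>algebra_isomorphic_cohomologous\<close> below, the choice of the
  representatives \<open>\<alpha>\<close> and \<open>\<beta>\<close> is immaterial.\<close>

definition twist_isomorphic :: "('a, 'm) monoid_scheme \<Rightarrow> ('b, 'n) monoid_scheme \<Rightarrow> bool" where
  "twist_isomorphic G H \<longleftrightarrow>
     (\<exists>\<psi>\<in>iso (H2 G) (H2 H). \<forall>c\<in>carrier (H2 G). \<forall>\<alpha>\<in>c. \<forall>\<beta>\<in>\<psi> c.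
        algebra_isomorphic (twisted_group_algebra G \<alpha>) (twisted_group_algebra H \<beta>))"

text \<open>The integer \<open>s\<close> is the generalized corank of the group \<open>G\<close> of order \<open>p\<^sup>n\<close>. It is a priori an
  integer of either sign, hence the integer exponent.\<close>

definition is_generalized_corank :: "nat \<Rightarrow> nat \<Rightarrow> ('a, 'm) monoid_scheme \<Rightarrow> int \<Rightarrow> bool" where
  "is_generalized_corank p n G s \<longleftrightarrow>
     real (order (H2 G)) = real p powi ((int n - 1) * (int n - 2) div 2 + 1 - s)"


section \<open>Basic facts\<close>

lemma complex_units_simps [simp]:
  "carrier complex_units = UNIV - {0}" "x \<otimes>\<^bsub>complex_units\<^esub> y = x * y" "\<one>\<^bsub>complex_units\<^esub> = 1"
  by (simp_all add: complex_units_def)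

lemma comm_group_complex_units: "comm_group complex_units"
proof (rule comm_groupI)
  fix x assume "x \<in> carrier complex_units"
  then show "\<exists>y\<in>carrier complex_units. y \<otimes>\<^bsub>complex_units\<^esub> x = \<one>\<^bsub>complex_units\<^esub>"
    by (intro bexI [of _ "inverse x"]) auto
qed auto

lemma comm_group_cochains2: "comm_group (cochains2 G)"
proof -
  interpret C: group "cochains2 G"
    unfolding cochains2_def using comm_group_complex_units
    by (intro product_group) (auto simp: comm_group_def)
  show ?thesis
    by (rule C.group_comm_groupI) (auto simp: cochains2_def mult.commute)
qed

lemma inv_complex_units: "x \<noteq> 0 \<Longrightarrow> inv\<^bsub>complex_units\<^esub> x = inverse x"
  using comm_group_complex_units unfolding comm_group_def
  by (auto intro!: group.inv_equality)

lemma inv_cochains2: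
  "\<alpha> \<in> carrier (cochains2 G) \<Longrightarrow>
    inv\<^bsub>cochains2 G\<^esub> \<alpha> = (\<lambda>i\<in>carrier G \<times> carrier G. inverse (\<alpha> i))"
  using comm_group_complex_units unfolding cochains2_def
  by (subst inv_product_group)
     (auto simp: comm_group_def PiE_iff intro!: restrict_ext inv_complex_units)

lemma subgroup_cocycles2:
  assumes "group G" shows "subgroup (cocycles2 G) (cochains2 G)"
proof -
  interpret G: group G by fact
  interpret C: comm_group "cochains2 G" by (rule comm_group_cochains2)
  show ?thesis
  proof (rule C.subgroupI)
    have "\<one>\<^bsub>cochains2 G\<^esub> \<in> cocycles2 G"
      by (auto simp: cocycles2_def cochains2_def)
    then show "cocycles2 G \<noteq> {}" by blast
  next
    fix \<alpha> assume a: "\<alpha> \<in> cocycles2 G"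
    then have "inv\<^bsub>cochains2 G\<^esub> \<alpha> \<in> carrier (cochains2 G)"
      by (auto simp: cocycles2_def)
    with a show "inv\<^bsub>cochains2 G\<^esub> \<alpha> \<in> cocycles2 G"
      by (auto simp: cocycles2_def inv_cochains2 simp flip: inverse_mult_distrib)
  next
    fix \<alpha> \<beta> assume a: "\<alpha> \<in> cocycles2 G" "\<beta> \<in> cocycles2 G"
    then have "\<alpha> \<otimes>\<^bsub>cochains2 G\<^esub> \<beta> \<in> carrier (cochains2 G)"
      by (auto simp: cocycles2_def)
    moreover have "\<alpha> (g, h) * \<beta> (g, h) * (\<alpha> (g \<otimes>\<^bsub>G\<^esub> h, k) * \<beta> (g \<otimes>\<^bsub>G\<^esub> h, k)) =
        \<alpha> (h, k) * \<beta> (h, k) * (\<alpha> (g, h \<otimes>\<^bsub>G\<^esub> k) * \<beta> (g, h \<otimes>\<^bsub>G\<^esub> k))"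
      if "g \<in> carrier G" "h \<in> carrier G" "k \<in> carrier G" for g h k
    proof -
      have e: "\<alpha> (g, h) * \<alpha> (g \<otimes>\<^bsub>G\<^esub> h, k) = \<alpha> (h, k) * \<alpha> (g, h \<otimes>\<^bsub>G\<^esub> k)"
           "\<beta> (g, h) * \<beta> (g \<otimes>\<^bsub>G\<^esub> h, k) = \<beta> (h, k) * \<beta> (g, h \<otimes>\<^bsub>G\<^esub> k)"
        using a that by (auto simp: cocycles2_def)
      show ?thesis using arg_cong2 [OF e, of "(*)"] by (simp only: mult_ac)
    qed
    ultimately show "\<alpha> \<otimes>\<^bsub>cochains2 G\<^esub> \<beta> \<in> cocycles2 G"
      by (auto simp: cocycles2_def cochains2_def)
  qed (auto simp: cocycles2_def)
qed

lemma cochain1_nonzero: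
  "f \<in> carrier (cochains1 G) \<Longrightarrow> g \<in> carrier G \<Longrightarrow> f g \<noteq> 0"
  by (auto simp: cochains1_def PiE_iff)

lemma coboundary_in_cocycles2:
  assumes "group G" "f \<in> carrier (cochains1 G)"
  shows "coboundary G f \<in> cocycles2 G"
proof -
  interpret G: group G by fact
  show ?thesis
    using cochain1_nonzero [OF assms(2)]
    by (auto simp: cocycles2_def cochains2_def coboundary_def G.m_assoc field_simps)
qed

lemma subgroup_coboundaries2:
  assumes "group G" shows "subgroup (coboundaries2 G) (Z2 G)"
proof -
  interpret G: group G by fact
  interpret C: comm_group "cochains2 G" by (rule comm_group_cochains2)
  have sub: "coboundaries2 G \<subseteq> cocycles2 G"
    using coboundary_in_cocycles2 [OF assms] by (auto simp: coboundaries2_def)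
  have "subgroup (coboundaries2 G) (cochains2 G)"
  proof (rule C.subgroupI)
    show "coboundaries2 G \<subseteq> carrier (cochains2 G)"
      using sub by (auto simp: cocycles2_def)
    have "(\<lambda>g\<in>carrier G. 1) \<in> carrier (cochains1 G)"
      by (auto simp: cochains1_def)
    then show "coboundaries2 G \<noteq> {}" by (auto simp: coboundaries2_def)
  next
    fix \<alpha> assume a: "\<alpha> \<in> coboundaries2 G"
    then obtain f where f: "f \<in> carrier (cochains1 G)" "\<alpha> = coboundary G f"
      by (auto simp: coboundaries2_def)
    have "inv\<^bsub>cochains2 G\<^esub> \<alpha> = coboundary G (\<lambda>g\<in>carrier G. inverse (f g))"
    proof (subst inv_cochains2)
      show "\<alpha> \<in> carrier (cochains2 G)" using a sub by (auto simp: cocycles2_def)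
    qed (use cochain1_nonzero [OF f(1)] in \<open>auto simp: f(2) coboundary_def fun_eq_iff restrict_def field_simps\<close>)
    moreover have "(\<lambda>g\<in>carrier G. inverse (f g)) \<in> carrier (cochains1 G)"
      using f by (auto simp: cochains1_def PiE_iff)
    ultimately show "inv\<^bsub>cochains2 G\<^esub> \<alpha> \<in> coboundaries2 G"
      by (auto simp: coboundaries2_def)
  next
    fix \<alpha> \<beta> assume "\<alpha> \<in> coboundaries2 G" "\<beta> \<in> coboundaries2 G"
    then obtain f f' where f: "f \<in> carrier (cochains1 G)" "\<alpha> = coboundary G f"
        "f' \<in> carrier (cochains1 G)" "\<beta> = coboundary G f'"
      by (auto simp: coboundaries2_def)
    have "\<alpha> \<otimes>\<^bsub>cochains2 G\<^esub> \<beta> = coboundary G (\<lambda>g\<in>carrier G. f g * f' g)"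
      using f by (auto simp: cochains2_def coboundary_def fun_eq_iff restrict_def field_simps)
    moreover have "(\<lambda>g\<in>carrier G. f g * f' g) \<in> carrier (cochains1 G)"
      using f by (auto simp: cochains1_def PiE_iff)
    ultimately show "\<alpha> \<otimes>\<^bsub>cochains2 G\<^esub> \<beta> \<in> coboundaries2 G"
      by (auto simp: coboundaries2_def)
  qed
  then show ?thesis
    unfolding Z2_def
    by (rule C.subgroup_incl [OF _ subgroup_cocycles2 [OF assms] sub])
qed

lemma comm_group_Z2:
  assumes "group G" shows "comm_group (Z2 G)"
proof -
  interpret C: comm_group "cochains2 G" by (rule comm_group_cochains2)
  interpret Z: group "Z2 G"
    unfolding Z2_def by (rule C.subgroup_imp_group [OF subgroup_cocycles2 [OF assms]])
  show ?thesis
    by (rule Z.group_comm_groupI) (auto simp: Z2_def cocycles2_def intro: C.m_comm)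
qed

lemma comm_group_H2:
  assumes "group G" shows "comm_group (H2 G)"
  unfolding H2_def
  by (rule comm_group.abelian_FactGroup
        [OF comm_group_Z2 [OF assms] subgroup_coboundaries2 [OF assms]])

lemma ring_twisted_group_algebra:
  assumes "group G" "finite (carrier G)" and \<alpha>: "\<alpha> \<in> cocycles2 G"
  shows "ring (twisted_group_algebra G \<alpha>)"
proof -
  interpret G: group G by fact
  let ?C = "carrier G"
  let ?A = "twisted_group_algebra G \<alpha>"
  note fin = assms(2)
  have nz: "\<alpha> (g, h) \<noteq> 0" if "g \<in> ?C" "h \<in> ?C" for g h
    using \<alpha> that by (auto simp: cocycles2_def cochains2_def PiE_iff)
  have coc: "\<alpha> (g, h) * \<alpha> (g \<otimes>\<^bsub>G\<^esub> h, k) = \<alpha> (h, k) * \<alpha> (g, h \<otimes>\<^bsub>G\<^esub> k)"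
    if "g \<in> ?C" "h \<in> ?C" "k \<in> ?C" for g h k
    using \<alpha> that by (auto simp: cocycles2_def)
  have left: "(x \<otimes>\<^bsub>?A\<^esub> y) k = (\<Sum>g\<in>?C. x g * y (inv\<^bsub>G\<^esub> g \<otimes>\<^bsub>G\<^esub> k) * \<alpha> (g, inv\<^bsub>G\<^esub> g \<otimes>\<^bsub>G\<^esub> k))"
    if k: "k \<in> ?C" for x y k
  proof -
    have "(\<Sum>(g, h)\<in>{(g, h). g \<in> ?C \<and> h \<in> ?C \<and> g \<otimes>\<^bsub>G\<^esub> h = k}. x g * y h * \<alpha> (g, h)) =
        (\<Sum>g\<in>?C. x g * y (inv\<^bsub>G\<^esub> g \<otimes>\<^bsub>G\<^esub> k) * \<alpha> (g, inv\<^bsub>G\<^esub> g \<otimes>\<^bsub>G\<^esub> k))"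
      by (rule sum.reindex_bij_witness [where i = "\<lambda>g. (g, inv\<^bsub>G\<^esub> g \<otimes>\<^bsub>G\<^esub> k)" and j = fst])
         (use k in \<open>auto simp flip: G.m_assoc\<close>)
    then show ?thesis
      using k by (simp add: twisted_group_algebra_def)
  qed
  have out: "(x \<otimes>\<^bsub>?A\<^esub> y) k = undefined" if "k \<notin> ?C" for x y k
    using that by (simp add: twisted_group_algebra_def)
  have carr: "x \<in> carrier ?A \<longleftrightarrow> x \<in> extensional ?C" for x
    by (simp add: twisted_group_algebra_def PiE_def)
  have ab: "abelian_group ?A"
  proof (rule abelian_groupI)
    fix x assume "x \<in> carrier ?A"
    then show "\<exists>y\<in>carrier ?A. y \<oplus>\<^bsub>?A\<^esub> x = \<zero>\<^bsub>?A\<^esub>"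
      by (intro bexI [of _ "\<lambda>k\<in>?C. - x k"])
         (auto simp: twisted_group_algebra_def fun_eq_iff restrict_def)
  qed (auto simp: twisted_group_algebra_def fun_eq_iff restrict_def PiE_iff extensional_def)
  have assoc: "((x \<otimes>\<^bsub>?A\<^esub> y) \<otimes>\<^bsub>?A\<^esub> z) k = (x \<otimes>\<^bsub>?A\<^esub> (y \<otimes>\<^bsub>?A\<^esub> z)) k"
    if k: "k \<in> ?C" for x y z k
  proof -
    let ?m = "\<lambda>g h. inv\<^bsub>G\<^esub> g \<otimes>\<^bsub>G\<^esub> h"
    have "((x \<otimes>\<^bsub>?A\<^esub> y) \<otimes>\<^bsub>?A\<^esub> z) k =
        (\<Sum>l\<in>?C. \<Sum>g\<in>?C. x g * y (?m g l) * \<alpha> (g, ?m g l) * z (?m l k) * \<alpha> (l, ?m l k))"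
      using k by (simp add: left sum_distrib_right)
    also have "\<dots> = (\<Sum>g\<in>?C. \<Sum>l\<in>?C. x g * y (?m g l) * \<alpha> (g, ?m g l) * z (?m l k) * \<alpha> (l, ?m l k))"
      by (rule sum.swap)
    also have "\<dots> = (\<Sum>g\<in>?C. \<Sum>h\<in>?C. x g * (y h * z (?m h (?m g k)) * \<alpha> (h, ?m h (?m g k))) * \<alpha> (g, ?m g k))"
    proof (rule sum.cong [OF refl])
      fix g assume g: "g \<in> ?C"
      show "(\<Sum>l\<in>?C. x g * y (?m g l) * \<alpha> (g, ?m g l) * z (?m l k) * \<alpha> (l, ?m l k)) =
        (\<Sum>h\<in>?C. x g * (y h * z (?m h (?m g k)) * \<alpha> (h, ?m h (?m g k))) * \<alpha> (g, ?m g k))"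
      proof (rule sum.reindex_bij_witness [where i = "\<lambda>h. g \<otimes>\<^bsub>G\<^esub> h" and j = "\<lambda>l. ?m g l"])
        fix l assume l: "l \<in> ?C"
        have e: "g \<otimes>\<^bsub>G\<^esub> ?m g l = l" "?m (?m g l) (?m g k) = ?m l k"
            "?m g l \<otimes>\<^bsub>G\<^esub> ?m l k = ?m g k"
          using g l k by (simp_all add: G.inv_mult_group G.m_assoc)
             (simp_all flip: G.m_assoc)
        have "\<alpha> (g, ?m g l) * \<alpha> (l, ?m l k) = \<alpha> (?m g l, ?m l k) * \<alpha> (g, ?m g k)"
          using coc [of g "?m g l" "?m l k"] g l k by (simp add: e)
        then show "x g * (y (?m g l) * z (?m (?m g l) (?m g k)) * \<alpha> (?m g l, ?m (?m g l) (?m g k))) *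
            \<alpha> (g, ?m g k) = x g * y (?m g l) * \<alpha> (g, ?m g l) * z (?m l k) * \<alpha> (l, ?m l k)"
          by (simp add: e mult_ac)
      qed (use g in \<open>auto simp flip: G.m_assoc\<close>)
    qed
    also have "\<dots> = (x \<otimes>\<^bsub>?A\<^esub> (y \<otimes>\<^bsub>?A\<^esub> z)) k"
      using k by (simp add: left sum_distrib_left sum_distrib_right mult_ac)
    finally show ?thesis .
  qed
  have a1: "\<alpha> (\<one>\<^bsub>G\<^esub>, k) = \<alpha> (\<one>\<^bsub>G\<^esub>, \<one>\<^bsub>G\<^esub>)" "\<alpha> (k, \<one>\<^bsub>G\<^esub>) = \<alpha> (\<one>\<^bsub>G\<^esub>, \<one>\<^bsub>G\<^esub>)" if "k \<in> ?C" for k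
    using coc [of "\<one>\<^bsub>G\<^esub>" "\<one>\<^bsub>G\<^esub>" k] coc [of k "\<one>\<^bsub>G\<^esub>" "\<one>\<^bsub>G\<^esub>"] that nz by auto
  have lone: "(\<one>\<^bsub>?A\<^esub> \<otimes>\<^bsub>?A\<^esub> x) k = x k" if k: "k \<in> ?C" for x k
  proof -
    have "(\<one>\<^bsub>?A\<^esub> \<otimes>\<^bsub>?A\<^esub> x) k = (\<Sum>g\<in>?C. if g = \<one>\<^bsub>G\<^esub> then x k else 0)"
      unfolding left [OF k]
      by (rule sum.cong) (use k nz in \<open>auto simp: twisted_group_algebra_def a1(1) [OF k]\<close>)
    then show ?thesis using fin by simp
  qed
  have rone: "(x \<otimes>\<^bsub>?A\<^esub> \<one>\<^bsub>?A\<^esub>) k = x k" if k: "k \<in> ?C" for x k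
  proof -
    have *: "inv\<^bsub>G\<^esub> g \<otimes>\<^bsub>G\<^esub> k = \<one>\<^bsub>G\<^esub> \<longleftrightarrow> g = k" if "g \<in> ?C" for g
      using that k by (metis G.inv_closed G.inv_equality G.inv_inv G.l_inv)
    have "(x \<otimes>\<^bsub>?A\<^esub> \<one>\<^bsub>?A\<^esub>) k = (\<Sum>g\<in>?C. if g = k then x k else 0)"
      unfolding left [OF k]
      by (rule sum.cong) (use k nz in \<open>auto simp: twisted_group_algebra_def a1(2) [OF k] *\<close>)
    then show ?thesis using fin k by simp
  qed
  have mon: "monoid ?A"
  proof (rule monoidI)
    fix x y z
    show "x \<otimes>\<^bsub>?A\<^esub> y \<in> carrier ?A" by (auto simp: carr extensional_def out)
    show "\<one>\<^bsub>?A\<^esub> \<in> carrier ?A" by (auto simp: twisted_group_algebra_def)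
    show "x \<otimes>\<^bsub>?A\<^esub> y \<otimes>\<^bsub>?A\<^esub> z = x \<otimes>\<^bsub>?A\<^esub> (y \<otimes>\<^bsub>?A\<^esub> z)"
      using assoc out by (metis ext)
    assume "x \<in> carrier ?A"
    then have x: "x k = undefined" if "k \<notin> ?C" for k
      using that by (auto simp: carr extensional_def)
    have "(\<one>\<^bsub>?A\<^esub> \<otimes>\<^bsub>?A\<^esub> x) k = x k" "(x \<otimes>\<^bsub>?A\<^esub> \<one>\<^bsub>?A\<^esub>) k = x k" for k
      by (cases "k \<in> ?C"; simp only: lone rone out x not_False_eq_True)+
    then show "\<one>\<^bsub>?A\<^esub> \<otimes>\<^bsub>?A\<^esub> x = x" "x \<otimes>\<^bsub>?A\<^esub> \<one>\<^bsub>?A\<^esub> = x"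
      by (simp_all only: fun_eq_iff simp_thms)
  qed
  have add: "(x \<oplus>\<^bsub>?A\<^esub> y) k = (if k \<in> ?C then x k + y k else undefined)" for x y k
    by (simp add: twisted_group_algebra_def)
  show ?thesis
  proof (rule ringI [OF ab mon])
    fix x y z
    have "((x \<oplus>\<^bsub>?A\<^esub> y) \<otimes>\<^bsub>?A\<^esub> z) k = (x \<otimes>\<^bsub>?A\<^esub> z \<oplus>\<^bsub>?A\<^esub> y \<otimes>\<^bsub>?A\<^esub> z) k"
         "(z \<otimes>\<^bsub>?A\<^esub> (x \<oplus>\<^bsub>?A\<^esub> y)) k = (z \<otimes>\<^bsub>?A\<^esub> x \<oplus>\<^bsub>?A\<^esub> z \<otimes>\<^bsub>?A\<^esub> y) k" for k
      by (cases "k \<in> ?C"; simp add: left out add ring_distribs sum.distrib)+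
    then show "(x \<oplus>\<^bsub>?A\<^esub> y) \<otimes>\<^bsub>?A\<^esub> z = x \<otimes>\<^bsub>?A\<^esub> z \<oplus>\<^bsub>?A\<^esub> y \<otimes>\<^bsub>?A\<^esub> z"
        "z \<otimes>\<^bsub>?A\<^esub> (x \<oplus>\<^bsub>?A\<^esub> y) = z \<otimes>\<^bsub>?A\<^esub> x \<oplus>\<^bsub>?A\<^esub> z \<otimes>\<^bsub>?A\<^esub> y"
      by (simp_all only: fun_eq_iff simp_thms)
  qed
qed

lemma twisted_group_algebra_basis_mult:
  assumes "group G" "finite (carrier G)" "g \<in> carrier G" "h \<in> carrier G"
  defines "u \<equiv> \<lambda>g. \<lambda>k\<in>carrier G. if k = g then 1 else 0"
  shows "u g \<otimes>\<^bsub>twisted_group_algebra G \<alpha>\<^esub> u h =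
           \<alpha> (g, h) \<odot>\<^bsub>twisted_group_algebra G \<alpha>\<^esub> u (g \<otimes>\<^bsub>G\<^esub> h)"
proof -
  interpret G: group G by fact
  have "(\<Sum>(a, b)\<in>{(a, b). a \<in> carrier G \<and> b \<in> carrier G \<and> a \<otimes>\<^bsub>G\<^esub> b = k}. u g a * u h b * \<alpha> (a, b)) =
      \<alpha> (g, h) * u (g \<otimes>\<^bsub>G\<^esub> h) k" (is "?l = _") if "k \<in> carrier G" for k
  proof -
    let ?S = "{(a, b). a \<in> carrier G \<and> b \<in> carrier G \<and> a \<otimes>\<^bsub>G\<^esub> b = k}"
    have "finite ?S"
      by (rule finite_subset [of _ "carrier G \<times> carrier G"]) (use assms in auto)
    moreover have "?l = (\<Sum>i\<in>?S. if i = (g, h) then \<alpha> (g, h) else 0)"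
      by (rule sum.cong) (auto simp: u_def split: if_splits)
    ultimately show ?thesis
      using assms that by (auto simp: u_def)
  qed
  then show ?thesis
    by (auto simp: twisted_group_algebra_def intro!: restrict_ext)
qed

lemma algebra_isomorphic_cohomologous:
  assumes "group G" and f: "f \<in> carrier (cochains1 G)"
  shows "algebra_isomorphic
           (twisted_group_algebra G (\<alpha> \<otimes>\<^bsub>cochains2 G\<^esub> coboundary G f)) (twisted_group_algebra G \<alpha>)"
    (is "algebra_isomorphic ?A ?B")
proof -
  interpret G: group G by fact
  note nz = cochain1_nonzero [OF f]
  define \<phi> where "\<phi> x = (\<lambda>g\<in>carrier G. f g * x g)" for x :: "'a \<Rightarrow> complex"
  have mult: "\<phi> (x \<otimes>\<^bsub>?A\<^esub> y) = \<phi> x \<otimes>\<^bsub>?B\<^esub> \<phi> y" for x y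
    using nz by (auto simp: \<phi>_def twisted_group_algebra_def cochains2_def coboundary_def
        fun_eq_iff restrict_def sum_distrib_left case_prod_unfold intro!: sum.cong)
  have hom: "\<phi> \<in> ring_hom ?A ?B"
  proof (rule ring_hom_memI)
    show "\<phi> \<one>\<^bsub>?A\<^esub> = \<one>\<^bsub>?B\<^esub>"
      using nz by (auto simp: \<phi>_def twisted_group_algebra_def cochains2_def coboundary_def
          fun_eq_iff restrict_def)
  qed (auto simp: mult, auto simp: \<phi>_def twisted_group_algebra_def fun_eq_iff restrict_def
         distrib_left)
  have "bij_betw \<phi> (carrier ?A) (carrier ?B)"
    by (rule bij_betw_byWitness [where f' = "\<lambda>x. \<lambda>g\<in>carrier G. x g / f g"])
       (use nz in \<open>auto simp: \<phi>_def twisted_group_algebra_def fun_eq_iff restrict_def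
          PiE_iff extensional_def\<close>)
  with hom have "\<phi> \<in> ring_iso ?A ?B" by (simp add: ring_iso_def)
  moreover have "\<phi> (c \<odot>\<^bsub>?A\<^esub> x) = c \<odot>\<^bsub>?B\<^esub> \<phi> x" for c x
    by (auto simp: \<phi>_def twisted_group_algebra_def fun_eq_iff restrict_def)
  ultimately show ?thesis
    by (auto simp: algebra_isomorphic_def)
qed

end

theory Submission
  imports Defs
begin

text \<open>For a central subgroup \<open>K = \<langle>z\<rangle>\<close> of order \<open>p\<close>, a cocycle \<open>\<alpha>\<close> defines a pairing
  \<open>\<epsilon>(g, z) = \<alpha>(g, z) / \<alpha>(z, g)\<close>, a character of \<open>G\<close> in \<open>g\<close>, and the classes with trivial pairing are
  inflated from \<open>G/K\<close>. If \<open>A\<close> is the common kernel of these characters, this gives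
  \<open>|M(G)| |A| \<le> |M(G/K)| |G|\<close>, with an additional factor \<open>p\<close> on the left if \<open>K \<le> G'\<close>. Since
  \<open>\<epsilon>(g, g\<^sup>i) = 1\<close> and \<open>\<epsilon>(c, [a, b]) = 1\<close> for \<open>c\<close> commuting with \<open>a\<close> and \<open>b\<close>, induction on
  the order bounds \<open>|M(G)|\<close>, and for corank 0 or 1 nearly every estimate is sharp. If \<open>|G'| = p\<close>, this
  forces \<open>G\<close> to be the product of an elementary abelian group and the extraspecial group of order
  \<open>p\<^sup>3\<close> and exponent \<open>p\<close> (the dihedral group of order 8 for \<open>p = 2\<close>); otherwise \<open>|G| = p\<^sup>5\<close>
  and \<open>G = (\<int>/p)\<^sup>4 \<rtimes> \<int>/p\<close>. The two cases have different \<open>|G'|\<close>, which can be read off from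
  the number of algebra homomorphisms \<open>\<complex>G \<rightarrow> \<complex>\<close>.\<close>


section \<open>Finite \<open>p\<close>-groups\<close>

text \<open>The twist relation enters through two consequences: the multipliers have equal order,
  and CG and CH are isomorphic since trivial classes correspond. Coranks 0 and 1 both give |M(G)| >=
  p^C(n-1,2), and the classification starts from this inequality. If |G'| = p, the quotient by G' is
  abelian, and A contains the common centralizer of any noncommuting pair, whose order is at least
  p^(n-2). So |M(G)| <= p^(C(n-1,2)+1), which leaves one factor p of slack. If |G'| > p, a central z
  of order p in G' gives a nonabelian quotient, A contains G', and |M(G)| <= p^C(n-1,2): there is no
  slack, whatever z is chosen. Comparing different z then determines the group. Isomorphisms are
  built without presentations. Both families are described by a chain of subgroups, each obtained
  from the previous one by adjoining an element of order p, and an embedding is extended along the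
  chain. This needs generators of order p; finding them is where p = 2 differs from odd p.\<close>

definition center :: "('a, 'm) monoid_scheme \<Rightarrow> 'a set" where
  "center G = {z \<in> carrier G. \<forall>g\<in>carrier G. g \<otimes>\<^bsub>G\<^esub> z = z \<otimes>\<^bsub>G\<^esub> g}"

definition centralizer :: "('a, 'm) monoid_scheme \<Rightarrow> 'a \<Rightarrow> 'a set" where
  "centralizer G a = {g \<in> carrier G. g \<otimes>\<^bsub>G\<^esub> a = a \<otimes>\<^bsub>G\<^esub> g}"

definition commutator :: "('a, 'm) monoid_scheme \<Rightarrow> 'a \<Rightarrow> 'a \<Rightarrow> 'a" where
  "commutator G g h = g \<otimes>\<^bsub>G\<^esub> h \<otimes>\<^bsub>G\<^esub> inv\<^bsub>G\<^esub> g \<otimes>\<^bsub>G\<^esub> inv\<^bsub>G\<^esub> h"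

definition powers :: "('a, 'm) monoid_scheme \<Rightarrow> 'a \<Rightarrow> 'a set" where
  "powers G x = range (\<lambda>i::nat. x [^]\<^bsub>G\<^esub> i)"

text \<open>For normal \<open>S\<close> this is the subgroup generated by \<open>S\<close> and
  \<open>x\<close>; natural exponents suffice in a finite group. Characters and embeddings are
  extended along such steps.\<close>

definition adjoin :: "('a, 'm) monoid_scheme \<Rightarrow> 'a set \<Rightarrow> 'a \<Rightarrow> 'a set" where
  "adjoin G S x = (\<lambda>(s, i::nat). s \<otimes>\<^bsub>G\<^esub> x [^]\<^bsub>G\<^esub> i) ` (S \<times> UNIV)"

lemma card_le_fibers:
  assumes "finite A" "finite B" "f ` A \<subseteq> B" and "\<And>b. b \<in> B \<Longrightarrow> card {a \<in> A. f a = b} \<le> k"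
  shows "card A \<le> card B * k"
proof -
  have "A = (\<Union>b\<in>B. {a \<in> A. f a = b})"
    using assms(3) by auto
  then have "card A \<le> (\<Sum>b\<in>B. card {a \<in> A. f a = b})"
    by (metis (no_types) assms(2) card_UN_le)
  also have "\<dots> \<le> card B * k"
    using sum_bounded_above [of B "\<lambda>b. card {a \<in> A. f a = b}" k] assms(4) by simp
  finally show ?thesis .
qed

section \<open>Commutators, centralizers and the center\<close>

context group
begin

lemma cancel_inv [simp]:
  "x \<in> carrier G \<Longrightarrow> y \<in> carrier G \<Longrightarrow> inv x \<otimes> (x \<otimes> y) = y"
  "x \<in> carrier G \<Longrightarrow> y \<in> carrier G \<Longrightarrow> x \<otimes> (inv x \<otimes> y) = y"
  by (simp_all flip: m_assoc)

lemma commutator_closed [simp, intro]: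
  "g \<in> carrier G \<Longrightarrow> h \<in> carrier G \<Longrightarrow> commutator G g h \<in> carrier G"
  by (simp add: commutator_def)

lemma commutator_mult:
  "g \<in> carrier G \<Longrightarrow> h \<in> carrier G \<Longrightarrow> g \<otimes> h = commutator G g h \<otimes> (h \<otimes> g)"
  by (simp add: commutator_def m_assoc)

lemma commutator_eqI:
  assumes "g \<in> carrier G" "h \<in> carrier G" "z \<in> carrier G" "g \<otimes> h = z \<otimes> (h \<otimes> g)"
  shows "commutator G g h = z"
  using assms by (simp add: commutator_def m_assoc)

lemma commutator_eq_one_iff:
  "g \<in> carrier G \<Longrightarrow> h \<in> carrier G \<Longrightarrow> commutator G g h = \<one> \<longleftrightarrow> g \<otimes> h = h \<otimes> g"
  by (metis commutator_eqI commutator_mult l_one m_closed one_closed)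

lemma commutator_in_derived:
  "g \<in> carrier G \<Longrightarrow> h \<in> carrier G \<Longrightarrow> commutator G g h \<in> derived G (carrier G)"
  unfolding derived_def commutator_def by (rule generate.incl) auto

lemma derived_subsetI:
  assumes "subgroup S G" "\<And>g h. g \<in> carrier G \<Longrightarrow> h \<in> carrier G \<Longrightarrow> commutator G g h \<in> S"
  shows "derived G (carrier G) \<subseteq> S"
  unfolding derived_def
  by (rule generate_subgroup_incl [OF _ assms(1)]) (use assms(2) in \<open>auto simp: commutator_def\<close>)

lemma subgroup_derived: "subgroup (derived G (carrier G)) G"
  by (rule derived_is_subgroup) simp

lemma subgroup_centralizer:
  assumes "a \<in> carrier G" shows "subgroup (centralizer G a) G"
proof (rule subgroupI)
  fix g assume g: "g \<in> centralizer G a"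
  then have "inv g \<otimes> (g \<otimes> a) \<otimes> inv g = inv g \<otimes> (a \<otimes> g) \<otimes> inv g"
    by (simp add: centralizer_def)
  then show "inv g \<in> centralizer G a"
    using g assms by (clarsimp simp add: centralizer_def m_assoc) (metis cancel_inv(1) inv_closed m_assoc m_closed r_inv r_one)
next
  fix g h assume "g \<in> centralizer G a" "h \<in> centralizer G a"
  then show "g \<otimes> h \<in> centralizer G a"
    using assms by (auto simp: centralizer_def m_assoc) (metis m_assoc)
qed (use assms in \<open>auto simp: centralizer_def\<close>)

lemma centerI: "z \<in> carrier G \<Longrightarrow> (\<And>g. g \<in> carrier G \<Longrightarrow> g \<otimes> z = z \<otimes> g) \<Longrightarrow> z \<in> center G"
  unfolding center_def by blast

lemma center_closed: "z \<in> center G \<Longrightarrow> z \<in> carrier G"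
  unfolding center_def by blast

lemma center_comm: "z \<in> center G \<Longrightarrow> g \<in> carrier G \<Longrightarrow> g \<otimes> z = z \<otimes> g"
  unfolding center_def by blast

lemma centralizer_iff: "g \<in> centralizer G a \<longleftrightarrow> g \<in> carrier G \<and> g \<otimes> a = a \<otimes> g"
  unfolding centralizer_def by blast

lemma center_in_centralizer: "z \<in> center G \<Longrightarrow> a \<in> carrier G \<Longrightarrow> z \<in> centralizer G a"
  by (metis center_closed center_comm centralizer_iff)

lemma subgroup_center: "subgroup (center G) G"
proof (rule subgroupI)
  fix x assume x: "x \<in> center G"
  show "inv x \<in> center G"
  proof (rule centerI)
    show "inv x \<in> carrier G" using center_closed [OF x] by simp
    fix g assume g: "g \<in> carrier G"
    from subgroup.m_inv_closed [OF subgroup_centralizer [OF g] center_in_centralizer [OF x g]]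
    show "g \<otimes> inv x = inv x \<otimes> g" by (simp add: centralizer_def)
  qed
next
  fix x y assume xy: "x \<in> center G" "y \<in> center G"
  show "x \<otimes> y \<in> center G"
  proof (rule centerI)
    show "x \<otimes> y \<in> carrier G" using xy [THEN center_closed] by simp
    fix g assume g: "g \<in> carrier G"
    from subgroup.m_closed [OF subgroup_centralizer [OF g] xy [THEN center_in_centralizer [OF _ g]]]
    show "g \<otimes> (x \<otimes> y) = x \<otimes> y \<otimes> g" by (simp add: centralizer_def)
  qed
next
  show "center G \<subseteq> carrier G" using center_closed by blast
  show "center G \<noteq> {}" using centerI [of \<one>] by auto
qed

lemma normal_of_central:
  assumes "subgroup S G" "S \<subseteq> center G" shows "S \<lhd> G"
proof (rule normal_invI [OF assms(1)])
  fix x h assume x: "x \<in> carrier G" and h: "h \<in> S"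
  then have "h \<in> center G" using assms by auto
  then have "x \<otimes> h \<otimes> inv x = h"
    using x by (simp add: center_comm [OF _ x] m_assoc center_closed)
  then show "x \<otimes> h \<otimes> inv x \<in> S" using h by simp
qed

lemma normal_of_derived:
  assumes "subgroup S G" "derived G (carrier G) \<subseteq> S" shows "S \<lhd> G"
proof (rule normal_invI [OF assms(1)])
  fix x h assume x: "x \<in> carrier G" and h: "h \<in> S"
  then have hc: "h \<in> carrier G" using assms(1) subgroup.mem_carrier by metis
  have "commutator G x h \<otimes> h \<in> S"
    using commutator_in_derived [OF x hc] assms h by (meson subgroup.m_closed subsetD)
  then show "x \<otimes> h \<otimes> inv x \<in> S"
    using x hc by (simp add: commutator_def m_assoc)
qed

text \<open>In a finite group the inverse of \<open>x\<close> is its power with exponent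
  \<open>ord x - 1\<close>, so closure under products already gives inverses.\<close>

lemma finite_subgroupI:
  assumes "finite (carrier G)" "S \<subseteq> carrier G" "\<one> \<in> S"
    and "\<And>x y. x \<in> S \<Longrightarrow> y \<in> S \<Longrightarrow> x \<otimes> y \<in> S"
  shows "subgroup S G"
proof (rule subgroupI)
  fix x assume x: "x \<in> S"
  then have xc: "x \<in> carrier G" using assms by auto
  have pw: "x [^] (i::nat) \<in> S" for i
    by (induction i) (use assms x in auto)
  have "ord x > 0" using ord_ge_1 [OF assms(1) xc] by simp
  then have "x \<otimes> x [^] (ord x - 1) = \<one>"
    using xc by (metis Suc_pred' nat_pow_Suc2 pow_ord_eq_1)
  then have "inv x = x [^] (ord x - 1)"
    using xc by (metis inv_equality inv_comm nat_pow_closed)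
  then show "inv x \<in> S" using pw by simp
qed (use assms in auto)

section \<open>Cyclic subgroups and adjoining one element\<close>

lemma powers_subset_carrier: "x \<in> carrier G \<Longrightarrow> powers G x \<subseteq> carrier G"
  by (auto simp: powers_def)

lemma subgroup_powers:
  assumes "finite (carrier G)" "x \<in> carrier G" shows "subgroup (powers G x) G"
proof (rule finite_subgroupI [OF assms(1)])
  show "\<one> \<in> powers G x" unfolding powers_def by (rule image_eqI [of _ _ 0]) auto
qed (use assms in \<open>auto simp: powers_def nat_pow_mult\<close>)

lemma powers_in_subgroup:
  assumes "subgroup S G" "x \<in> S" shows "powers G x \<subseteq> S"
proof -
  have "x [^] (i::nat) \<in> S" for i
    by (induction i) (use assms in \<open>auto intro: subgroup.m_closed subgroup.one_closed\<close>)
  then show ?thesis by (auto simp: powers_def)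
qed

lemma subgroup_nat_pow_closed:
  "subgroup S G \<Longrightarrow> x \<in> S \<Longrightarrow> x [^] (i::nat) \<in> S"
  using powers_in_subgroup [of S x] by (auto simp: powers_def)

lemma adjoin_mem:
  "s \<in> S \<Longrightarrow> s \<otimes> x [^] (i::nat) \<in> adjoin G S x"
  by (auto simp: adjoin_def)

lemma subset_adjoin:
  assumes "S \<subseteq> carrier G" shows "S \<subseteq> adjoin G S x"
proof
  fix s assume "s \<in> S"
  then show "s \<in> adjoin G S x" using adjoin_mem [of s S x 0] assms by auto
qed

lemma self_in_adjoin:
  assumes "\<one> \<in> S" "x \<in> carrier G" shows "x \<in> adjoin G S x"
  using adjoin_mem [OF assms(1), of x 1] assms by simp

lemma pow_conj_normal:
  assumes "S \<lhd> G" "x \<in> carrier G" "s \<in> S"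
  shows "x [^] (i::nat) \<otimes> s \<otimes> inv (x [^] i) \<in> S"
  using normal_invE(2) [OF assms(1)] assms by simp

lemma adjoin_subset_carrier:
  "S \<subseteq> carrier G \<Longrightarrow> x \<in> carrier G \<Longrightarrow> adjoin G S x \<subseteq> carrier G"
  by (auto simp: adjoin_def)

lemma adjoin_mult:
  assumes "x \<in> carrier G" "s \<in> carrier G" "t \<in> carrier G"
  shows "(s \<otimes> x [^] (i::nat)) \<otimes> (t \<otimes> x [^] (j::nat)) =
    (s \<otimes> (x [^] i \<otimes> t \<otimes> inv (x [^] i))) \<otimes> x [^] (i + j)"
  using assms by (simp add: m_assoc flip: nat_pow_mult)

lemma subgroup_adjoin:
  assumes "finite (carrier G)" "S \<lhd> G" "x \<in> carrier G"
  shows "subgroup (adjoin G S x) G"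
proof -
  interpret S: normal S G by fact
  show ?thesis
  proof (rule finite_subgroupI [OF assms(1)])
    show "adjoin G S x \<subseteq> carrier G" by (rule adjoin_subset_carrier [OF S.subset assms(3)])
    show "\<one> \<in> adjoin G S x" using subset_adjoin [OF S.subset] S.one_closed by blast
    fix u v assume "u \<in> adjoin G S x" "v \<in> adjoin G S x"
    then obtain s i t j where "s \<in> S" "t \<in> S" "u = s \<otimes> x [^] (i::nat)" "v = t \<otimes> x [^] (j::nat)"
      by (auto simp: adjoin_def)
    then show "u \<otimes> v \<in> adjoin G S x"
      using adjoin_mult assms(3) pow_conj_normal [OF assms(2,3)] by (simp add: adjoin_mem)
  qed
qed

text \<open>If \<open>p\<close> does not divide \<open>k\<close>, Bezout coefficients
  \<open>k * a = p * b + 1\<close> express \<open>x\<close> through \<open>x [^] k\<close> and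
  \<open>x [^] p\<close>, which would put \<open>x\<close> itself into \<open>S\<close>.\<close>

lemma pow_prime_mem_iff:
  assumes "finite (carrier G)" "subgroup S G" "x \<in> carrier G" "x \<notin> S" "x [^] (p::nat) \<in> S" "Factorial_Ring.prime p"
  shows "x [^] (k::nat) \<in> S \<longleftrightarrow> p dvd k"
proof
  assume k: "x [^] k \<in> S"
  show "p dvd k"
  proof (rule ccontr)
    assume "\<not> p dvd k"
    then have "coprime k p"
      using assms(6) by (metis coprime_commute prime_imp_coprime)
    moreover have "p > 0" using assms(6) prime_gt_0_nat by auto
    ultimately have "k \<noteq> 0" using assms(6) by (metis coprime_0_left_iff nat_dvd_1_iff_1 not_prime_1 is_unit_gcd)
    from bezout_nat [OF this, of p] \<open>coprime k p\<close> obtain a b where ab: "k * a = p * b + 1"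
      by auto
    have "x [^] (k * a) \<in> S" "x [^] (p * b) \<in> S"
      using subgroup_nat_pow_closed [OF assms(2)] k assms(3,5) by (simp_all flip: nat_pow_pow)
    then have "inv (x [^] (p * b)) \<otimes> x [^] (k * a) \<in> S"
      using assms(2) by (metis subgroup.m_closed subgroup.m_inv_closed)
    moreover have "inv (x [^] (p * b)) \<otimes> x [^] (k * a) = x"
      unfolding ab using assms(3) by (simp flip: nat_pow_mult)
    ultimately show False using assms(4) by simp
  qed
next
  assume "p dvd k"
  then obtain m where "k = p * m" by blast
  then show "x [^] k \<in> S"
    using subgroup_nat_pow_closed [OF assms(2,5), of m] assms(3) by (simp add: nat_pow_pow)
qed

text \<open>The only ambiguity in writing an element as a member of \<open>S\<close> times a power
  of \<open>x\<close> is a power of \<open>x [^] p\<close> moved into \<open>S\<close>. This yields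
  both the size of \<open>adjoin\<close> and the well-definedness of maps on it.\<close>

lemma adjoin_repr_eq_iff:
  assumes "finite (carrier G)" "subgroup S G" "x \<in> carrier G" "x \<notin> S" "x [^] (p::nat) \<in> S" "Factorial_Ring.prime p"
    and "s \<in> S" "t \<in> S" "i \<le> j" "s \<otimes> x [^] (i::nat) = t \<otimes> x [^] (j::nat)"
  shows "p dvd j - i" "s = t \<otimes> x [^] (j - i)"
proof -
  have st: "s \<in> carrier G" "t \<in> carrier G" using assms(2,7,8) subgroup.mem_carrier by metis+
  have "t \<otimes> x [^] j = t \<otimes> x [^] (j - i) \<otimes> x [^] i"
    using assms(3,9) st by (simp add: m_assoc nat_pow_mult)
  then show s: "s = t \<otimes> x [^] (j - i)"
    using assms(3,10) st by (metis m_closed nat_pow_closed r_cancel)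
  have "inv t \<otimes> s \<in> S" using assms(2,7,8) by (metis subgroup.m_closed subgroup.m_inv_closed)
  then have "x [^] (j - i) \<in> S" using s st assms(3) by simp
  then show "p dvd j - i"
    using pow_prime_mem_iff [OF assms(1-6)] by blast
qed

text \<open>Division of exponents by \<open>p\<close> with remainder moves the quotient part into
  \<open>S\<close>, so the set is the disjoint union of the cosets of \<open>S\<close> given by the
  powers of \<open>x\<close> with exponents below \<open>p\<close>.\<close>

lemma card_adjoin:
  assumes fin: "finite (carrier G)" and S: "subgroup S G" and x: "x \<in> carrier G" "x \<notin> S" "x [^] (p::nat) \<in> S"
    and p: "Factorial_Ring.prime p"
  shows "card (adjoin G S x) = p * card S"
proof -
  have "adjoin G S x = (\<lambda>(s, i). s \<otimes> x [^] i) ` (S \<times> {..<p})"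
  proof safe
    fix w assume "w \<in> adjoin G S x"
    then obtain s i where w: "s \<in> S" "w = s \<otimes> x [^] (i::nat)" by (auto simp: adjoin_def)
    have sc: "s \<in> carrier G" using S w subgroup.mem_carrier by metis
    have "x [^] i = (x [^] p) [^] (i div p) \<otimes> x [^] (i mod p)"
      using x by (simp add: nat_pow_pow nat_pow_mult)
    then have "w = (s \<otimes> (x [^] p) [^] (i div p)) \<otimes> x [^] (i mod p)"
      using w x sc by (simp add: m_assoc)
    moreover have "s \<otimes> (x [^] p) [^] (i div p) \<in> S"
      using subgroup_nat_pow_closed [OF S x(3)] w S by (simp add: subgroup.m_closed)
    moreover have "i mod p < p" using p prime_gt_0_nat by simp
    ultimately show "w \<in> (\<lambda>(s, i). s \<otimes> x [^] i) ` (S \<times> {..<p})"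
      by (intro image_eqI [of _ _ "(s \<otimes> (x [^] p) [^] (i div p), i mod p)"]) auto
  qed (auto simp: adjoin_def)
  moreover have "inj_on (\<lambda>(s, i). s \<otimes> x [^] i) (S \<times> {..<p})"
  proof -
    have *: "s = t \<and> i = j" if "s \<in> S" "t \<in> S" "i \<le> j" "j < p" "s \<otimes> x [^] i = t \<otimes> x [^] j" for s t i j
    proof -
      have "p dvd j - i" "s = t \<otimes> x [^] (j - i)"
        using adjoin_repr_eq_iff [OF fin S x p] that by auto
      moreover have "j - i = 0" using \<open>p dvd j - i\<close> that by (meson dvd_imp_le leD less_imp_diff_less neq0_conv)
      ultimately show ?thesis using that S subgroup.mem_carrier [OF S] by simp
    qed
    show ?thesis
      by (rule inj_onI) (auto, (metis * nle_le)+)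
  qed
  ultimately show ?thesis
    by (simp add: card_image card_cartesian_product)
qed

section \<open>Counting with cosets, conjugates and intersections\<close>

lemma card_le_cosets:
  assumes "finite (carrier G)" "subgroup C G" "A \<subseteq> carrier G" "finite B" "f ` A \<subseteq> B"
    and "\<And>g h. g \<in> A \<Longrightarrow> h \<in> A \<Longrightarrow> f g = f h \<Longrightarrow> inv g \<otimes> h \<in> C"
  shows "card A \<le> card B * card C"
proof (rule card_le_fibers [OF finite_subset [OF assms(3,1)] assms(4,5)])
  fix b assume "b \<in> B"
  have finC: "finite C" using assms(1,2) by (meson finite_subset subgroup.subset)
  show "card {a \<in> A. f a = b} \<le> card C"
  proof (cases "\<exists>g\<in>A. f g = b")
    case True
    then obtain g where g: "g \<in> A" "f g = b" by blast
    have "(\<lambda>h. inv g \<otimes> h) ` {a \<in> A. f a = b} \<subseteq> C" using assms(6) g by auto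
    moreover have "inj_on (\<lambda>h. inv g \<otimes> h) {a \<in> A. f a = b}"
      using g assms(3) by (intro inj_onI) (metis (mono_tags, lifting) l_cancel inv_closed mem_Collect_eq subsetD)
    ultimately show ?thesis using card_inj_on_le finC by blast
  next
    case False
    then have "{a \<in> A. f a = b} = {}" by auto
    then show ?thesis by (simp only: card.empty)
  qed
qed

text \<open>Orbit-stabilizer: since \<open>g a g^-1 = [g,a] a\<close>, there are at most
  \<open>card B\<close> conjugates of \<open>a\<close> under \<open>A\<close>, and elements giving
  the same conjugate lie in one left coset of the centralizer.\<close>

lemma order_le_centralizer:
  assumes "finite (carrier G)" "a \<in> carrier G" "A \<subseteq> carrier G" "subgroup A G" "finite B"
    "\<And>g. g \<in> A \<Longrightarrow> commutator G g a \<in> B"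
  shows "card A \<le> card B * card (A \<inter> centralizer G a)"
proof (rule card_le_cosets [OF assms(1) _ assms(3,5)])
  show "subgroup (A \<inter> centralizer G a) G"
    using assms(2,4) subgroup_centralizer subgroups_Inter_pair by blast
  fix g h assume gh: "g \<in> A" "h \<in> A" "commutator G g a = commutator G h a"
  then have c: "g \<in> carrier G" "h \<in> carrier G" using assms(3) by auto
  have "g \<otimes> a \<otimes> inv g = h \<otimes> a \<otimes> inv h"
    using gh(3) c assms(2) unfolding commutator_def by (metis inv_closed m_closed r_cancel)
  then have "inv g \<otimes> (g \<otimes> a \<otimes> inv g) \<otimes> h = inv g \<otimes> (h \<otimes> a \<otimes> inv h) \<otimes> h" by simp
  then have "a \<otimes> (inv g \<otimes> h) = inv g \<otimes> h \<otimes> a"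
    using c assms(2) by (simp add: m_assoc)
  then show "inv g \<otimes> h \<in> A \<inter> centralizer G a"
    using gh c assms(4) by (auto simp: centralizer_def subgroup.m_closed subgroup.m_inv_closed)
qed (use assms in auto)

text \<open>The product map on pairs takes values in \<open>S\<close>. Pairs with the same product
  differ by an element of the intersection, because \<open>a0 b0 = a b\<close> gives
  \<open>a0^-1 a = b0 b^-1\<close>.\<close>

lemma card_mult_le_inter:
  assumes "finite (carrier G)" "subgroup A G" "subgroup B G" "subgroup S G" "A \<subseteq> S" "B \<subseteq> S"
  shows "card A * card B \<le> card S * card (A \<inter> B)"
proof -
  have sub: "A \<subseteq> carrier G" "B \<subseteq> carrier G" "S \<subseteq> carrier G" using assms subgroup.subset by metis+
  have fin: "finite A" "finite B" "finite S" using sub assms(1) finite_subset by metis+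
  have "card (A \<times> B) \<le> card S * card (A \<inter> B)"
  proof (rule card_le_fibers [where f = "\<lambda>(a, b). a \<otimes> b"])
    show "(\<lambda>(a, b). a \<otimes> b) ` (A \<times> B) \<subseteq> S"
      using assms by (auto intro: subgroup.m_closed)
    fix s assume "s \<in> S"
    let ?F = "{x \<in> A \<times> B. (case x of (a, b) \<Rightarrow> a \<otimes> b) = s}"
    show "card ?F \<le> card (A \<inter> B)"
    proof (cases "?F = {}")
      case False
      then obtain a0 b0 where 0: "a0 \<in> A" "b0 \<in> B" "a0 \<otimes> b0 = s" by auto
      have *: "inv a0 \<otimes> a = b0 \<otimes> inv b" if "a \<in> A" "b \<in> B" "a \<otimes> b = s" for a b
      proof -
        have c: "a \<in> carrier G" "b \<in> carrier G" "a0 \<in> carrier G" "b0 \<in> carrier G"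
          using sub that 0 by auto
        have "inv a0 \<otimes> (a \<otimes> b) \<otimes> inv b = inv a0 \<otimes> (a0 \<otimes> b0) \<otimes> inv b"
          using that 0 by simp
        then show ?thesis using c by (simp add: m_assoc)
      qed
      have "(\<lambda>(a, b). inv a0 \<otimes> a) ` ?F \<subseteq> A \<inter> B"
      proof safe
        fix a b assume ab: "a \<in> A" "b \<in> B" "s = a \<otimes> b"
        show "inv a0 \<otimes> a \<in> A" using ab 0 assms(2) by (simp add: subgroup.m_closed subgroup.m_inv_closed)
        show "inv a0 \<otimes> a \<in> B" using * [of a b] ab 0 assms(3) by (simp add: subgroup.m_closed subgroup.m_inv_closed)
      qed
      moreover have "inj_on (\<lambda>(a, b). inv a0 \<otimes> a) ?F"
      proof (rule inj_onI, clarify)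
        fix a b a' b'
        assume h: "a \<in> A" "b \<in> B" "a' \<in> A" "b' \<in> B" "inv a0 \<otimes> a = inv a0 \<otimes> a'"
          "a' \<otimes> b' = a \<otimes> b" "s = a \<otimes> b"
        have c: "a \<in> carrier G" "b \<in> carrier G" "a' \<in> carrier G" "b' \<in> carrier G" "a0 \<in> carrier G"
          using sub h 0 by auto
        then have "a = a'" using h by simp
        then show "a = a' \<and> b = b'" using h c by simp
      qed
      ultimately show ?thesis using card_inj_on_le fin by blast
    qed (metis card.empty le0)
  qed (use fin in auto)
  then show ?thesis by (simp add: card_cartesian_product)
qed

end

section \<open>Elements of order p and the center of a p-group\<close>

locale p_group = group G for G (structure) + fixes p n :: nat
  assumes prime_p: "Factorial_Ring.prime p" and order_G: "order G = p ^ n"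
begin

lemma p_pos: "p > 0" using prime_p prime_gt_0_nat by auto

lemma finite_carrier: "finite (carrier G)"
  using order_G p_pos unfolding order_def by (metis card.infinite less_numeral_extra(3) zero_less_power)

lemma finite_subset_carrier: "S \<subseteq> carrier G \<Longrightarrow> finite S"
  using finite_carrier finite_subset by auto

lemma card_subgroup_dvd: "subgroup S G \<Longrightarrow> card S dvd p ^ n"
  using lagrange order_G by (metis dvd_triv_right)

lemma card_subgroup:
  assumes "subgroup S G" obtains k where "k \<le> n" "card S = p ^ k"
  using card_subgroup_dvd [OF assms] divides_primepow_nat [OF prime_p] by auto

lemma p_dvd_card_subgroup:
  assumes "subgroup S G" "S \<noteq> {\<one>}" shows "p dvd card S"
proof -
  obtain k where k: "card S = p ^ k" using card_subgroup [OF assms(1)] by blast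
  have "k \<noteq> 0"
  proof
    assume "k = 0"
    with k have "card S = 1" by simp
    then obtain x where "S = {x}" by (metis card_1_singletonE)
    then show False using assms subgroup.one_closed by blast
  qed
  then show ?thesis using k by (simp add: dvd_power)
qed

lemma pow_order_one: "x \<in> carrier G \<Longrightarrow> x [^] (p ^ n) = \<one>"
  using pow_order_eq_1 order_G finite_carrier by metis

text \<open>The least \<open>m\<close> with \<open>x [^] (p ^ m)\<close> in \<open>S\<close> is
  positive, and its predecessor gives an element just outside \<open>S\<close>, ready to be
  adjoined.\<close>

lemma exists_pow_prime:
  assumes "subgroup S G" "x \<in> carrier G" "x \<notin> S"
  obtains k where "x [^] (p ^ k) \<notin> S" "(x [^] (p ^ k)) [^] p \<in> S"
proof -
  define m where "m = (LEAST m. x [^] (p ^ m) \<in> S)"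
  have ex: "x [^] (p ^ n) \<in> S"
    using pow_order_one [OF assms(2)] subgroup.one_closed [OF assms(1)] by simp
  then have m: "x [^] (p ^ m) \<in> S" unfolding m_def by (rule LeastI)
  have "m \<noteq> 0" using m assms by (intro notI) simp
  then obtain k where k: "m = Suc k" by (cases m) auto
  have "x [^] (p ^ k) \<notin> S" using k not_less_Least m_def by (metis lessI)
  moreover have "(x [^] (p ^ k)) [^] p \<in> S" using m k assms(2) by (simp add: nat_pow_pow mult.commute)
  ultimately show thesis using that by blast
qed

text \<open>A group of order \<open>p\<close> has no proper nontrivial subgroup: if \<open>x\<close>
  were not a power of \<open>y = x [^] i\<close>, then \<open>p\<close> would divide
  \<open>i\<close> and \<open>y\<close> would be trivial.\<close>

lemma pow_coprime_generates:
  assumes "x \<in> carrier G" "x [^] p = \<one>" "y \<in> powers G x" "y \<noteq> \<one>"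
  shows "x \<in> powers G y"
proof (rule ccontr)
  assume n: "x \<notin> powers G y"
  obtain i where i: "y = x [^] (i::nat)" using assms by (auto simp: powers_def)
  have yc: "y \<in> carrier G" using i assms by simp
  have s: "subgroup (powers G y) G" by (rule subgroup_powers [OF finite_carrier yc])
  have "x [^] p \<in> powers G y" using assms(2) subgroup.one_closed [OF s] by simp
  then have "p dvd i"
    using pow_prime_mem_iff [OF finite_carrier s assms(1) n _ prime_p, of i] i s
    by (metis nat_pow_eone powers_def rangeI yc)
  then show False using i assms(1,2,4) by (metis dvd_def nat_pow_one nat_pow_pow)
qed

lemma card_powers_prime:
  assumes "x \<in> carrier G" "x [^] p = \<one>" "x \<noteq> \<one>"
  shows "card (powers G x) = p"
proof -
  have "powers G x = adjoin G {\<one>} x"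
    using assms(1) by (auto simp: powers_def adjoin_def image_iff)
  moreover have "card (adjoin G {\<one>} x) = p * card {\<one>}"
    by (rule card_adjoin [OF finite_carrier triv_subgroup assms(1) _ _ prime_p]) (use assms in auto)
  ultimately show ?thesis by simp
qed

lemma powers_of_prime_card:
  assumes "subgroup K G" "card K = p" "x \<in> K" "x \<noteq> \<one>"
  shows "K = powers G x" "x [^] p = \<one>"
proof -
  have c: "x \<in> carrier G" using assms subgroup.mem_carrier by metis
  have s: "subgroup (powers G x) G" by (rule subgroup_powers [OF finite_carrier c])
  have sub: "powers G x \<subseteq> K" by (rule powers_in_subgroup [OF assms(1,3)])
  have "x \<in> powers G x" unfolding powers_def by (rule image_eqI [of _ _ 1]) (use c in auto)
  then have "powers G x \<noteq> {\<one>}" using assms by auto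
  then have "p dvd card (powers G x)" by (rule p_dvd_card_subgroup [OF s])
  moreover have fK: "finite K" using finite_subset_carrier subgroup.subset assms(1) by auto
  moreover have "card (powers G x) > 0"
    using \<open>x \<in> powers G x\<close> sub fK by (metis card_gt_0_iff empty_iff finite_subset)
  ultimately have "card (powers G x) \<ge> p" using dvd_imp_le by auto
  then show "K = powers G x" using sub fK assms(2) by (metis card_seteq)
  interpret K: group "G\<lparr>carrier := K\<rparr>" by (rule subgroup_imp_group [OF assms(1)])
  have "x [^]\<^bsub>G\<lparr>carrier := K\<rparr>\<^esub> order (G\<lparr>carrier := K\<rparr>) = \<one>"
    using K.pow_order_eq_1 [of x] assms fK by simp
  then show "x [^] p = \<one>"
    using assms(2) by (simp add: order_def flip: nat_pow_consistent)
qed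

text \<open>Class equation: the conjugacy classes of the noncentral elements of a normal subgroup have
  size divisible by \<open>p\<close>.\<close>

lemma normal_meets_center:
  assumes N: "N \<lhd> G" "N \<noteq> {\<one>}"
  obtains z where "z \<in> N" "z \<in> center G" "z \<noteq> \<one>" "z [^] p = \<one>"
proof -
  interpret N: normal N G by fact
  define \<phi> where "\<phi> = (\<lambda>g. (\<lambda>h \<in> carrier G. g \<otimes> h \<otimes> (inv g)))"
  interpret act: group_action G "carrier G" \<phi>
    unfolding \<phi>_def by (rule action_by_conjugation)
  have finN: "finite N" by (rule finite_subset_carrier [OF N.subset])
  have "\<exists>w\<in>N. w \<in> center G \<and> w \<noteq> \<one>"
  proof (rule ccontr)
    assume none: "\<not> (\<exists>w\<in>N. w \<in> center G \<and> w \<noteq> \<one>)"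
    let ?OO = "orbit G \<phi> ` (N - {\<one>})"
    have orb: "orbit G \<phi> x = {g \<otimes> x \<otimes> inv g | g. g \<in> carrier G}" if "x \<in> carrier G" for x
      using that by (auto simp: orbit_def \<phi>_def)
    have conj1: "g \<otimes> x \<otimes> inv g \<noteq> \<one>" if "g \<in> carrier G" "x \<in> N" "x \<noteq> \<one>" for g x
    proof
      assume 1: "g \<otimes> x \<otimes> inv g = \<one>"
      have x: "x \<in> carrier G" using that N.subset by auto
      have "inv g \<otimes> (g \<otimes> x \<otimes> inv g) \<otimes> g = x" using x that by (simp add: m_assoc)
      then show False using 1 that by simp
    qed
    have U: "\<Union> ?OO = N - {\<one>}"
    proof (intro subset_antisym subsetI)
      fix x assume "x \<in> \<Union> ?OO"
      then obtain y where y: "y \<in> N" "y \<noteq> \<one>" "x \<in> orbit G \<phi> y" by blast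
      have "y \<in> carrier G" using y N.subset by auto
      from y(3) [unfolded orb [OF this]] obtain g where g: "g \<in> carrier G" "x = g \<otimes> y \<otimes> inv g"
        by blast
      show "x \<in> N - {\<one>}" using g y N.inv_op_closed2 conj1 by auto
    next
      fix x assume x: "x \<in> N - {\<one>}"
      then have "x \<in> orbit G \<phi> x" using act.orbit_refl N.subset by auto
      then show "x \<in> \<Union> ?OO" using x by blast
    qed
    have "p dvd card Y" if "Y \<in> ?OO" for Y
    proof -
      from that obtain y where y: "y \<in> N" "y \<noteq> \<one>" "Y = orbit G \<phi> y" by auto
      have yc: "y \<in> carrier G" using y N.subset by auto
      have "card Y dvd p ^ n"
        using act.orbit_stabilizer_theorem [OF yc] order_G y by (metis dvd_triv_left)
      then obtain k where k: "card Y = p ^ k" using divides_primepow_nat [OF prime_p] by auto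
      have "k \<noteq> 0"
      proof
        assume "k = 0"
        then obtain w where "Y = {w}" using k by (metis card_1_singletonE power_0)
        moreover have "y \<in> Y" using y act.orbit_refl yc by auto
        ultimately have Y: "Y = {y}" by auto
        have "g \<otimes> y = y \<otimes> g" if g: "g \<in> carrier G" for g
        proof -
          have "g \<otimes> y \<otimes> inv g \<in> Y" using y orb [OF yc] g by auto
          then have "g \<otimes> y \<otimes> inv g = y" using Y by simp
          then show ?thesis using g yc by (metis inv_solve_right' m_closed)
        qed
        then have "y \<in> center G" using yc by (rule centerI [rotated])
        then show False using none y by auto
      qed
      then show ?thesis using k by (simp add: dvd_power)
    qed
    moreover have "card (\<Union> ?OO) = (\<Sum>Y\<in>?OO. card Y)"
    proof (rule card_Union_disjoint)
      show "pairwise disjnt ?OO"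
      proof (rule pairwiseI)
        fix A B assume "A \<in> ?OO" "B \<in> ?OO" "A \<noteq> B"
        moreover have "?OO \<subseteq> orbits G (carrier G) \<phi>"
          using N.subset by (auto simp: orbits_def)
        ultimately have "A \<in> orbits G (carrier G) \<phi>" "B \<in> orbits G (carrier G) \<phi>"
          by (auto simp only: subset_iff)
        then show "disjnt A B"
          using act.disjoint_union [of A B] \<open>A \<noteq> B\<close> by (auto simp: disjnt_def)
      qed
      show "\<And>A. A \<in> ?OO \<Longrightarrow> finite A"
        by (metis U finN Sup_upper finite_Diff finite_subset)
    qed
    ultimately have "p dvd card (N - {\<one>})" unfolding U by (simp add: dvd_sum)
    with p_dvd_card_subgroup [OF N.subgroup_axioms N(2)] card_Suc_Diff1 [OF finN N.one_closed]
    have "p dvd 1" by (metis Suc_eq_plus1 dvd_add_right_iff)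
    then show False using prime_p by (simp add: prime_nat_iff)
  qed
  then obtain w where w: "w \<in> N" "w \<in> center G" "w \<noteq> \<one>" by auto
  have wc: "w \<in> carrier G" using w center_closed by auto
  \<comment> \<open>A suitable power of the central element \<open>w\<close> has order exactly
    \<open>p\<close> and stays in \<open>N\<close> and in the center.\<close>
  obtain k where k: "w [^] (p ^ k) \<notin> {\<one>}" "(w [^] (p ^ k)) [^] p \<in> {\<one>}"
    using exists_pow_prime [OF triv_subgroup wc] w by blast
  show thesis
  proof (rule that)
    show "w [^] (p ^ k) \<in> N" by (rule subgroup_nat_pow_closed [OF N.subgroup_axioms w(1)])
    show "w [^] (p ^ k) \<in> center G" by (rule subgroup_nat_pow_closed [OF subgroup_center w(2)])
    show "w [^] (p ^ k) \<noteq> \<one>" using k(1) by (simp only: singleton_iff not_False_eq_True)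
    show "(w [^] (p ^ k)) [^] p = \<one>" using k(2) by (rule singletonD)
  qed
qed

lemma prime_normal_central:
  assumes "N \<lhd> G" "card N = p" shows "N \<subseteq> center G"
proof -
  have "p \<noteq> 1" using prime_gt_1_nat [OF prime_p] by simp
  then have "N \<noteq> {\<one>}" using assms(2) by (intro notI) simp
  then obtain z where z: "z \<in> N" "z \<in> center G" "z \<noteq> \<one>"
    using normal_meets_center [OF assms(1)] by metis
  have "N = powers G z"
    using powers_of_prime_card [OF normal_imp_subgroup [OF assms(1)] assms(2) z(1,3)] by simp
  then show ?thesis using powers_in_subgroup [OF subgroup_center z(2)] by simp
qed

end


section \<open>Extension of homomorphisms and characters\<close>

text \<open>For normal \<open>L\<close> this is the dual group of \<open>S\<close> modulo
  \<open>L\<close>. Extensionality identifies functions that agree on \<open>S\<close>, so that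
  characters can be counted.\<close>

definition chars :: "('a, 'm) monoid_scheme \<Rightarrow> 'a set \<Rightarrow> 'a set \<Rightarrow> ('a \<Rightarrow> complex) set" where
  "chars G L S = {\<chi> \<in> hom (G\<lparr>carrier := S\<rparr>) complex_units. \<chi> \<in> extensional S \<and> (\<forall>x\<in>L. \<chi> x = 1)}"

lemma complex_units_pow [simp]: "x [^]\<^bsub>complex_units\<^esub> (i::nat) = x ^ i"
  by (induction i) (simp_all add: mult.commute)

context group
begin

lemma hom_on_subgroup_pow:
  assumes "group B" "subgroup S G" "\<sigma> \<in> hom (G\<lparr>carrier := S\<rparr>) B" "s \<in> S"
  shows "\<sigma> (s [^] (i::nat)) = \<sigma> s [^]\<^bsub>B\<^esub> i"
proof -
  interpret B: group B by fact
  interpret GS: group "G\<lparr>carrier := S\<rparr>" by (rule subgroup_imp_group [OF assms(2)])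
  interpret \<sigma>: group_hom "G\<lparr>carrier := S\<rparr>" B \<sigma>
    by unfold_locales (fact assms)
  show ?thesis using \<sigma>.hom_nat_pow [of s i] assms(4) by (simp flip: nat_pow_consistent)
qed

text \<open>The image \<open>y\<close> of \<open>x\<close> has to satisfy the relations that
  \<open>x\<close> satisfies over \<open>S\<close>: its \<open>p\<close>-th power is prescribed, and
  it must conjugate the image of \<open>S\<close> as \<open>x\<close> conjugates \<open>S\<close>.
  For normal \<open>S\<close> these two relations suffice.\<close>

lemma hom_extend:
  assumes fin: "finite (carrier G)" and "group B" and S: "S \<lhd> G"
    and x: "x \<in> carrier G" "x \<notin> S" "x [^] (p::nat) \<in> S" and p: "Factorial_Ring.prime p"
    and \<sigma>: "\<sigma> \<in> hom (G\<lparr>carrier := S\<rparr>) B"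
    and y: "y \<in> carrier B" "\<sigma> (x [^] p) = y [^]\<^bsub>B\<^esub> p"
    and conj: "\<And>s. s \<in> S \<Longrightarrow> \<sigma> (x \<otimes> s \<otimes> inv x) = y \<otimes>\<^bsub>B\<^esub> \<sigma> s \<otimes>\<^bsub>B\<^esub> inv\<^bsub>B\<^esub> y"
  obtains \<tau> where "\<tau> \<in> hom (G\<lparr>carrier := adjoin G S x\<rparr>) B"
    "\<And>s i. s \<in> S \<Longrightarrow> \<tau> (s \<otimes> x [^] (i::nat)) = \<sigma> s \<otimes>\<^bsub>B\<^esub> y [^]\<^bsub>B\<^esub> i"
proof -
  interpret B: group B by fact
  interpret S: normal S G by fact
  note sub = S.subgroup_axioms
  have \<sigma>c: "\<sigma> s \<in> carrier B" if "s \<in> S" for s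
    using \<sigma> that by (auto simp: hom_def)
  have \<sigma>m: "\<sigma> (s \<otimes> t) = \<sigma> s \<otimes>\<^bsub>B\<^esub> \<sigma> t" if "s \<in> S" "t \<in> S" for s t
    using \<sigma> that by (auto simp: hom_def)
  \<comment> \<open>Two representations of an element differ by a power of \<open>x [^] p\<close>,
    on which \<open>\<sigma>\<close> agrees with the powers of \<open>y\<close>; so the value does
    not depend on the representation.\<close>
  have wd: "\<sigma> s \<otimes>\<^bsub>B\<^esub> y [^]\<^bsub>B\<^esub> i = \<sigma> t \<otimes>\<^bsub>B\<^esub> y [^]\<^bsub>B\<^esub> j"
    if st: "s \<in> S" "t \<in> S" and e: "s \<otimes> x [^] i = t \<otimes> x [^] j" and "i \<le> j" for s t and i j :: nat
  proof -
    note r = adjoin_repr_eq_iff [OF fin sub x p st \<open>i \<le> j\<close> e]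
    from r(1) obtain m where m: "j - i = p * m" by blast
    have xm: "x [^] (j - i) = (x [^] p) [^] m" using m x by (simp add: nat_pow_pow)
    have "\<sigma> (x [^] (j - i)) = (y [^]\<^bsub>B\<^esub> p) [^]\<^bsub>B\<^esub> m"
      unfolding xm using hom_on_subgroup_pow [OF assms(2) sub \<sigma> x(3)] y by simp
    also have "\<dots> = y [^]\<^bsub>B\<^esub> (j - i)" using m y by (simp add: B.nat_pow_pow)
    finally have "\<sigma> (x [^] (j - i)) = y [^]\<^bsub>B\<^esub> (j - i)" .
    moreover have "x [^] (j - i) \<in> S" unfolding xm by (rule subgroup_nat_pow_closed [OF sub x(3)])
    ultimately have "\<sigma> s = \<sigma> t \<otimes>\<^bsub>B\<^esub> y [^]\<^bsub>B\<^esub> (j - i)" using r(2) st \<sigma>m by simp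
    then show ?thesis using \<open>i \<le> j\<close> y \<sigma>c [OF st(2)] by (simp add: B.m_assoc B.nat_pow_mult)
  qed
  define \<tau> where "\<tau> w = (SOME b. \<exists>s\<in>S. \<exists>i::nat. w = s \<otimes> x [^] i \<and> b = \<sigma> s \<otimes>\<^bsub>B\<^esub> y [^]\<^bsub>B\<^esub> i)" for w
  have \<tau>: "\<tau> (s \<otimes> x [^] (i::nat)) = \<sigma> s \<otimes>\<^bsub>B\<^esub> y [^]\<^bsub>B\<^esub> i" if "s \<in> S" for s i
  proof -
    have "\<exists>t\<in>S. \<exists>j::nat. s \<otimes> x [^] i = t \<otimes> x [^] j \<and> \<tau> (s \<otimes> x [^] i) = \<sigma> t \<otimes>\<^bsub>B\<^esub> y [^]\<^bsub>B\<^esub> j"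
      unfolding \<tau>_def by (rule someI_ex) (use that in blast)
    then show ?thesis using wd that by (metis nle_le)
  qed
  \<comment> \<open>The conjugation hypothesis is iterated to powers of \<open>x\<close>, since
    these appear when two elements of \<open>adjoin\<close> are multiplied.\<close>
  have cj: "\<sigma> (x [^] i \<otimes> s \<otimes> inv (x [^] i)) = y [^]\<^bsub>B\<^esub> i \<otimes>\<^bsub>B\<^esub> \<sigma> s \<otimes>\<^bsub>B\<^esub> inv\<^bsub>B\<^esub> (y [^]\<^bsub>B\<^esub> i)"
    if s: "s \<in> S" for s and i :: nat
  proof (induction i)
    case (Suc i)
    let ?t = "x [^] i \<otimes> s \<otimes> inv (x [^] i)"
    have t: "?t \<in> S" by (rule pow_conj_normal [OF S x(1) s])
    have sc: "s \<in> carrier G" using s S.subset by auto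
    have "x [^] Suc i \<otimes> s \<otimes> inv (x [^] Suc i) = x \<otimes> ?t \<otimes> inv x"
      unfolding nat_pow_Suc2 [OF x(1)] using x(1) sc by (simp add: m_assoc inv_mult_group del: nat_pow_Suc)
    then show ?case
      unfolding B.nat_pow_Suc2 [OF y(1)] using conj [OF t] Suc y(1) \<sigma>c [OF s]
      by (simp add: B.m_assoc B.inv_mult_group del: nat_pow_Suc)
  qed (use s \<sigma>c S.subset in auto)
  have "\<tau> \<in> hom (G\<lparr>carrier := adjoin G S x\<rparr>) B"
  proof (rule homI)
    fix u assume "u \<in> carrier (G\<lparr>carrier := adjoin G S x\<rparr>)"
    then obtain s i where "s \<in> S" "u = s \<otimes> x [^] (i::nat)" by (auto simp: adjoin_def)
    then show "\<tau> u \<in> carrier B" using \<tau> \<sigma>c y by simp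
  next
    fix u v assume "u \<in> carrier (G\<lparr>carrier := adjoin G S x\<rparr>)" "v \<in> carrier (G\<lparr>carrier := adjoin G S x\<rparr>)"
    then obtain s i t j where st: "s \<in> S" "u = s \<otimes> x [^] (i::nat)" "t \<in> S" "v = t \<otimes> x [^] (j::nat)"
      by (auto simp: adjoin_def)
    have c: "s \<in> carrier G" "t \<in> carrier G" using st S.subset by auto
    have t': "x [^] i \<otimes> t \<otimes> inv (x [^] i) \<in> S" by (rule pow_conj_normal [OF S x(1) st(3)])
    have "u \<otimes> v = (s \<otimes> (x [^] i \<otimes> t \<otimes> inv (x [^] i))) \<otimes> x [^] (i + j)"
      using adjoin_mult [OF x(1) c] st by simp
    then have "\<tau> (u \<otimes> v) = (\<sigma> s \<otimes>\<^bsub>B\<^esub> (y [^]\<^bsub>B\<^esub> i \<otimes>\<^bsub>B\<^esub> \<sigma> t \<otimes>\<^bsub>B\<^esub> inv\<^bsub>B\<^esub> (y [^]\<^bsub>B\<^esub> i))) \<otimes>\<^bsub>B\<^esub> y [^]\<^bsub>B\<^esub> (i + j)"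
      using \<tau> t' st cj \<sigma>m by simp
    also have "\<dots> = \<tau> u \<otimes>\<^bsub>B\<^esub> \<tau> v"
      using \<tau> st y \<sigma>c by (simp add: B.m_assoc flip: B.nat_pow_mult)
    finally show "\<tau> (u \<otimes>\<^bsub>G\<lparr>carrier := adjoin G S x\<rparr>\<^esub> v) = \<tau> u \<otimes>\<^bsub>B\<^esub> \<tau> v" by simp
  qed
  then show thesis using that \<tau> by blast
qed

text \<open>A kernel element has \<open>y [^] i\<close> in the image of \<open>S\<close>. As
  \<open>y\<close> lies outside this image, \<open>p\<close> divides \<open>i\<close>, so the powers
  of \<open>x\<close> and \<open>y\<close> vanish and injectivity on \<open>S\<close> finishes. With
  \<open>x\<close> and \<open>y\<close> of order \<open>p\<close>, the relation between their
  \<open>p\<close>-th powers is trivially true.\<close>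

lemma hom_extend_inj:
  assumes fin: "finite (carrier G)" and "group B" and S: "S \<lhd> G"
    and x: "x \<in> carrier G" "x \<notin> S" "x [^] (p::nat) = \<one>" and p: "Factorial_Ring.prime p"
    and \<sigma>: "\<sigma> \<in> hom (G\<lparr>carrier := S\<rparr>) B" and inj: "inj_on \<sigma> S"
    and y: "y \<in> carrier B" "y \<notin> \<sigma> ` S" "y [^]\<^bsub>B\<^esub> p = \<one>\<^bsub>B\<^esub>" and finB: "finite (carrier B)"
    and conj: "\<And>s. s \<in> S \<Longrightarrow> \<sigma> (x \<otimes> s \<otimes> inv x) = y \<otimes>\<^bsub>B\<^esub> \<sigma> s \<otimes>\<^bsub>B\<^esub> inv\<^bsub>B\<^esub> y"
  obtains \<tau> where "\<tau> \<in> hom (G\<lparr>carrier := adjoin G S x\<rparr>) B" "inj_on \<tau> (adjoin G S x)"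
    "\<And>s. s \<in> S \<Longrightarrow> \<tau> s = \<sigma> s" "\<tau> x = y" "\<tau> ` adjoin G S x = adjoin B (\<sigma> ` S) y"
proof -
  interpret B: group B by fact
  interpret S: normal S G by fact
  interpret GS: group "G\<lparr>carrier := S\<rparr>" by (rule subgroup_imp_group [OF S.subgroup_axioms])
  interpret \<sigma>: group_hom "G\<lparr>carrier := S\<rparr>" B \<sigma>
    by unfold_locales (fact \<sigma>)
  have one: "\<sigma> \<one> = \<one>\<^bsub>B\<^esub>" using \<sigma>.hom_one by simp
  have xp: "x [^] p \<in> S" "\<sigma> (x [^] p) = y [^]\<^bsub>B\<^esub> p" using x y one by auto
  obtain \<tau> where \<tau>: "\<tau> \<in> hom (G\<lparr>carrier := adjoin G S x\<rparr>) B"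
    and \<tau>e: "\<And>s i. s \<in> S \<Longrightarrow> \<tau> (s \<otimes> x [^] (i::nat)) = \<sigma> s \<otimes>\<^bsub>B\<^esub> y [^]\<^bsub>B\<^esub> i"
    using hom_extend [OF fin assms(2) S x(1,2) xp(1) p \<sigma> y(1) xp(2) conj] by blast
  have \<sigma>c: "\<sigma> s \<in> carrier B" if "s \<in> S" for s using \<sigma>.hom_closed that by simp
  have img: "subgroup (\<sigma> ` S) B" using \<sigma>.img_is_subgroup by simp
  interpret GA: group "G\<lparr>carrier := adjoin G S x\<rparr>"
    by (rule subgroup_imp_group [OF subgroup_adjoin [OF fin S x(1)]])
  interpret \<tau>: group_hom "G\<lparr>carrier := adjoin G S x\<rparr>" B \<tau>
    by unfold_locales (fact \<tau>)
  have "inj_on \<tau> (adjoin G S x)"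
  proof -
    have "w = \<one>" if w: "w \<in> adjoin G S x" "\<tau> w = \<one>\<^bsub>B\<^esub>" for w
    proof -
      obtain s i where si: "s \<in> S" "w = s \<otimes> x [^] (i::nat)" using w by (auto simp: adjoin_def)
      have "\<sigma> s \<otimes>\<^bsub>B\<^esub> y [^]\<^bsub>B\<^esub> i = \<one>\<^bsub>B\<^esub>" using w si \<tau>e by simp
      then have "y [^]\<^bsub>B\<^esub> i = inv\<^bsub>B\<^esub> (\<sigma> s)" using \<sigma>c si y
        by (metis B.inv_equality B.inv_inv B.nat_pow_closed)
      then have "y [^]\<^bsub>B\<^esub> i \<in> \<sigma> ` S" using img si subgroup.m_inv_closed by (metis imageI)
      moreover have "y [^]\<^bsub>B\<^esub> p \<in> \<sigma> ` S" using y img subgroup.one_closed by metis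
      ultimately have "p dvd i" using B.pow_prime_mem_iff [OF finB img y(1,2) _ p] by blast
      then have "x [^] i = \<one>" "y [^]\<^bsub>B\<^esub> i = \<one>\<^bsub>B\<^esub>"
        using x y by (metis dvd_def nat_pow_one nat_pow_pow, metis dvd_def B.nat_pow_one B.nat_pow_pow)
      then have "w = s" "\<sigma> s = \<one>\<^bsub>B\<^esub>"
        using si \<open>\<sigma> s \<otimes>\<^bsub>B\<^esub> y [^]\<^bsub>B\<^esub> i = \<one>\<^bsub>B\<^esub>\<close> S.subset \<sigma>c by auto
      then show ?thesis using inj one si by (metis S.one_closed inj_onD)
    qed
    then have "kernel (G\<lparr>carrier := adjoin G S x\<rparr>) B \<tau> \<subseteq> {\<one>}"
      unfolding kernel_def by simp blast
    moreover have "\<one> \<in> kernel (G\<lparr>carrier := adjoin G S x\<rparr>) B \<tau>"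
      using GA.one_closed \<tau>.hom_one unfolding kernel_def by simp
    ultimately have "kernel (G\<lparr>carrier := adjoin G S x\<rparr>) B \<tau> = {\<one>}" by blast
    then show ?thesis using \<tau>.inj_iff_trivial_ker by simp
  qed
  moreover have "\<tau> s = \<sigma> s" if "s \<in> S" for s
    using \<tau>e [OF that, of 0] S.subset \<sigma>c that by auto
  moreover have "\<tau> x = y"
    using \<tau>e [OF S.one_closed, of 1] x(1) y(1) one by simp
  moreover have "\<tau> ` adjoin G S x = adjoin B (\<sigma> ` S) y"
  proof (intro subset_antisym subsetI)
    fix v assume "v \<in> \<tau> ` adjoin G S x"
    then obtain s i where "s \<in> S" "v = \<tau> (s \<otimes> x [^] (i::nat))" by (auto simp: adjoin_def)
    then show "v \<in> adjoin B (\<sigma> ` S) y" using \<tau>e by (simp add: B.adjoin_mem)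
  next
    fix v assume "v \<in> adjoin B (\<sigma> ` S) y"
    then obtain s i where "s \<in> S" "v = \<sigma> s \<otimes>\<^bsub>B\<^esub> y [^]\<^bsub>B\<^esub> (i::nat)" by (auto simp: adjoin_def)
    then have "s \<otimes> x [^] i \<in> adjoin G S x" "v = \<tau> (s \<otimes> x [^] i)" using \<tau>e by (simp_all add: adjoin_mem)
    then show "v \<in> \<tau> ` adjoin G S x" by blast
  qed
  ultimately show thesis using that \<tau> by blast
qed

end

context p_group
begin

text \<open>Commutators lie in \<open>L\<close>, so characters do not see conjugation, and an
  extension is determined by its value at \<open>x\<close>, an arbitrary \<open>p\<close>-th root of
  the value at \<open>x [^] p\<close>. A nonzero complex number has exactly \<open>p\<close> such
  roots.\<close>

lemma chars_adjoin:
  assumes S: "subgroup S G" and L: "L \<subseteq> S" "derived G (carrier G) \<subseteq> L"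
    and x: "x \<in> carrier G" "x \<notin> S" "x [^] p \<in> S" and fin: "finite (chars G L S)"
  shows "finite (chars G L (adjoin G S x))" "card (chars G L (adjoin G S x)) = p * card (chars G L S)"
proof -
  have N: "S \<lhd> G" by (rule normal_of_derived [OF S]) (use L in auto)
  interpret N: normal S G by (fact N)
  have gcu: "group complex_units" using comm_group_complex_units comm_group_def by metis
  let ?A = "adjoin G S x"
  let ?\<Sigma> = "Sigma (chars G L S) (\<lambda>\<chi>. {y. y ^ p = \<chi> (x [^] p)})"
  have SA: "S \<subseteq> ?A" by (rule subset_adjoin [OF N.subset])
  have xA: "x \<in> ?A" by (rule self_in_adjoin [OF N.one_closed x(1)])
  have sA: "subgroup ?A G" by (rule subgroup_adjoin [OF finite_carrier N x(1)])
  have Apow: "\<tau> (s \<otimes> x [^] (i::nat)) = \<tau> s * \<tau> x ^ i" if "\<tau> \<in> chars G L ?A" "s \<in> S" for \<tau> s i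
  proof -
    have h: "\<tau> \<in> hom (G\<lparr>carrier := ?A\<rparr>) complex_units" using that by (simp add: chars_def)
    have "\<tau> (x [^] i) = \<tau> x ^ i"
      using hom_on_subgroup_pow [OF gcu sA h xA] by simp
    then show ?thesis
      using hom_mult [OF h, of s "x [^] i"] SA that subgroup_nat_pow_closed [OF sA xA] by auto
  qed
  have "bij_betw (\<lambda>\<tau>. (restrict \<tau> S, \<tau> x)) (chars G L ?A) ?\<Sigma>"
    unfolding bij_betw_def
  proof
    show "inj_on (\<lambda>\<tau>. (restrict \<tau> S, \<tau> x)) (chars G L ?A)"
    proof (rule inj_onI)
      fix \<tau> \<tau>' assume t: "\<tau> \<in> chars G L ?A" "\<tau>' \<in> chars G L ?A"
        and e: "(restrict \<tau> S, \<tau> x) = (restrict \<tau>' S, \<tau>' x)"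
      show "\<tau> = \<tau>'"
      proof (rule extensionalityI)
        show "\<tau> \<in> extensional ?A" "\<tau>' \<in> extensional ?A" using t by (auto simp: chars_def)
        fix w assume "w \<in> ?A"
        then obtain s i where si: "s \<in> S" "w = s \<otimes> x [^] (i::nat)" by (auto simp: adjoin_def)
        moreover have "\<tau> s = \<tau>' s" using e si by (metis fst_conv restrict_apply')
        ultimately show "\<tau> w = \<tau>' w" using Apow [OF t(1) si(1)] Apow [OF t(2) si(1)] e by simp
      qed
    qed
    show "(\<lambda>\<tau>. (restrict \<tau> S, \<tau> x)) ` chars G L ?A = ?\<Sigma>"
    proof (intro subset_antisym subsetI)
      fix q assume "q \<in> (\<lambda>\<tau>. (restrict \<tau> S, \<tau> x)) ` chars G L ?A"
      then obtain \<tau> where t: "\<tau> \<in> chars G L ?A" and q: "q = (restrict \<tau> S, \<tau> x)" by auto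
      have h: "\<tau> \<in> hom (G\<lparr>carrier := ?A\<rparr>) complex_units" and L1: "\<And>l. l \<in> L \<Longrightarrow> \<tau> l = 1"
        using t by (auto simp: chars_def)
      have "restrict \<tau> S \<in> hom (G\<lparr>carrier := S\<rparr>) complex_units"
      proof (rule homI)
        fix s assume "s \<in> carrier (G\<lparr>carrier := S\<rparr>)"
        then show "restrict \<tau> S s \<in> carrier complex_units"
          using hom_in_carrier [OF h, of s] SA by auto
      next
        fix s u assume "s \<in> carrier (G\<lparr>carrier := S\<rparr>)" "u \<in> carrier (G\<lparr>carrier := S\<rparr>)"
        then show "restrict \<tau> S (s \<otimes>\<^bsub>G\<lparr>carrier := S\<rparr>\<^esub> u) = restrict \<tau> S s \<otimes>\<^bsub>complex_units\<^esub> restrict \<tau> S u"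
          using hom_mult [OF h, of s u] SA N.m_closed by auto
      qed
      then have "restrict \<tau> S \<in> chars G L S" using L1 L by (auto simp: chars_def)
      moreover have "\<tau> x ^ p = restrict \<tau> S (x [^] p)"
        using hom_on_subgroup_pow [OF gcu sA h xA, of p] x(3) by simp
      ultimately show "q \<in> ?\<Sigma>" using q by auto
    next
      fix q assume "q \<in> ?\<Sigma>"
      then obtain \<chi> y where q: "q = (\<chi>, y)" and c: "\<chi> \<in> chars G L S" and y: "y ^ p = \<chi> (x [^] p)" by auto
      have h: "\<chi> \<in> hom (G\<lparr>carrier := S\<rparr>) complex_units" and L1: "\<And>l. l \<in> L \<Longrightarrow> \<chi> l = 1"
        and ext: "\<chi> \<in> extensional S"
        using c by (auto simp: chars_def)
      have nz: "\<chi> s \<noteq> 0" if "s \<in> S" for s using hom_in_carrier [OF h, of s] that by simp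
      have y0: "y \<noteq> 0" using y nz [OF x(3)] p_pos by (metis zero_power)
      have cj: "\<chi> (x \<otimes> s \<otimes> inv x) = y \<otimes>\<^bsub>complex_units\<^esub> \<chi> s \<otimes>\<^bsub>complex_units\<^esub> inv\<^bsub>complex_units\<^esub> y" if s: "s \<in> S" for s
      proof -
        have sc: "s \<in> carrier G" using s N.subset by auto
        have d: "commutator G x s \<in> L" using commutator_in_derived [OF x(1) sc] L by auto
        have "x \<otimes> s \<otimes> inv x = commutator G x s \<otimes> s"
          using x(1) sc by (simp add: commutator_def m_assoc)
        then have "\<chi> (x \<otimes> s \<otimes> inv x) = \<chi> s"
          using hom_mult [OF h, of "commutator G x s" s] d s L1 L by auto
        then show ?thesis using y0 by (simp add: inv_complex_units)
      qed
      have yc: "y \<in> carrier complex_units" "\<chi> (x [^] p) = y [^]\<^bsub>complex_units\<^esub> p"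
        using y y0 by auto
      obtain \<tau> where \<tau>: "\<tau> \<in> hom (G\<lparr>carrier := ?A\<rparr>) complex_units"
        and \<tau>e: "\<And>s i. s \<in> S \<Longrightarrow> \<tau> (s \<otimes> x [^] (i::nat)) = \<chi> s * y ^ i"
        using hom_extend [OF finite_carrier gcu N x prime_p h yc cj] by auto
      have \<tau>S: "\<tau> s = \<chi> s" if "s \<in> S" for s using \<tau>e [OF that, of 0] that N.subset by auto
      have "\<chi> \<one> * \<chi> \<one> = \<chi> \<one>" using hom_mult [OF h, of \<one> \<one>] N.one_closed by simp
      then have "\<chi> \<one> = 1" using nz [OF N.one_closed] by simp
      then have \<tau>x: "\<tau> x = y" using \<tau>e [OF N.one_closed, of 1] x(1) by simp
      have "restrict \<tau> ?A \<in> hom (G\<lparr>carrier := ?A\<rparr>) complex_units"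
      proof (rule homI)
        fix s assume "s \<in> carrier (G\<lparr>carrier := ?A\<rparr>)"
        then show "restrict \<tau> ?A s \<in> carrier complex_units"
          using hom_in_carrier [OF \<tau>, of s] by auto
      next
        fix s u assume "s \<in> carrier (G\<lparr>carrier := ?A\<rparr>)" "u \<in> carrier (G\<lparr>carrier := ?A\<rparr>)"
        then show "restrict \<tau> ?A (s \<otimes>\<^bsub>G\<lparr>carrier := ?A\<rparr>\<^esub> u) = restrict \<tau> ?A s \<otimes>\<^bsub>complex_units\<^esub> restrict \<tau> ?A u"
          using hom_mult [OF \<tau>, of s u] subgroup.m_closed [OF sA] by auto
      qed
      then have "restrict \<tau> ?A \<in> chars G L ?A"
        using \<tau>S L1 L SA by (auto simp: chars_def subset_iff)
      moreover have "(restrict (restrict \<tau> ?A) S, restrict \<tau> ?A x) = q"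
      proof -
        have "restrict (restrict \<tau> ?A) S = \<chi>"
          by (rule extensionalityI [of _ S]) (use ext \<tau>S SA in auto)
        then show ?thesis using q \<tau>x xA by simp
      qed
      ultimately show "q \<in> (\<lambda>\<tau>. (restrict \<tau> S, \<tau> x)) ` chars G L ?A" by (metis (no_types, lifting) image_eqI)
    qed
  qed
  note b = this
  have f: "finite {y. y ^ p = \<chi> (x [^] p)}" "card {y. y ^ p = \<chi> (x [^] p)} = p" if "\<chi> \<in> chars G L S" for \<chi>
  proof -
    have "\<chi> \<in> hom (G\<lparr>carrier := S\<rparr>) complex_units" using that by (simp add: chars_def)
    then have "\<chi> (x [^] p) \<noteq> 0" using hom_in_carrier [of \<chi> _ _ "x [^] p"] x(3) by force
    then show "card {y. y ^ p = \<chi> (x [^] p)} = p" "finite {y. y ^ p = \<chi> (x [^] p)}"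
      using card_nth_roots p_pos finite_nth_roots by auto
  qed
  then have "finite ?\<Sigma>" using fin by auto
  then show "finite (chars G L ?A)" using b bij_betw_finite by blast
  have "card (chars G L ?A) = card ?\<Sigma>" using b by (rule bij_betw_same_card)
  also have "\<dots> = (\<Sum>\<chi>\<in>chars G L S. card {y. y ^ p = \<chi> (x [^] p)})"
    by (rule card_SigmaI) (use fin f in auto)
  also have "\<dots> = p * card (chars G L S)" using f by simp
  finally show "card (chars G L ?A) = p * card (chars G L S)" .
qed

text \<open>From the single trivial character of \<open>L\<close> upwards, each adjoined element
  multiplies both the order of the subgroup and the number of characters by
  \<open>p\<close>.\<close>

lemma card_chars:
  assumes L: "subgroup L G" "derived G (carrier G) \<subseteq> L"
  shows "finite (chars G L (carrier G)) \<and> card (chars G L (carrier G)) * card L = p ^ n"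
proof -
  have "finite (chars G L (carrier G)) \<and> card (chars G L (carrier G)) * card L = order G"
    if "subgroup S G" "L \<subseteq> S" "finite (chars G L S)" "card (chars G L S) * card L = card S" for S
    using that
  proof (induction "card (carrier G) - card S" arbitrary: S rule: less_induct)
    case less
    show ?case
    proof (cases "S = carrier G")
      case False
      then obtain y where y: "y \<in> carrier G" "y \<notin> S" using less.prems(1) subgroup.subset by blast
      obtain k where k: "y [^] (p ^ k) \<notin> S" "(y [^] (p ^ k)) [^] p \<in> S"
        using exists_pow_prime [OF less.prems(1) y] by blast
      define x where "x = y [^] (p ^ k)"
      have x: "x \<in> carrier G" "x \<notin> S" "x [^] p \<in> S" using k y by (auto simp: x_def)
      have N: "S \<lhd> G" by (rule normal_of_derived [OF less.prems(1)]) (use L less.prems in auto)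
      note c = chars_adjoin [OF less.prems(1,2) L(2) x less.prems(3)]
      have cA: "card (adjoin G S x) = p * card S" by (rule card_adjoin [OF finite_carrier less.prems(1) x prime_p])
      have sA: "subgroup (adjoin G S x) G" by (rule subgroup_adjoin [OF finite_carrier N x(1)])
      have "card S > 0"
        using less.prems(1) finite_subset_carrier subgroup.subset subgroup.one_closed
        by (metis card_gt_0_iff empty_iff)
      then have "card S < card (adjoin G S x)"
        unfolding cA using prime_gt_1_nat [OF prime_p] by simp
      moreover have "card (adjoin G S x) \<le> card (carrier G)"
        using sA finite_carrier subgroup.subset card_mono by metis
      ultimately have d: "card (carrier G) - card (adjoin G S x) < card (carrier G) - card S" by linarith
      show ?thesis
      proof (rule less.hyps [OF d sA _ c(1)])
        show "L \<subseteq> adjoin G S x" using subset_adjoin less.prems(1,2) subgroup.subset by blast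
        show "card (chars G L (adjoin G S x)) * card L = card (adjoin G S x)"
          unfolding c(2) cA using less.prems(4) by simp
      qed
    qed (use less in \<open>simp add: order_def\<close>)
  qed
  moreover have "chars G L L = {\<lambda>x\<in>L. 1}"
  proof (intro subset_antisym subsetI)
    fix \<chi> assume "\<chi> \<in> chars G L L"
    then show "\<chi> \<in> {\<lambda>x\<in>L. 1}" by (auto simp: chars_def extensional_def fun_eq_iff)
  next
    fix \<chi> :: "'a \<Rightarrow> complex" assume "\<chi> \<in> {\<lambda>x\<in>L. 1}"
    then show "\<chi> \<in> chars G L L"
      using subgroup.m_closed [OF L(1)] by (auto simp: chars_def hom_def)
  qed
  ultimately show ?thesis using L(1) by (simp add: order_G)
qed

end


section \<open>The commutator pairing of a cocycle\<close>

text \<open>For commuting \<open>g\<close> and \<open>h\<close> this is the scalar with u_g u_h =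
  \<open>eps \<alpha> g h\<close> u_h u_g in the twisted group algebra, which explains why it is
  multiplicative in each argument on commuting elements.\<close>

definition eps :: "('a \<times> 'a \<Rightarrow> complex) \<Rightarrow> 'a \<Rightarrow> 'a \<Rightarrow> complex" where
  "eps \<alpha> g h = \<alpha> (g, h) / \<alpha> (h, g)"

text \<open>For central \<open>z\<close> this is the subgroup A of the overview: those
  \<open>g\<close> for which u_g and u_z commute in every twisted group algebra.\<close>

definition ann :: "('a, 'm) monoid_scheme \<Rightarrow> 'a \<Rightarrow> 'a set" where
  "ann G z = {g \<in> carrier G. \<forall>\<alpha>\<in>cocycles2 G. eps \<alpha> g z = 1}"

lemma cocycle_nonzero:
  "\<alpha> \<in> cocycles2 G \<Longrightarrow> g \<in> carrier G \<Longrightarrow> h \<in> carrier G \<Longrightarrow> \<alpha> (g, h) \<noteq> 0"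
  by (auto simp: cocycles2_def cochains2_def PiE_iff)

lemma cocycle_eq:
  "\<alpha> \<in> cocycles2 G \<Longrightarrow> g \<in> carrier G \<Longrightarrow> h \<in> carrier G \<Longrightarrow> k \<in> carrier G \<Longrightarrow>
    \<alpha> (g, h) * \<alpha> (g \<otimes>\<^bsub>G\<^esub> h, k) = \<alpha> (h, k) * \<alpha> (g, h \<otimes>\<^bsub>G\<^esub> k)"
  by (auto simp: cocycles2_def)

lemma cocycle_extensional: "\<alpha> \<in> cocycles2 G \<Longrightarrow> \<alpha> \<in> extensional (carrier G \<times> carrier G)"
  by (simp add: cocycles2_def cochains2_def PiE_def)

lemma cocycles2I:
  assumes "\<And>g h. g \<in> carrier G \<Longrightarrow> h \<in> carrier G \<Longrightarrow> \<alpha> (g, h) \<noteq> 0"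
    and "\<alpha> \<in> extensional (carrier G \<times> carrier G)"
    and "\<And>g h k. g \<in> carrier G \<Longrightarrow> h \<in> carrier G \<Longrightarrow> k \<in> carrier G \<Longrightarrow>
      \<alpha> (g, h) * \<alpha> (g \<otimes>\<^bsub>G\<^esub> h, k) = \<alpha> (h, k) * \<alpha> (g, h \<otimes>\<^bsub>G\<^esub> k)"
  shows "\<alpha> \<in> cocycles2 G"
  using assms by (auto simp: cocycles2_def cochains2_def PiE_iff)

context group
begin

lemma eps_nonzero:
  "\<alpha> \<in> cocycles2 G \<Longrightarrow> g \<in> carrier G \<Longrightarrow> h \<in> carrier G \<Longrightarrow> eps \<alpha> g h \<noteq> 0"
  by (simp add: eps_def cocycle_nonzero)

lemma eps_self [simp]: "\<alpha> \<in> cocycles2 G \<Longrightarrow> g \<in> carrier G \<Longrightarrow> eps \<alpha> g g = 1"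
  by (simp add: eps_def cocycle_nonzero)

lemma eps_swap: "eps \<alpha> g h = inverse (eps \<alpha> h g)"
  by (simp add: eps_def)

text \<open>Conjugation by u_g multiplies u_h and u_k by scalars, hence their product by the product
  of these scalars.\<close>

lemma eps_mult_right:
  assumes \<alpha>: "\<alpha> \<in> cocycles2 G" and c: "g \<in> carrier G" "h \<in> carrier G" "k \<in> carrier G"
    and com: "g \<otimes> h = h \<otimes> g" "g \<otimes> k = k \<otimes> g"
  shows "eps \<alpha> g (h \<otimes> k) = eps \<alpha> g h * eps \<alpha> g k"
proof -
  note n = cocycle_nonzero [OF \<alpha>]
  have 1: "\<alpha> (g, h) * \<alpha> (g \<otimes> h, k) = \<alpha> (h, k) * \<alpha> (g, h \<otimes> k)"
    using cocycle_eq [OF \<alpha>] c by blast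
  have 2: "\<alpha> (h, g) * \<alpha> (g \<otimes> h, k) = \<alpha> (g, k) * \<alpha> (h, k \<otimes> g)"
    using cocycle_eq [OF \<alpha> c(2,1,3)] com by simp
  have 3: "\<alpha> (h, k) * \<alpha> (h \<otimes> k, g) = \<alpha> (k, g) * \<alpha> (h, k \<otimes> g)"
    using cocycle_eq [OF \<alpha> c(2,3,1)] by simp
  \<comment> \<open>\<open>M\<close> and \<open>Q\<close> stand for the cocycle values at
    \<open>(g \<otimes> h, k)\<close> and \<open>(h, k \<otimes> g)\<close>, which are eliminated
    from the three identities.\<close>
  have aux: "P / R = (A / B) * (D / E)"
    if "A * M = C * P" "B * M = D * Q" "C * R = E * Q" "B \<noteq> 0" "C \<noteq> 0" "E \<noteq> 0" "R \<noteq> 0"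
    for A B C D E M P Q R :: complex
  proof -
    have "C * (P * (B * E)) = (A * M) * (B * E)" using that(1) by simp
    also have "\<dots> = A * E * (B * M)" by simp
    also have "\<dots> = A * D * (E * Q)" unfolding that(2) by simp
    also have "\<dots> = C * (A * D * R)" unfolding that(3) [symmetric] by simp
    finally have "P * (B * E) = A * D * R" using that(5) by simp
    then show ?thesis using that by (simp add: field_simps)
  qed
  show ?thesis
    unfolding eps_def by (rule aux [OF 1 2 3]) (use n c in auto)
qed

lemma eps_mult_left:
  assumes \<alpha>: "\<alpha> \<in> cocycles2 G" and c: "g \<in> carrier G" "h \<in> carrier G" "k \<in> carrier G"
    and com: "h \<otimes> g = g \<otimes> h" "k \<otimes> g = g \<otimes> k"
  shows "eps \<alpha> (h \<otimes> k) g = eps \<alpha> h g * eps \<alpha> k g"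
  using eps_mult_right [OF \<alpha> c com [symmetric]]
  by (metis eps_swap inverse_mult_distrib)

lemma eps_one_right: "\<alpha> \<in> cocycles2 G \<Longrightarrow> g \<in> carrier G \<Longrightarrow> eps \<alpha> g \<one> = 1"
  using eps_mult_right [of \<alpha> g \<one> \<one>] eps_nonzero [of \<alpha> g \<one>] by simp

lemma eps_one_left: "\<alpha> \<in> cocycles2 G \<Longrightarrow> g \<in> carrier G \<Longrightarrow> eps \<alpha> \<one> g = 1"
  using eps_one_right eps_swap by (metis inverse_1)

lemma commute_pow:
  assumes "g \<in> carrier G" "h \<in> carrier G" "g \<otimes> h = h \<otimes> g"
  shows "g \<otimes> h [^] (i::nat) = h [^] i \<otimes> g"
proof -
  have "h \<in> centralizer G g" using assms by (simp add: centralizer_iff)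
  then have "h [^] i \<in> centralizer G g"
    using subgroup_nat_pow_closed [OF subgroup_centralizer] assms by blast
  then show ?thesis by (simp add: centralizer_iff)
qed

lemma eps_pow_right:
  assumes "\<alpha> \<in> cocycles2 G" "g \<in> carrier G" "h \<in> carrier G" "g \<otimes> h = h \<otimes> g"
  shows "eps \<alpha> g (h [^] (i::nat)) = eps \<alpha> g h ^ i"
  by (induction i) (use assms in \<open>simp_all add: eps_one_right eps_mult_right commute_pow\<close>)

lemma eps_pow_left:
  assumes "\<alpha> \<in> cocycles2 G" "g \<in> carrier G" "h \<in> carrier G" "g \<otimes> h = h \<otimes> g"
  shows "eps \<alpha> (h [^] (i::nat)) g = eps \<alpha> h g ^ i"
  using eps_pow_right [OF assms] eps_swap by (metis power_inverse)

text \<open>Conjugation by \<open>g\<close> in the twisted group algebra sends \<open>u\<^sub>x\<close> to a scalar multiple of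
  \<open>u\<^bsub>gxg\<^sup>-\<^sup>1\<^esub>\<close>; \<open>f\<close> is this scalar.\<close>

lemma eps_conj:
  assumes \<alpha>: "\<alpha> \<in> cocycles2 G" and c: "g \<in> carrier G" "x \<in> carrier G" "y \<in> carrier G"
    and com: "x \<otimes> y = y \<otimes> x"
  shows "eps \<alpha> (g \<otimes> x \<otimes> inv g) (g \<otimes> y \<otimes> inv g) = eps \<alpha> x y"
proof -
  note n = cocycle_nonzero [OF \<alpha>]
  let ?c = "\<lambda>x. g \<otimes> x \<otimes> inv g"
  define f where "f x = \<alpha> (g, x) / \<alpha> (?c x, g)" for x
  \<comment> \<open>Conjugation by u_g is multiplicative: both sides are the scalar in the conjugate
    of u_x u_y.\<close>
  have main: "\<alpha> (x, y) * f (x \<otimes> y) = f x * f y * \<alpha> (?c x, ?c y)"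
    if xy: "x \<in> carrier G" "y \<in> carrier G" for x y
  proof -
    have cc: "?c x \<in> carrier G" "?c y \<in> carrier G" using c xy by auto
    have e: "?c x \<otimes> g = g \<otimes> x" "?c y \<otimes> g = g \<otimes> y" "?c x \<otimes> ?c y = ?c (x \<otimes> y)"
      using c xy by (simp_all add: m_assoc)
    have 1: "\<alpha> (g, x) * \<alpha> (g \<otimes> x, y) = \<alpha> (x, y) * \<alpha> (g, x \<otimes> y)"
      using cocycle_eq [OF \<alpha> c(1) xy] .
    have 2: "\<alpha> (?c x, g) * \<alpha> (g \<otimes> x, y) = \<alpha> (g, y) * \<alpha> (?c x, g \<otimes> y)"
      using cocycle_eq [OF \<alpha> cc(1) c(1) xy(2)] e by simp
    have 3: "\<alpha> (?c x, ?c y) * \<alpha> (?c (x \<otimes> y), g) = \<alpha> (?c y, g) * \<alpha> (?c x, g \<otimes> y)"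
      using cocycle_eq [OF \<alpha> cc c(1)] e by simp
    have nz: "\<alpha> (g, x) \<noteq> 0" "\<alpha> (g, y) \<noteq> 0" "\<alpha> (?c x, g) \<noteq> 0" "\<alpha> (?c y, g) \<noteq> 0"
      "\<alpha> (?c (x \<otimes> y), g) \<noteq> 0" "\<alpha> (x, y) \<noteq> 0"
      using n c xy by auto
    have "\<alpha> (g, x \<otimes> y) = \<alpha> (g, x) * \<alpha> (g \<otimes> x, y) / \<alpha> (x, y)"
      using 1 nz by (simp add: field_simps)
    moreover have "\<alpha> (g \<otimes> x, y) = \<alpha> (g, y) * \<alpha> (?c x, g \<otimes> y) / \<alpha> (?c x, g)"
      using 2 nz by (simp add: field_simps)
    moreover have "\<alpha> (?c x, ?c y) = \<alpha> (?c y, g) * \<alpha> (?c x, g \<otimes> y) / \<alpha> (?c (x \<otimes> y), g)"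
      using 3 nz by (simp add: field_simps)
    ultimately show ?thesis
      unfolding f_def using nz by (simp add: field_simps)
  qed
  have fnz: "f x \<noteq> 0" if "x \<in> carrier G" for x
    using n c that by (simp add: f_def)
  have "\<alpha> (?c x, ?c y) = \<alpha> (x, y) * f (x \<otimes> y) / (f x * f y)"
    using main [OF c(2,3)] fnz c by (simp add: field_simps)
  moreover have "\<alpha> (?c y, ?c x) = \<alpha> (y, x) * f (x \<otimes> y) / (f x * f y)"
    using main [OF c(3,2)] fnz c com by (simp add: field_simps)
  ultimately show ?thesis
    unfolding eps_def using fnz c by simp
qed

text \<open>On the centralizer of \<open>c\<close> the map \<open>eps \<alpha> c\<close> is
  multiplicative with values in an abelian group, and \<open>g h = [g,h] h g\<close>.\<close>

lemma eps_commutator: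
  assumes \<alpha>: "\<alpha> \<in> cocycles2 G" and c: "c \<in> carrier G" "g \<in> carrier G" "h \<in> carrier G"
    and com: "c \<otimes> g = g \<otimes> c" "c \<otimes> h = h \<otimes> c"
  shows "eps \<alpha> c (commutator G g h) = 1"
proof -
  have m: "g \<in> centralizer G c" "h \<in> centralizer G c" using c com by (auto simp: centralizer_iff)
  note s = subgroup_centralizer [OF c(1)]
  have cm: "commutator G g h \<in> centralizer G c" "h \<otimes> g \<in> centralizer G c"
    unfolding commutator_def using m s by (auto intro: subgroup.m_closed subgroup.m_inv_closed)
  then have e: "c \<otimes> commutator G g h = commutator G g h \<otimes> c" "c \<otimes> (h \<otimes> g) = (h \<otimes> g) \<otimes> c"
    by (simp_all add: centralizer_iff)
  have "eps \<alpha> c g * eps \<alpha> c h = eps \<alpha> c (commutator G g h \<otimes> (h \<otimes> g))"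
    unfolding commutator_mult [OF c(2,3), symmetric] by (rule eps_mult_right [OF \<alpha> c com, symmetric])
  also have "\<dots> = eps \<alpha> c (commutator G g h) * (eps \<alpha> c h * eps \<alpha> c g)"
    using eps_mult_right [OF \<alpha> c(1) _ _ e] eps_mult_right [OF \<alpha> c(1,3,2) com(2,1)] c by simp
  finally show ?thesis using eps_nonzero [OF \<alpha>] c by simp
qed

lemma ann_iff: "g \<in> ann G z \<longleftrightarrow> g \<in> carrier G \<and> (\<forall>\<alpha>\<in>cocycles2 G. eps \<alpha> g z = 1)"
  unfolding ann_def by blast

lemma subgroup_ann:
  assumes fin: "finite (carrier G)" and z: "z \<in> center G" shows "subgroup (ann G z) G"
proof (rule finite_subgroupI [OF fin])
  note zc = center_closed [OF z]
  show "\<one> \<in> ann G z" using zc by (simp add: ann_iff eps_one_left)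
  fix x y assume "x \<in> ann G z" "y \<in> ann G z"
  then show "x \<otimes> y \<in> ann G z"
    using eps_mult_left [OF _ zc] center_comm [OF z] by (simp add: ann_iff)
qed (auto simp: ann_iff)

lemma derived_subset_ann:
  assumes fin: "finite (carrier G)" and z: "z \<in> center G" shows "derived G (carrier G) \<subseteq> ann G z"
proof (rule derived_subsetI [OF subgroup_ann [OF assms]])
  note zc = center_closed [OF z]
  fix g h assume gh: "g \<in> carrier G" "h \<in> carrier G"
  have "eps \<alpha> z (commutator G g h) = 1" if "\<alpha> \<in> cocycles2 G" for \<alpha>
    by (rule eps_commutator [OF that zc gh]) (simp_all add: center_comm [OF z] gh)
  then show "commutator G g h \<in> ann G z"
    using gh by (simp add: ann_iff) (metis eps_swap inverse_1)
qed

lemma ann_powers: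
  assumes z: "z \<in> center G" and y: "y \<in> center G" "z \<in> powers G y"
  shows "ann G y \<subseteq> ann G z"
proof
  fix g assume g: "g \<in> ann G y"
  obtain i where i: "z = y [^] (i::nat)" using y by (auto simp: powers_def)
  show "g \<in> ann G z"
    using g eps_pow_right [of _ g y i] center_closed [OF y(1)] center_comm [OF y(1)]
    by (simp add: ann_iff i)
qed

end

text \<open>Each pairing with \<open>z\<close> is a character of \<open>G\<close> trivial on
  \<open>ann G z\<close>, and \<open>card_chars\<close> counts these characters.\<close>

lemma (in p_group) card_pairings:
  assumes z: "z \<in> center G"
  shows "finite ((\<lambda>\<alpha>. \<lambda>g\<in>carrier G. eps \<alpha> g z) ` cocycles2 G)"
    and "card ((\<lambda>\<alpha>. \<lambda>g\<in>carrier G. eps \<alpha> g z) ` cocycles2 G) * card (ann G z) \<le> p ^ n"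
proof -
  note zc = center_closed [OF z]
  let ?X = "(\<lambda>\<alpha>. \<lambda>g\<in>carrier G. eps \<alpha> g z) ` cocycles2 G"
  note c = card_chars [OF subgroup_ann [OF finite_carrier z] derived_subset_ann [OF finite_carrier z]]
  have "?X \<subseteq> chars G (ann G z) (carrier G)"
  proof
    fix \<chi> assume "\<chi> \<in> ?X"
    then obtain \<alpha> where \<alpha>: "\<alpha> \<in> cocycles2 G" and \<chi>: "\<chi> = (\<lambda>g\<in>carrier G. eps \<alpha> g z)" by blast
    have "\<chi> \<in> hom (G\<lparr>carrier := carrier G\<rparr>) complex_units"
    proof (rule homI)
      fix x assume "x \<in> carrier (G\<lparr>carrier := carrier G\<rparr>)"
      then show "\<chi> x \<in> carrier complex_units" using eps_nonzero [OF \<alpha> _ zc] by (simp add: \<chi>)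
    next
      fix x y assume "x \<in> carrier (G\<lparr>carrier := carrier G\<rparr>)" "y \<in> carrier (G\<lparr>carrier := carrier G\<rparr>)"
      then show "\<chi> (x \<otimes>\<^bsub>G\<lparr>carrier := carrier G\<rparr>\<^esub> y) = \<chi> x \<otimes>\<^bsub>complex_units\<^esub> \<chi> y"
        using eps_mult_left [OF \<alpha> zc] center_comm [OF z] by (simp add: \<chi>)
    qed
    then show "\<chi> \<in> chars G (ann G z) (carrier G)"
      unfolding chars_def using \<alpha> by (auto simp: \<chi> ann_iff)
  qed
  then show f: "finite ?X" and "card ?X * card (ann G z) \<le> p ^ n"
    using c finite_subset card_mono mult_le_mono1 by metis+
qed


section \<open>Inflation from a central quotient\<close>

lemma (in group_hom) order_kernel_image:
  "order G = card (kernel G H h) * card (h ` carrier G)"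
proof -
  have "bij_betw (\<lambda>C. the_elem (h ` C)) (carrier (G Mod kernel G H h)) (h ` carrier G)"
  proof -
    have img: "subgroup (h ` carrier G) H" by (rule img_is_subgroup)
    interpret I: group "H\<lparr>carrier := h ` carrier G\<rparr>" by (rule H.subgroup_imp_group [OF img])
    interpret r: group_hom G "H\<lparr>carrier := h ` carrier G\<rparr>" h
      by unfold_locales (auto simp: hom_def)
    have "kernel G (H\<lparr>carrier := h ` carrier G\<rparr>) h = kernel G H h" by (simp add: kernel_def)
    then show ?thesis using r.FactGroup_iso_set by (auto simp: iso_def)
  qed
  then have "card (rcosets kernel G H h) = card (h ` carrier G)"
    using bij_betw_same_card by (auto simp: FactGroup_def)
  then show ?thesis using G.lagrange [OF subgroup_kernel] by (metis mult.commute)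
qed

lemma Z2_simps: "carrier (Z2 G) = cocycles2 G" "\<alpha> \<otimes>\<^bsub>Z2 G\<^esub> \<beta> = (\<lambda>q\<in>carrier G \<times> carrier G. \<alpha> q * \<beta> q)"
  by (simp_all add: Z2_def cochains2_def)

definition cohom_class :: "('a, 'm) monoid_scheme \<Rightarrow> ('a \<times> 'a \<Rightarrow> complex) \<Rightarrow> ('a \<times> 'a \<Rightarrow> complex) set" where
  "cohom_class G \<alpha> = coboundaries2 G #>\<^bsub>Z2 G\<^esub> \<alpha>"

context group
begin

lemma cohom_class_hom: "cohom_class G \<in> hom (Z2 G) (H2 G)"
proof -
  interpret Z: comm_group "Z2 G" by (rule comm_group_Z2 [OF is_group])
  interpret N: normal "coboundaries2 G" "Z2 G"
    using Z.subgroup_imp_normal [OF subgroup_coboundaries2 [OF is_group]] .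
  show ?thesis unfolding cohom_class_def H2_def by (rule N.r_coset_hom_Mod)
qed

lemma carrier_H2: "carrier (H2 G) = cohom_class G ` cocycles2 G"
  unfolding H2_def carrier_FactGroup cohom_class_def Z2_simps ..

lemma cohom_class_eqI:
  assumes \<alpha>: "\<alpha> \<in> cocycles2 G" and \<beta>: "\<beta> \<in> cocycles2 G" and f: "f \<in> carrier (cochains1 G)"
    and e: "\<And>g h. g \<in> carrier G \<Longrightarrow> h \<in> carrier G \<Longrightarrow> \<beta> (g, h) = coboundary G f (g, h) * \<alpha> (g, h)"
  shows "cohom_class G \<alpha> = cohom_class G \<beta>"
proof -
  interpret Z: comm_group "Z2 G" by (rule comm_group_Z2 [OF is_group])
  have "\<beta> = coboundary G f \<otimes>\<^bsub>Z2 G\<^esub> \<alpha>"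
    unfolding Z2_simps
    by (rule extensionalityI [OF cocycle_extensional [OF \<beta>]]) (use e in auto)
  then have "\<beta> \<in> coboundaries2 G #>\<^bsub>Z2 G\<^esub> \<alpha>"
    using f by (auto simp: r_coset_def coboundaries2_def)
  then show ?thesis
    unfolding cohom_class_def
    using Z.repr_independence [OF _ _ subgroup_coboundaries2 [OF is_group]] \<alpha> by (simp add: Z2_simps)
qed

lemma cohom_class_eqD:
  assumes \<alpha>: "\<alpha> \<in> cocycles2 G" and \<beta>: "\<beta> \<in> cocycles2 G" and e: "cohom_class G \<alpha> = cohom_class G \<beta>"
  obtains f where "f \<in> carrier (cochains1 G)"
    "\<And>g h. g \<in> carrier G \<Longrightarrow> h \<in> carrier G \<Longrightarrow> \<beta> (g, h) = coboundary G f (g, h) * \<alpha> (g, h)"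
proof -
  interpret Z: comm_group "Z2 G" by (rule comm_group_Z2 [OF is_group])
  have "\<beta> \<in> coboundaries2 G #>\<^bsub>Z2 G\<^esub> \<alpha>"
    using e Z.repr_independenceD [OF subgroup_coboundaries2 [OF is_group], of \<beta> \<alpha>] \<beta>
    unfolding cohom_class_def Z2_simps by simp
  then obtain c where "c \<in> coboundaries2 G" "\<beta> = c \<otimes>\<^bsub>Z2 G\<^esub> \<alpha>" by (auto simp: r_coset_def)
  then show thesis using that by (auto simp: coboundaries2_def Z2_simps)
qed

end

definition inflate ::
  "('a, 'm) monoid_scheme \<Rightarrow> ('a \<Rightarrow> 'b) \<Rightarrow> ('b \<times> 'b \<Rightarrow> complex) \<Rightarrow> ('a \<times> 'a \<Rightarrow> complex)" where
  "inflate G \<pi> \<beta> = (\<lambda>(g, h)\<in>carrier G \<times> carrier G. \<beta> (\<pi> g, \<pi> h))"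

text \<open>The quotient is given by a surjection whose kernel is generated by \<open>z\<close>
  instead of by a group of cosets, so that \<open>Q\<close> may have the same element type as
  \<open>G\<close>.\<close>

locale central_quotient = p_group +
  fixes z :: 'a and Q :: "('c, 'k) monoid_scheme" and \<pi> :: "'a \<Rightarrow> 'c"
  assumes z: "z \<in> center G" "z \<noteq> \<one>" "z [^] p = \<one>"
    and group_Q: "group Q" and hom_\<pi>: "\<pi> \<in> hom G Q" and surj_\<pi>: "\<pi> ` carrier G = carrier Q"
    and kernel_\<pi>: "kernel G Q \<pi> = powers G z"
begin

sublocale Q: group Q by (rule group_Q)
sublocale \<pi>: group_hom G Q \<pi> by unfold_locales (rule hom_\<pi>)

lemma zc: "z \<in> carrier G" by (rule center_closed [OF z(1)])

lemma \<pi>_closed: "g \<in> carrier G \<Longrightarrow> \<pi> g \<in> carrier Q"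
  using surj_\<pi> by blast

lemma \<pi>_mult: "g \<in> carrier G \<Longrightarrow> h \<in> carrier G \<Longrightarrow> \<pi> (g \<otimes> h) = \<pi> g \<otimes>\<^bsub>Q\<^esub> \<pi> h"
  by simp

lemma powers_central: "k \<in> powers G z \<Longrightarrow> k \<in> center G"
  using powers_in_subgroup [OF subgroup_center z(1)] by blast

lemma powers_carrier: "k \<in> powers G z \<Longrightarrow> k \<in> carrier G"
  using powers_central center_closed by blast

lemma subgroup_K: "subgroup (powers G z) G"
  by (rule subgroup_powers [OF finite_carrier zc])

lemma \<pi>_eqD:
  assumes "g \<in> carrier G" "h \<in> carrier G" "\<pi> g = \<pi> h"
  shows "inv g \<otimes> h \<in> powers G z"
proof -
  have "\<pi> (inv g \<otimes> h) = \<one>\<^bsub>Q\<^esub>" using assms by (simp add: \<pi>_closed)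
  then have "inv g \<otimes> h \<in> kernel G Q \<pi>" using assms by (simp add: kernel_def)
  then show ?thesis using kernel_\<pi> by simp
qed

lemma \<pi>_kernel: "k \<in> powers G z \<Longrightarrow> \<pi> k = \<one>\<^bsub>Q\<^esub>"
  using kernel_\<pi> by (auto simp: kernel_def)

lemma inflate_cocycle:
  assumes "\<beta> \<in> cocycles2 Q" shows "inflate G \<pi> \<beta> \<in> cocycles2 G"
proof (rule cocycles2I)
  show "inflate G \<pi> \<beta> \<in> extensional (carrier G \<times> carrier G)" by (simp add: inflate_def)
qed (use cocycle_nonzero [OF assms] cocycle_eq [OF assms] \<pi>_closed in \<open>auto simp: inflate_def\<close>)

lemma inflate_hom: "inflate G \<pi> \<in> hom (Z2 Q) (Z2 G)"
  by (rule homI) (auto simp: Z2_simps inflate_cocycle, auto simp: inflate_def \<pi>_closed fun_eq_iff)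

text \<open>A coboundary on \<open>Q\<close> inflates to the coboundary of the composed cochain, so
  inflation descends to classes by the universal property of the factor group.\<close>

lemma inflation:
  obtains \<iota> where "\<iota> \<in> hom (H2 Q) (H2 G)"
    "\<And>\<beta>. \<beta> \<in> cocycles2 Q \<Longrightarrow> \<iota> (cohom_class Q \<beta>) = cohom_class G (inflate G \<pi> \<beta>)"
proof -
  interpret ZQ: comm_group "Z2 Q" by (rule comm_group_Z2 [OF group_Q])
  have N: "coboundaries2 Q \<lhd> Z2 Q"
    using ZQ.subgroup_imp_normal [OF subgroup_coboundaries2 [OF group_Q]] .
  have h: "(\<lambda>\<beta>. cohom_class G (inflate G \<pi> \<beta>)) \<in> hom (Z2 Q) (H2 G)"
  proof (rule homI)
    fix \<alpha> \<beta> assume ab: "\<alpha> \<in> carrier (Z2 Q)" "\<beta> \<in> carrier (Z2 Q)"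
    show "cohom_class G (inflate G \<pi> (\<alpha> \<otimes>\<^bsub>Z2 Q\<^esub> \<beta>)) =
        cohom_class G (inflate G \<pi> \<alpha>) \<otimes>\<^bsub>H2 G\<^esub> cohom_class G (inflate G \<pi> \<beta>)"
      unfolding hom_mult [OF inflate_hom ab]
      by (rule hom_mult [OF cohom_class_hom hom_in_carrier [OF inflate_hom ab(1)] hom_in_carrier [OF inflate_hom ab(2)]])
  qed (rule hom_in_carrier [OF cohom_class_hom hom_in_carrier [OF inflate_hom]])
  have "cohom_class G (inflate G \<pi> \<beta>) = cohom_class G (inflate G \<pi> \<beta>')"
    if b: "\<beta> \<in> cocycles2 Q" "\<beta>' \<in> cocycles2 Q" and e: "cohom_class Q \<beta> = cohom_class Q \<beta>'" for \<beta> \<beta>'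
  proof -
    obtain f where f: "f \<in> carrier (cochains1 Q)"
      and fe: "\<And>g h. g \<in> carrier Q \<Longrightarrow> h \<in> carrier Q \<Longrightarrow> \<beta>' (g, h) = coboundary Q f (g, h) * \<beta> (g, h)"
      using Q.cohom_class_eqD [OF b e] by blast
    show ?thesis
    proof (rule cohom_class_eqI [OF inflate_cocycle [OF b(1)] inflate_cocycle [OF b(2)]])
      show "(\<lambda>g\<in>carrier G. f (\<pi> g)) \<in> carrier (cochains1 G)"
        using f \<pi>_closed by (auto simp: cochains1_def PiE_iff)
    qed (use fe \<pi>_closed in \<open>simp add: inflate_def coboundary_def\<close>)
  qed
  then obtain \<iota> where "\<iota> \<in> hom (Z2 Q Mod coboundaries2 Q) (H2 G)"
    "\<And>\<beta>. \<beta> \<in> carrier (Z2 Q) \<Longrightarrow> \<iota> (coboundaries2 Q #>\<^bsub>Z2 Q\<^esub> \<beta>) = cohom_class G (inflate G \<pi> \<beta>)"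
    using FactGroup_universal [OF h N] unfolding cohom_class_def Z2_simps by blast
  then show thesis using that unfolding H2_def [symmetric] cohom_class_def [symmetric] Z2_simps by blast
qed

text \<open>The cocycle identity with one argument in the kernel shows that \<open>\<alpha>\<close>
  is constant on cosets in each variable; in the first variable the kernel element is moved across
  to the second, where centrality lets it pass to the right.\<close>

lemma deflate:
  assumes \<alpha>: "\<alpha> \<in> cocycles2 G"
    and one: "\<And>g k. g \<in> carrier G \<Longrightarrow> k \<in> powers G z \<Longrightarrow> \<alpha> (g, k) = 1 \<and> \<alpha> (k, g) = 1"
  obtains \<beta> where "\<beta> \<in> cocycles2 Q" "\<alpha> = inflate G \<pi> \<beta>"
proof -
  have r: "\<alpha> (g, h \<otimes> k) = \<alpha> (g, h)" if "g \<in> carrier G" "h \<in> carrier G" "k \<in> powers G z" for g h k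
    using cocycle_eq [OF \<alpha> that(1,2) powers_carrier [OF that(3)]] one that by simp
  have l: "\<alpha> (g \<otimes> k, h) = \<alpha> (g, h)" if "g \<in> carrier G" "h \<in> carrier G" "k \<in> powers G z" for g h k
  proof -
    have "\<alpha> (g \<otimes> k, h) = \<alpha> (g, k \<otimes> h)"
      using cocycle_eq [OF \<alpha> that(1) powers_carrier [OF that(3)] that(2)] one that by simp
    also have "k \<otimes> h = h \<otimes> k" using center_comm [OF powers_central [OF that(3)] that(2)] by simp
    finally show ?thesis using r that by simp
  qed
  have inv: "\<alpha> (g, h) = \<alpha> (g', h')"
    if "g \<in> carrier G" "h \<in> carrier G" "g' \<in> carrier G" "h' \<in> carrier G" "\<pi> g = \<pi> g'" "\<pi> h = \<pi> h'" for g h g' h'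
  proof -
    have "\<alpha> (g, h) = \<alpha> (g \<otimes> (inv g \<otimes> g'), h)" using l \<pi>_eqD that by metis
    also have "\<dots> = \<alpha> (g', h \<otimes> (inv h \<otimes> h'))" using r \<pi>_eqD that by (metis cancel_inv(2))
    also have "\<dots> = \<alpha> (g', h')" using that by simp
    finally show ?thesis .
  qed
  define t where "t = inv_into (carrier G) \<pi>"
  have t: "t q \<in> carrier G" "\<pi> (t q) = q" if "q \<in> carrier Q" for q
    unfolding t_def using that surj_\<pi> by (metis inv_into_into, metis f_inv_into_f)
  define \<beta> where "\<beta> = (\<lambda>(q, r)\<in>carrier Q \<times> carrier Q. \<alpha> (t q, t r))"
  have \<beta>: "\<beta> (\<pi> g, \<pi> h) = \<alpha> (g, h)" if "g \<in> carrier G" "h \<in> carrier G" for g h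
    using inv [of "t (\<pi> g)" "t (\<pi> h)" g h] that t \<pi>_closed by (simp add: \<beta>_def)
  have "\<beta> \<in> cocycles2 Q"
  proof (rule cocycles2I)
    fix q r assume "q \<in> carrier Q" "r \<in> carrier Q"
    then show "\<beta> (q, r) \<noteq> 0" using t cocycle_nonzero [OF \<alpha>] by (simp add: \<beta>_def)
  next
    fix q r s assume "q \<in> carrier Q" "r \<in> carrier Q" "s \<in> carrier Q"
    then have "q \<in> \<pi> ` carrier G" "r \<in> \<pi> ` carrier G" "s \<in> \<pi> ` carrier G"
      unfolding surj_\<pi> .
    then obtain g h k where c: "g \<in> carrier G" "h \<in> carrier G" "k \<in> carrier G"
      and e: "q = \<pi> g" "r = \<pi> h" "s = \<pi> k"
      by (elim imageE)
    have "q \<otimes>\<^bsub>Q\<^esub> r = \<pi> (g \<otimes> h)" "r \<otimes>\<^bsub>Q\<^esub> s = \<pi> (h \<otimes> k)"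
      unfolding e using \<pi>_mult c by metis+
    then show "\<beta> (q, r) * \<beta> (q \<otimes>\<^bsub>Q\<^esub> r, s) = \<beta> (r, s) * \<beta> (q, r \<otimes>\<^bsub>Q\<^esub> s)"
      unfolding e using cocycle_eq [OF \<alpha> c] \<beta> c by (metis m_closed)
  qed (simp add: \<beta>_def)
  moreover have "\<alpha> = inflate G \<pi> \<beta>"
    by (rule extensionalityI [OF cocycle_extensional [OF \<alpha>]]) (auto simp: inflate_def \<beta>)
  ultimately show thesis using that by blast
qed

lemma pow_z_eq_iff: "z [^] (i::nat) = z [^] (j::nat) \<longleftrightarrow> i mod p = j mod p"
proof -
  have *: "z [^] i = z [^] j \<longleftrightarrow> p dvd j - i" if "i \<le> j" for i j :: nat
  proof -
    have "z [^] i \<otimes> z [^] (j - i) = z [^] j" using that zc by (simp add: nat_pow_mult)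
    then have "z [^] i = z [^] j \<longleftrightarrow> z [^] (j - i) = \<one>"
      using zc by (metis l_cancel_one' nat_pow_closed)
    also have "\<dots> \<longleftrightarrow> p dvd j - i"
      using pow_prime_mem_iff [OF finite_carrier triv_subgroup zc _ _ prime_p, of "j - i"] z by simp
    finally show ?thesis .
  qed
  show ?thesis
  proof (cases "i \<le> j")
    case True
    then show ?thesis using *[OF True] by (metis mod_eq_dvd_iff_nat)
  next
    case False
    then show ?thesis using *[of j i] by (metis mod_eq_dvd_iff_nat nle_le)
  qed
qed

text \<open>Functions on the cyclic kernel are prescribed through exponents; periodicity makes this
  legitimate since \<open>z\<close> has order \<open>p\<close>.\<close>

lemma periodic_fun:
  assumes "\<And>i. F (i + p) = F i"
  obtains \<phi> where "\<And>i. \<phi> (z [^] (i::nat)) = F i"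
proof -
  have per: "F (i + p * m) = F i" for i m
  proof (induction m)
    case (Suc m)
    have "F (i + p * Suc m) = F (i + p * m + p)" by (simp add: algebra_simps)
    then show ?case using assms Suc by simp
  qed simp
  have mod: "F i = F (i mod p)" for i
    using per [of "i mod p" "i div p"] by simp
  define \<phi> where "\<phi> w = F (SOME i. w = z [^] (i::nat))" for w
  have "\<phi> (z [^] i) = F i" for i
  proof -
    have "z [^] i = z [^] (SOME j::nat. z [^] i = z [^] j)" by (rule someI [of _ i]) (rule refl)
    then have "i mod p = (SOME j::nat. z [^] i = z [^] j) mod p" using pow_z_eq_iff by blast
    then show ?thesis unfolding \<phi>_def using mod by metis
  qed
  then show thesis using that by blast
qed

text \<open>Here \<open>t g\<close> is the chosen representative of the coset of \<open>g\<close>, with \<open>1\<close> representing the trivial coset.\<close>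

lemma section_ex:
  obtains t \<kappa> where "\<And>g. g \<in> carrier G \<Longrightarrow> t g \<in> carrier G" "\<And>g. g \<in> carrier G \<Longrightarrow> \<kappa> g \<in> powers G z"
    "\<And>g. g \<in> carrier G \<Longrightarrow> g = t g \<otimes> \<kappa> g"
    "\<And>g k. g \<in> carrier G \<Longrightarrow> k \<in> powers G z \<Longrightarrow> t (g \<otimes> k) = t g"
    "\<And>g k. g \<in> carrier G \<Longrightarrow> k \<in> powers G z \<Longrightarrow> \<kappa> (g \<otimes> k) = \<kappa> g \<otimes> k"
    "\<And>k. k \<in> powers G z \<Longrightarrow> t k = \<one>"
    "\<And>k. k \<in> powers G z \<Longrightarrow> \<kappa> k = k"
proof -
  define s where "s q = (if q = \<one>\<^bsub>Q\<^esub> then \<one> else inv_into (carrier G) \<pi> q)" for q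
  have s: "s q \<in> carrier G" "\<pi> (s q) = q" if "q \<in> carrier Q" for q
    unfolding s_def using that surj_\<pi> by (auto intro: inv_into_into f_inv_into_f)
  define t where "t g = s (\<pi> g)" for g
  define \<kappa> where "\<kappa> g = inv (t g) \<otimes> g" for g
  have tc: "t g \<in> carrier G" if "g \<in> carrier G" for g using s \<pi>_closed that by (simp add: t_def)
  have kc: "k \<in> carrier G" "\<pi> k = \<one>\<^bsub>Q\<^esub>" if "k \<in> powers G z" for k
    using powers_carrier \<pi>_kernel that by auto
  have tk: "t (g \<otimes> k) = t g" if "g \<in> carrier G" "k \<in> powers G z" for g k
    using kc [OF that(2)] that \<pi>_closed by (simp add: t_def)
  have t1: "t k = \<one>" if "k \<in> powers G z" for k using kc [OF that] by (simp add: t_def s_def)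
  show thesis
  proof (rule that [of t \<kappa>])
    fix g assume g: "g \<in> carrier G"
    show "t g \<in> carrier G" using tc g .
    show "\<kappa> g \<in> powers G z" unfolding \<kappa>_def
      by (rule \<pi>_eqD) (use tc g s \<pi>_closed in \<open>auto simp: t_def\<close>)
    show "g = t g \<otimes> \<kappa> g" using tc g by (simp add: \<kappa>_def)
    fix k assume k: "k \<in> powers G z"
    show "t (g \<otimes> k) = t g" using tk g k .
    show "\<kappa> (g \<otimes> k) = \<kappa> g \<otimes> k" unfolding \<kappa>_def tk [OF g k] using g kc k tc by (simp add: m_assoc)
  next
    fix k assume k: "k \<in> powers G z"
    show "t k = \<one>" using t1 k .
    show "\<kappa> k = k" unfolding \<kappa>_def using t1 kc k by simp
  qed
qed

end

lemma (in group) cocycle_one: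
  assumes \<alpha>: "\<alpha> \<in> cocycles2 G" and g: "g \<in> carrier G"
  shows "\<alpha> (g, \<one>) = \<alpha> (\<one>, \<one>)" "\<alpha> (\<one>, g) = \<alpha> (\<one>, \<one>)"
  using cocycle_eq [OF \<alpha> g one_closed one_closed] cocycle_eq [OF \<alpha> one_closed one_closed g]
    cocycle_nonzero [OF \<alpha>] g by auto

lemma (in group) cocycle_mult_coboundary:
  assumes \<alpha>: "\<alpha> \<in> cocycles2 G" and f: "f \<in> carrier (cochains1 G)"
  shows "coboundary G f \<otimes>\<^bsub>Z2 G\<^esub> \<alpha> \<in> cocycles2 G"
proof -
  interpret Z: comm_group "Z2 G" by (rule comm_group_Z2 [OF is_group])
  show ?thesis
    using Z.m_closed [of "coboundary G f" \<alpha>] coboundary_in_cocycles2 [OF is_group f] \<alpha>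
    by (simp only: Z2_simps(1))
qed

lemma (in group) multiplicative_trivial_on_derived:
  fixes \<chi> :: "'a \<Rightarrow> complex"
  assumes fin: "finite (carrier G)" and nz: "\<And>g. g \<in> carrier G \<Longrightarrow> \<chi> g \<noteq> 0"
    and m: "\<And>g h. g \<in> carrier G \<Longrightarrow> h \<in> carrier G \<Longrightarrow> \<chi> (g \<otimes> h) = \<chi> g * \<chi> h"
    and z: "z \<in> derived G (carrier G)"
  shows "\<chi> z = 1"
proof -
  have one: "\<chi> \<one> = 1" using m [of \<one> \<one>] nz [of \<one>] by simp
  have s: "subgroup {g \<in> carrier G. \<chi> g = 1} G"
    by (rule finite_subgroupI [OF fin]) (use m one in auto)
  have "derived G (carrier G) \<subseteq> {g \<in> carrier G. \<chi> g = 1}"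
  proof (rule derived_subsetI [OF s])
    fix g h assume gh: "g \<in> carrier G" "h \<in> carrier G"
    have "\<chi> g * \<chi> h = \<chi> (commutator G g h) * (\<chi> h * \<chi> g)"
      using m gh commutator_mult [OF gh] by (metis commutator_closed m_closed)
    then have "\<chi> (commutator G g h) = 1" using nz gh by simp
    then show "commutator G g h \<in> {g \<in> carrier G. \<chi> g = 1}" using gh by simp
  qed
  then show ?thesis using z by auto
qed

context central_quotient
begin

text \<open>The multiplier of a cyclic group is trivial: in the twisted group algebra, the elements
  \<open>\<phi> k\<close> u_k for \<open>k\<close> in the kernel multiply like the group
  elements.\<close>

lemma trivialize_on_kernel:
  assumes \<alpha>: "\<alpha> \<in> cocycles2 G"
  obtains \<phi> where "\<And>k. k \<in> powers G z \<Longrightarrow> \<phi> k \<noteq> 0"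
    "\<And>k l. k \<in> powers G z \<Longrightarrow> l \<in> powers G z \<Longrightarrow> \<phi> (k \<otimes> l) = \<alpha> (k, l) * \<phi> k * \<phi> l"
proof -
  note n = cocycle_nonzero [OF \<alpha>]
  define w where "w j = \<alpha> (z [^] j, z)" for j :: nat
  have w0: "w j \<noteq> 0" for j using n zc by (simp add: w_def)
  \<comment> \<open>For a \<open>p\<close>-th root \<open>s\<close> of this constant, the
    \<open>p\<close>-th power of s u_z is the unit of the twisted group algebra.\<close>
  define c where "c = inverse (\<Prod>j<p. w j)"
  have "c \<noteq> 0" using w0 by (simp add: c_def)
  then have "card {s. s ^ p = c} = p" using card_nth_roots p_pos by blast
  then have "{s. s ^ p = c} \<noteq> {}" using p_pos by (metis card.empty less_numeral_extra(3))
  then obtain s where s: "s ^ p = c" by blast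
  have s0: "s \<noteq> 0" using s \<open>c \<noteq> 0\<close> p_pos by (metis zero_power)
  \<comment> \<open>The coefficient of the basis element at \<open>z [^] i\<close> in the
    \<open>i\<close>-th power of s u_z. Division by \<open>\<alpha> (\<one>, \<one>)\<close>
    accounts for the unit, as the cocycle need not be normalized.\<close>
  define P where "P i = s ^ i * (\<Prod>j<i. w j) / \<alpha> (\<one>, \<one>)" for i
  have P0: "P i \<noteq> 0" for i using s0 w0 n by (simp add: P_def)
  have PS: "P (Suc i) = P i * s * w i" for i by (simp add: P_def)
  have Padd: "P (i + j) = \<alpha> (z [^] i, z [^] j) * P i * P j" for i j
  proof (induction j)
    case 0
    have "\<alpha> (z [^] i, \<one>) = \<alpha> (\<one>, \<one>)" "\<alpha> (\<one>, \<one>) \<noteq> 0"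
      using cocycle_one(1) [OF \<alpha>, of "z [^] i"] n zc by auto
    moreover have "P 0 = 1 / \<alpha> (\<one>, \<one>)" by (simp add: P_def)
    ultimately show ?case by simp
  next
    case (Suc j)
    have e: "\<alpha> (z [^] i, z [^] j) * w (i + j) = w j * \<alpha> (z [^] i, z [^] Suc j)"
      using cocycle_eq [OF \<alpha>, of "z [^] i" "z [^] j" z] zc by (simp add: w_def nat_pow_mult)
    have "P (i + Suc j) = (\<alpha> (z [^] i, z [^] j) * w (i + j)) * (P i * P j * s)"
      using Suc PS by (simp add: mult_ac)
    also have "\<dots> = \<alpha> (z [^] i, z [^] Suc j) * P i * P (Suc j)"
      unfolding e PS by (simp add: mult_ac)
    finally show ?case .
  qed
  have Pp: "P p = P 0" using s w0 by (simp add: P_def c_def)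
  have "P (i + p) = P i" for i
  proof -
    have "\<alpha> (z [^] i, \<one>) = \<alpha> (\<one>, \<one>)" "\<alpha> (\<one>, \<one>) \<noteq> 0"
      using cocycle_one(1) [OF \<alpha>, of "z [^] i"] n zc by auto
    moreover have "P 0 = 1 / \<alpha> (\<one>, \<one>)" by (simp add: P_def)
    ultimately show ?thesis unfolding Padd Pp z(3) by simp
  qed
  then obtain \<phi> where \<phi>: "\<And>i. \<phi> (z [^] (i::nat)) = P i" using periodic_fun by blast
  show thesis
  proof (rule that)
    fix k assume "k \<in> powers G z"
    then show "\<phi> k \<noteq> 0" using \<phi> P0 by (auto simp: powers_def)
  next
    fix k l assume "k \<in> powers G z" "l \<in> powers G z"
    then obtain i j where "k = z [^] (i::nat)" "l = z [^] (j::nat)" by (auto simp: powers_def)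
    then show "\<phi> (k \<otimes> l) = \<alpha> (k, l) * \<phi> k * \<phi> l" using \<phi> Padd zc by (simp add: nat_pow_mult)
  qed
qed

text \<open>The cocycle is changed by a coboundary until it is 1 whenever one argument lies in the
  kernel. Rescaling achieves this for the second argument, and the trivial pairing transfers it to
  the first.\<close>

lemma deflate_class:
  assumes \<alpha>: "\<alpha> \<in> cocycles2 G" and triv: "\<And>g. g \<in> carrier G \<Longrightarrow> eps \<alpha> g z = 1"
  obtains \<beta> where "\<beta> \<in> cocycles2 Q" "cohom_class G \<alpha> = cohom_class G (inflate G \<pi> \<beta>)"
proof -
  note n = cocycle_nonzero [OF \<alpha>]
  obtain \<phi> where \<phi>0: "\<And>k. k \<in> powers G z \<Longrightarrow> \<phi> k \<noteq> 0"
    and \<phi>: "\<And>k l. k \<in> powers G z \<Longrightarrow> l \<in> powers G z \<Longrightarrow> \<phi> (k \<otimes> l) = \<alpha> (k, l) * \<phi> k * \<phi> l"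
    using trivialize_on_kernel [OF \<alpha>] by blast
  obtain t \<kappa> where t: "\<And>g. g \<in> carrier G \<Longrightarrow> t g \<in> carrier G" "\<And>g. g \<in> carrier G \<Longrightarrow> \<kappa> g \<in> powers G z"
    "\<And>g. g \<in> carrier G \<Longrightarrow> g = t g \<otimes> \<kappa> g"
    "\<And>g k. g \<in> carrier G \<Longrightarrow> k \<in> powers G z \<Longrightarrow> t (g \<otimes> k) = t g"
    "\<And>g k. g \<in> carrier G \<Longrightarrow> k \<in> powers G z \<Longrightarrow> \<kappa> (g \<otimes> k) = \<kappa> g \<otimes> k"
    "\<And>k. k \<in> powers G z \<Longrightarrow> t k = \<one>"
    "\<And>k. k \<in> powers G z \<Longrightarrow> \<kappa> k = k"
    using section_ex by blast
  \<comment> \<open>With v_k = \<open>\<phi> k\<close> u_k on the kernel, u_g is rescaled to the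
    product of u at \<open>t g\<close> and v at \<open>\<kappa> g\<close>, divided by
    \<open>\<alpha> (\<one>, \<one>)\<close>. The division makes \<open>f\<close> agree with
    \<open>\<phi>\<close> on the kernel, whose representative is the identity.\<close>
  define f where "f = (\<lambda>g\<in>carrier G. \<alpha> (t g, \<kappa> g) * \<phi> (\<kappa> g) / \<alpha> (\<one>, \<one>))"
  have f0: "f g \<noteq> 0" if "g \<in> carrier G" for g
    using n \<phi>0 t(1,2) powers_carrier that by (simp add: f_def)
  have fK: "f k = \<phi> k" if "k \<in> powers G z" for k
    using cocycle_one(2) [OF \<alpha> powers_carrier [OF that]] n [of \<one> \<one>] powers_carrier [OF that] t(6,7) [OF that]
    by (simp add: f_def)
  have fm: "f (g \<otimes> k) = f g * \<alpha> (g, k) * \<phi> k" if g: "g \<in> carrier G" and k: "k \<in> powers G z" for g k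
  proof -
    note kc = powers_carrier [OF k]
    have "\<alpha> (t g, \<kappa> g) * \<alpha> (t g \<otimes> \<kappa> g, k) = \<alpha> (\<kappa> g, k) * \<alpha> (t g, \<kappa> g \<otimes> k)"
      by (rule cocycle_eq [OF \<alpha> t(1) [OF g] powers_carrier [OF t(2) [OF g]] kc])
    then have e: "\<alpha> (t g, \<kappa> g) * \<alpha> (g, k) = \<alpha> (\<kappa> g, k) * \<alpha> (t g, \<kappa> g \<otimes> k)"
      unfolding t(3) [OF g, symmetric] .
    have "f (g \<otimes> k) = \<alpha> (t g, \<kappa> g \<otimes> k) * (\<alpha> (\<kappa> g, k) * \<phi> (\<kappa> g) * \<phi> k) / \<alpha> (\<one>, \<one>)"
      using g kc t(4,5) [OF g k] \<phi> [OF t(2) [OF g] k] by (simp add: f_def)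
    also have "\<dots> = (\<alpha> (\<kappa> g, k) * \<alpha> (t g, \<kappa> g \<otimes> k)) * \<phi> (\<kappa> g) * \<phi> k / \<alpha> (\<one>, \<one>)" by simp
    also have "\<dots> = f g * \<alpha> (g, k) * \<phi> k" unfolding e [symmetric] using g by (simp add: f_def)
    finally show ?thesis .
  qed
  have fc: "f \<in> carrier (cochains1 G)"
    using f0 by (auto simp: cochains1_def PiE_iff f_def)
  define \<alpha>' where "\<alpha>' = coboundary G f \<otimes>\<^bsub>Z2 G\<^esub> \<alpha>"
  have \<alpha>': "\<alpha>' \<in> cocycles2 G" unfolding \<alpha>'_def by (rule cocycle_mult_coboundary [OF \<alpha> fc])
  have \<alpha>'e: "\<alpha>' (g, h) = f g * f h / f (g \<otimes> h) * \<alpha> (g, h)" if "g \<in> carrier G" "h \<in> carrier G" for g h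
    using that by (simp add: \<alpha>'_def Z2_simps coboundary_def)
  have "\<alpha>' (g, k) = 1 \<and> \<alpha>' (k, g) = 1" if g: "g \<in> carrier G" and k: "k \<in> powers G z" for g k
  proof -
    note kc = powers_carrier [OF k]
    obtain i where i: "k = z [^] (i::nat)" using k by (auto simp: powers_def)
    have "eps \<alpha> g k = 1"
      unfolding i using eps_pow_right [OF \<alpha> g zc center_comm [OF z(1) g]] triv [OF g] by simp
    then have "\<alpha> (k, g) = \<alpha> (g, k)" using n [OF kc g] by (simp add: eps_def)
    moreover have "k \<otimes> g = g \<otimes> k" using center_comm [OF powers_central [OF k] g] by simp
    moreover have "\<alpha>' (g, k) = 1"
      using \<alpha>'e [OF g kc] fm [OF g k] fK [OF k] f0 [OF g] n [OF g kc] \<phi>0 [OF k] by simp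
    ultimately show ?thesis using \<alpha>'e [OF g kc] \<alpha>'e [OF kc g] by (simp add: mult.commute)
  qed
  then obtain \<beta> where \<beta>: "\<beta> \<in> cocycles2 Q" "\<alpha>' = inflate G \<pi> \<beta>"
    using deflate [OF \<alpha>'] by blast
  have "cohom_class G \<alpha> = cohom_class G \<alpha>'"
    by (rule cohom_class_eqI [OF \<alpha> \<alpha>' fc]) (simp add: \<alpha>'_def Z2_simps)
  then show thesis using that \<beta> by blast
qed

lemma cohom_class_coboundary:
  assumes "f \<in> carrier (cochains1 G)" shows "cohom_class G (coboundary G f) = \<one>\<^bsub>H2 G\<^esub>"
proof -
  interpret Z: comm_group "Z2 G" by (rule comm_group_Z2 [OF is_group])
  have "coboundary G f \<in> coboundaries2 G" using assms by (auto simp: coboundaries2_def)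
  then show ?thesis
    unfolding cohom_class_def H2_def one_FactGroup
    using Z.coset_join2 [OF _ subgroup_coboundaries2 [OF is_group]] coboundary_in_cocycles2 [OF is_group assms]
    by (simp add: Z2_simps)
qed

text \<open>This is injectivity of the transgression. A root of unity \<open>y\<close> gives the
  character of the kernel with value \<open>y\<close> at \<open>z\<close>. Extended to
  \<open>G\<close> along the section, it has a coboundary that is trivial on the kernel and
  therefore inflated from \<open>Q\<close>; the resulting class of \<open>Q\<close> dies under
  inflation. Different \<open>y\<close> give different classes because \<open>z\<close> lies in the
  derived subgroup.\<close>

lemma inflation_kernel:
  assumes zd: "z \<in> derived G (carrier G)" and fin: "finite (carrier (H2 Q))"
    and \<iota>: "\<And>\<beta>. \<beta> \<in> cocycles2 Q \<Longrightarrow> \<iota> (cohom_class Q \<beta>) = cohom_class G (inflate G \<pi> \<beta>)"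
  shows "p \<le> card (kernel (H2 Q) (H2 G) \<iota>)"
proof -
  obtain t \<kappa> where \<kappa>: "\<And>g. g \<in> carrier G \<Longrightarrow> \<kappa> g \<in> powers G z"
    "\<And>g k. g \<in> carrier G \<Longrightarrow> k \<in> powers G z \<Longrightarrow> \<kappa> (g \<otimes> k) = \<kappa> g \<otimes> k"
    "\<And>k. k \<in> powers G z \<Longrightarrow> \<kappa> k = k"
    using section_ex by metis
  have zK: "z \<in> powers G z" "\<one> \<in> powers G z"
    unfolding powers_def using zc by (metis nat_pow_eone rangeI, metis nat_pow_0 rangeI)
  let ?R = "{y::complex. y ^ p = 1}"
  define T where "T y q \<longleftrightarrow> fst q \<in> carrier (cochains1 G) \<and> fst q z = y \<and> fst q \<one> = 1 \<and>
    snd q \<in> cocycles2 Q \<and> coboundary G (fst q) = inflate G \<pi> (snd q)" for y q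
  have ex: "\<exists>q. T y q" if y: "y \<in> ?R" for y
  proof -
    have "y ^ (i + p) = y ^ i" for i using y by (simp add: power_add)
    then obtain \<theta> where \<theta>: "\<And>i. \<theta> (z [^] (i::nat)) = y ^ i" using periodic_fun by blast
    have y0: "y \<noteq> 0" using y p_pos by (auto simp: zero_power)
    have \<theta>m: "\<theta> (k \<otimes> l) = \<theta> k * \<theta> l" if kl: "k \<in> powers G z" "l \<in> powers G z" for k l
    proof -
      obtain i j where "k = z [^] (i::nat)" "l = z [^] (j::nat)" using kl by (auto simp: powers_def)
      then show ?thesis using \<theta> zc by (simp add: nat_pow_mult power_add)
    qed
    have \<theta>0: "\<theta> k \<noteq> 0" if "k \<in> powers G z" for k
      using that \<theta> y0 by (auto simp: powers_def)
    define e where "e = (\<lambda>g\<in>carrier G. \<theta> (\<kappa> g))"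
    have ec: "e \<in> carrier (cochains1 G)" using \<theta>0 \<kappa>(1) by (auto simp: cochains1_def PiE_iff e_def)
    have eK: "e k = \<theta> k" if "k \<in> powers G z" for k using \<kappa>(3) powers_carrier that by (simp add: e_def)
    have em: "e (g \<otimes> k) = e g * e k" if "g \<in> carrier G" "k \<in> powers G z" for g k
      using that powers_carrier \<kappa> \<theta>m by (simp add: e_def)
    have ez: "e z = y" using eK [OF zK(1)] \<theta> [of 1] zc by simp
    have e1: "e \<one> = 1" using eK [OF zK(2)] \<theta> [of 0] by simp
    have cob: "coboundary G e (g, k) = 1 \<and> coboundary G e (k, g) = 1" if gk: "g \<in> carrier G" "k \<in> powers G z" for g k
    proof -
      have "k \<otimes> g = g \<otimes> k" using center_comm [OF powers_central [OF gk(2)] gk(1)] by simp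
      then show ?thesis
        using em [OF gk] powers_carrier [OF gk(2)] gk(1) cochain1_nonzero [OF ec] by (simp add: coboundary_def)
    qed
    obtain \<beta> where \<beta>: "\<beta> \<in> cocycles2 Q" "coboundary G e = inflate G \<pi> \<beta>"
      using deflate [OF coboundary_in_cocycles2 [OF is_group ec] cob] by blast
    then have "T y (e, \<beta>)" using ec ez e1 by (simp add: T_def)
    then show ?thesis by (rule exI)
  qed
  define E B where "E y = fst (SOME q. T y q)" and "B y = snd (SOME q. T y q)" for y
  have "T y (E y, B y)" if "y \<in> ?R" for y
    unfolding E_def B_def using someI_ex [OF ex [OF that]] by simp
  then have E: "\<And>y. y \<in> ?R \<Longrightarrow> E y \<in> carrier (cochains1 G)" "\<And>y. y \<in> ?R \<Longrightarrow> E y z = y"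
    "\<And>y. y \<in> ?R \<Longrightarrow> E y \<one> = 1"
    and B: "\<And>y. y \<in> ?R \<Longrightarrow> B y \<in> cocycles2 Q" "\<And>y. y \<in> ?R \<Longrightarrow> coboundary G (E y) = inflate G \<pi> (B y)"
    unfolding T_def by simp_all
  let ?F = "\<lambda>y. cohom_class Q (B y)"
  have "?F ` ?R \<subseteq> kernel (H2 Q) (H2 G) \<iota>"
  proof
    fix c assume "c \<in> ?F ` ?R"
    then obtain y where y: "y \<in> ?R" "c = ?F y" by blast
    have "\<iota> c = cohom_class G (coboundary G (E y))" using y \<iota> B by simp
    also have "\<dots> = \<one>\<^bsub>H2 G\<^esub>" by (rule cohom_class_coboundary [OF E(1) [OF y(1)]])
    finally show "c \<in> kernel (H2 Q) (H2 G) \<iota>"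
      unfolding kernel_def Q.carrier_H2 using y B by simp
  qed
  moreover have "inj_on ?F ?R"
  proof (rule inj_onI)
    fix y y' assume y: "y \<in> ?R" "y' \<in> ?R" and e: "?F y = ?F y'"
    obtain f where f: "f \<in> carrier (cochains1 Q)"
      and fe: "\<And>g h. g \<in> carrier Q \<Longrightarrow> h \<in> carrier Q \<Longrightarrow> B y' (g, h) = coboundary Q f (g, h) * B y (g, h)"
      using Q.cohom_class_eqD [OF B(1) B(1) e] y by blast
    \<comment> \<open>If the two classes coincide, this quotient of cochains is multiplicative on
      \<open>G\<close>, hence 1 at \<open>z\<close>. As \<open>z\<close> and the identity have the
      same image in \<open>Q\<close>, comparing the values there gives
      \<open>y = y'\<close>.\<close>
    define \<chi> where "\<chi> g = E y' g / (E y g * f (\<pi> g))" for g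
    have nz: "E y g \<noteq> 0" "E y' g \<noteq> 0" "f (\<pi> g) \<noteq> 0" if "g \<in> carrier G" for g
      using cochain1_nonzero [OF E(1)] y cochain1_nonzero [OF f] \<pi>_closed that by auto
    have \<chi>m: "\<chi> (g \<otimes> h) = \<chi> g * \<chi> h" if gh: "g \<in> carrier G" "h \<in> carrier G" for g h
    proof -
      have "coboundary G (E y') (g, h) = coboundary Q f (\<pi> g, \<pi> h) * coboundary G (E y) (g, h)"
        unfolding B(2) [OF y(1)] B(2) [OF y(2)] using fe gh \<pi>_closed by (simp add: inflate_def)
      then have "E y' g * E y' h / E y' (g \<otimes> h) =
          f (\<pi> g) * f (\<pi> h) / f (\<pi> (g \<otimes> h)) * (E y g * E y h / E y (g \<otimes> h))"
        using gh \<pi>_closed by (simp add: coboundary_def)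
      then show ?thesis
        unfolding \<chi>_def using nz gh nz [of "g \<otimes> h"] by (simp add: field_simps)
    qed
    have \<chi>0: "\<chi> g \<noteq> 0" if "g \<in> carrier G" for g using nz that by (simp add: \<chi>_def)
    have \<chi>: "\<chi> w = 1" if "w \<in> derived G (carrier G)" for w
      using finite_carrier \<chi>0 \<chi>m that by (rule multiplicative_trivial_on_derived)
    have "E y' \<one> / (E y \<one> * f (\<pi> \<one>)) = 1"
      using \<chi> [OF subgroup.one_closed [OF subgroup_derived]] unfolding \<chi>_def .
    then have "f (\<pi> \<one>) = 1" unfolding E(3) [OF y(1)] E(3) [OF y(2)] by (simp add: field_simps)
    moreover have "f (\<pi> z) = f (\<pi> \<one>)" unfolding \<pi>_kernel [OF zK(1)] \<pi>_kernel [OF zK(2)] ..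
    ultimately have "f (\<pi> z) = 1" by simp
    moreover have "E y' z / (E y z * f (\<pi> z)) = 1" using \<chi> [OF zd] unfolding \<chi>_def .
    ultimately show "y = y'" unfolding E(2) [OF y(1)] E(2) [OF y(2)] by (simp add: field_simps)
  qed
  moreover have "finite (kernel (H2 Q) (H2 G) \<iota>)" using fin by (simp add: kernel_def)
  ultimately have "card ?R \<le> card (kernel (H2 Q) (H2 G) \<iota>)" by (metis card_inj_on_le)
  then show ?thesis using card_nth_roots [of 1 p] p_pos by simp
qed

text \<open>Classes with the same pairing against \<open>z\<close> differ by a class with trivial
  pairing, hence by an inflated one. So the order of the multiplier is at most the number of
  pairings times the size of the image of inflation, and a nontrivial kernel of inflation saves a
  factor \<open>p\<close>.\<close>

theorem H2_bound:
  assumes fin: "finite (carrier (H2 Q))"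
  shows "finite (carrier (H2 G))"
    and "order (H2 G) * card (ann G z) \<le> order (H2 Q) * p ^ n"
    and "z \<in> derived G (carrier G) \<Longrightarrow> p * (order (H2 G) * card (ann G z)) \<le> order (H2 Q) * p ^ n"
proof -
  interpret HG: comm_group "H2 G" by (rule comm_group_H2 [OF is_group])
  interpret HQ: comm_group "H2 Q" by (rule comm_group_H2 [OF group_Q])
  obtain \<iota> where hom: "\<iota> \<in> hom (H2 Q) (H2 G)"
    and \<iota>: "\<And>\<beta>. \<beta> \<in> cocycles2 Q \<Longrightarrow> \<iota> (cohom_class Q \<beta>) = cohom_class G (inflate G \<pi> \<beta>)"
    using inflation by blast
  interpret \<iota>: group_hom "H2 Q" "H2 G" \<iota> by unfold_locales (rule hom)
  let ?r = "\<lambda>\<alpha>. \<lambda>g\<in>carrier G. eps \<alpha> g z"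
  let ?P = "?r ` cocycles2 G"
  let ?I = "\<iota> ` carrier (H2 Q)"
  note P = card_pairings [OF z(1)]
  define a where "a x = (SOME \<alpha>. \<alpha> \<in> cocycles2 G \<and> ?r \<alpha> = x)" for x
  have a: "a x \<in> cocycles2 G" "?r (a x) = x" if "x \<in> ?P" for x
  proof -
    have "\<exists>\<alpha>. \<alpha> \<in> cocycles2 G \<and> ?r \<alpha> = x" using that by blast
    from someI_ex [OF this] show "a x \<in> cocycles2 G" "?r (a x) = x" unfolding a_def by blast+
  qed
  have "carrier (H2 G) \<subseteq> (\<lambda>(x, b). cohom_class G (a x) \<otimes>\<^bsub>H2 G\<^esub> b) ` (?P \<times> ?I)"
  proof
    fix c assume "c \<in> carrier (H2 G)"
    then obtain \<alpha> where \<alpha>: "\<alpha> \<in> cocycles2 G" and c: "c = cohom_class G \<alpha>" unfolding carrier_H2 by blast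
    define x where "x = ?r \<alpha>"
    have x: "x \<in> ?P" using \<alpha> by (simp add: x_def)
    define \<gamma> where "\<gamma> = (\<lambda>q\<in>carrier G \<times> carrier G. \<alpha> q / a x q)"
    note na = cocycle_nonzero [OF a(1) [OF x]] cocycle_nonzero [OF \<alpha>]
    have \<gamma>: "\<gamma> \<in> cocycles2 G"
    proof (rule cocycles2I)
      fix g h k assume g: "g \<in> carrier G" "h \<in> carrier G" "k \<in> carrier G"
      then show "\<gamma> (g, h) * \<gamma> (g \<otimes> h, k) = \<gamma> (h, k) * \<gamma> (g, h \<otimes> k)"
        using cocycle_eq [OF \<alpha> g] cocycle_eq [OF a(1) [OF x] g] by (simp add: \<gamma>_def)
    qed (use na in \<open>auto simp: \<gamma>_def\<close>)
    have "eps \<gamma> g z = 1" if g: "g \<in> carrier G" for g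
    proof -
      have "eps (a x) g z = eps \<alpha> g z" using a(2) [OF x] g unfolding x_def by (metis restrict_apply')
      then show ?thesis using na g zc by (simp add: eps_def \<gamma>_def field_simps)
    qed
    then obtain \<beta> where \<beta>: "\<beta> \<in> cocycles2 Q" "cohom_class G \<gamma> = cohom_class G (inflate G \<pi> \<beta>)"
      using deflate_class [OF \<gamma>] by blast
    have "\<alpha> = a x \<otimes>\<^bsub>Z2 G\<^esub> \<gamma>"
      unfolding Z2_simps
      by (rule extensionalityI [OF cocycle_extensional [OF \<alpha>]]) (use na in \<open>auto simp: \<gamma>_def\<close>)
    then have "c = cohom_class G (a x) \<otimes>\<^bsub>H2 G\<^esub> cohom_class G \<gamma>"
      using hom_mult [OF cohom_class_hom, of "a x" \<gamma>] a(1) [OF x] \<gamma> c by (simp add: Z2_simps(1))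
    moreover have "cohom_class G \<gamma> \<in> ?I" using \<beta> \<iota> Q.carrier_H2 by auto
    ultimately show "c \<in> (\<lambda>(x, b). cohom_class G (a x) \<otimes>\<^bsub>H2 G\<^esub> b) ` (?P \<times> ?I)" using x by auto
  qed
  moreover have fI: "finite (?P \<times> ?I)" using P fin by simp
  ultimately show "finite (carrier (H2 G))" by (metis finite_surj)
  have "order (H2 G) \<le> card (?P \<times> ?I)"
    unfolding order_def using surj_card_le [OF fI] \<open>carrier (H2 G) \<subseteq> _\<close> by blast
  then have "order (H2 G) * card (ann G z) \<le> card ?I * (card ?P * card (ann G z))"
    by (simp add: card_cartesian_product mult_ac)
  then have b: "order (H2 G) * card (ann G z) \<le> card ?I * p ^ n"
    using P(2) by (meson le_trans mult_le_mono2)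
  have "card ?I \<le> order (H2 Q)" unfolding order_def using fin card_image_le by blast
  then show "order (H2 G) * card (ann G z) \<le> order (H2 Q) * p ^ n"
    using b by (meson le_trans mult_le_mono1)
  assume zd: "z \<in> derived G (carrier G)"
  have "p * card ?I \<le> order (H2 Q)"
    unfolding \<iota>.order_kernel_image using inflation_kernel [OF zd fin \<iota>] by simp
  then have "p * card ?I * p ^ n \<le> order (H2 Q) * p ^ n" by (rule mult_le_mono1)
  with mult_le_mono2 [OF b, of p]
  show "p * (order (H2 G) * card (ann G z)) \<le> order (H2 Q) * p ^ n"
    unfolding mult.assoc by (rule le_trans)
qed

end


section \<open>Bounds for the Schur multiplier of abelian groups\<close>

text \<open>The quotient is realized on coset representatives, so that it has the same type as \<open>G\<close> and
  can be used in inductions.\<close>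

lemma (in p_group) central_quotient_ex:
  assumes z: "z \<in> center G" "z \<noteq> \<one>" "z [^] p = \<one>"
  obtains Q :: "('a, 'b) monoid_scheme" and \<pi> where "central_quotient G p n z Q \<pi>"
proof -
  define K where "K = powers G z"
  note zc = center_closed [OF z(1)]
  have sK: "subgroup K G" unfolding K_def by (rule subgroup_powers [OF finite_carrier zc])
  have "K \<subseteq> center G" unfolding K_def by (rule powers_in_subgroup [OF subgroup_center z(1)])
  then have nK: "K \<lhd> G" by (rule normal_of_central [OF sK])
  interpret K: normal K G by (rule nK)
  define \<pi> where "\<pi> g = (SOME h. h \<in> K #> g)" for g
  have \<pi>m: "\<pi> g \<in> K #> g" if "g \<in> carrier G" for g
    unfolding \<pi>_def by (rule someI [of _ g]) (rule rcos_self [OF that sK])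
  have \<pi>c: "\<pi> g \<in> carrier G" if "g \<in> carrier G" for g
    using \<pi>m [OF that] r_coset_subset_G [OF K.subset that] by blast
  have \<pi>r: "K #> \<pi> g = K #> g" if "g \<in> carrier G" for g
    using repr_independence [OF \<pi>m [OF that] that sK] by simp
  have \<pi>cong: "\<pi> g = \<pi> h" if "K #> g = K #> h" for g h
    unfolding \<pi>_def that ..
  \<comment> \<open>Products are replaced by representatives of their cosets, which makes
    \<open>\<pi>\<close> multiplicative. The group axioms for its image \<open>Q\<close> then follow
    from those of \<open>G\<close>.\<close>
  define Q0 where "Q0 = G\<lparr>monoid.mult := \<lambda>x y. \<pi> (x \<otimes> y)\<rparr>"
  have h0: "\<pi> \<in> hom G Q0"
  proof (rule homI)
    fix x assume "x \<in> carrier G"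
    then show "\<pi> x \<in> carrier Q0" using \<pi>c by (simp add: Q0_def)
  next
    fix x y assume xy: "x \<in> carrier G" "y \<in> carrier G"
    have "K #> (\<pi> x \<otimes> \<pi> y) = (K #> \<pi> x) <#> (K #> \<pi> y)" using K.rcos_sum \<pi>c xy by simp
    also have "\<dots> = K #> (x \<otimes> y)" using \<pi>r K.rcos_sum xy by simp
    finally have "\<pi> (\<pi> x \<otimes> \<pi> y) = \<pi> (x \<otimes> y)" by (rule \<pi>cong)
    then show "\<pi> (x \<otimes> y) = \<pi> x \<otimes>\<^bsub>Q0\<^esub> \<pi> y" by (simp add: Q0_def)
  qed
  define Q where "Q = Q0\<lparr>carrier := \<pi> ` carrier G, one := \<pi> \<one>\<rparr>"
  have gQ: "group Q" unfolding Q_def by (rule hom_imp_img_group [OF h0])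
  have hQ: "\<pi> \<in> hom G Q"
    using h0 by (auto simp: hom_def Q_def)
  have "kernel G Q \<pi> = K"
  proof (intro subset_antisym subsetI)
    fix x assume "x \<in> kernel G Q \<pi>"
    then have x: "x \<in> carrier G" "\<pi> x = \<pi> \<one>" by (auto simp: kernel_def Q_def)
    then have "K #> x = K #> \<one>" using \<pi>r by (metis one_closed)
    then have "K #> x = K" using K.subset by simp
    then show "x \<in> K" using coset_join1 [OF _ x(1) sK] by simp
  next
    fix x assume x: "x \<in> K"
    then have xc: "x \<in> carrier G" using K.subset by blast
    have "K #> x = K #> \<one>" using coset_join2 [OF xc sK x] K.subset by simp
    then have "\<pi> x = \<pi> \<one>" by (rule \<pi>cong)
    then show "x \<in> kernel G Q \<pi>" using xc by (simp add: kernel_def Q_def)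
  qed
  moreover have "carrier Q = \<pi> ` carrier G" by (simp add: Q_def)
  ultimately have "central_quotient G p n z Q \<pi>"
    by (intro central_quotient.intro p_group_axioms central_quotient_axioms.intro z gQ hQ)
       (simp_all add: K_def)
  then show thesis by (rule that)
qed

section \<open>Orders, commutators and derived subgroup of the central quotient\<close>

context central_quotient
begin

lemma order_Q: "n > 0" "order Q = p ^ (n - 1)"
proof -
  have "p ^ n = p * order Q"
    using \<pi>.order_kernel_image unfolding order_G kernel_\<pi> surj_\<pi> card_powers_prime [OF zc z(3,2)]
    by (simp add: order_def)
  moreover from this have "n \<noteq> 0" using prime_gt_1_nat [OF prime_p] by (intro notI) simp
  moreover from this have "p ^ n = p * p ^ (n - 1)" by (metis power_eq_if)
  ultimately show "n > 0" "order Q = p ^ (n - 1)" using p_pos by auto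
qed

lemma p_group_Q: "p_group Q p (n - 1)"
  by (intro p_group.intro group_Q p_group_axioms.intro prime_p order_Q)

lemma \<pi>_one_iff: "g \<in> carrier G \<Longrightarrow> \<pi> g = \<one>\<^bsub>Q\<^esub> \<longleftrightarrow> g \<in> powers G z"
  using kernel_\<pi> unfolding kernel_def by blast

lemma \<pi>_pow: "g \<in> carrier G \<Longrightarrow> \<pi> (g [^] (i::nat)) = \<pi> g [^]\<^bsub>Q\<^esub> i"
  by (rule \<pi>.hom_nat_pow)

lemma \<pi>_commutator:
  assumes "g \<in> carrier G" "h \<in> carrier G"
  shows "\<pi> (commutator G g h) = commutator Q (\<pi> g) (\<pi> h)"
  using assms by (simp add: commutator_def)

lemma carrier_Q_E:
  assumes "q \<in> carrier Q" obtains g where "g \<in> carrier G" "q = \<pi> g"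
  using assms surj_\<pi> by blast

lemma comm_Q_iff: "comm_group Q \<longleftrightarrow> derived G (carrier G) \<subseteq> powers G z"
proof
  assume "comm_group Q"
  then interpret CQ: comm_group Q .
  show "derived G (carrier G) \<subseteq> powers G z"
  proof (rule derived_subsetI [OF subgroup_K])
    fix g h assume gh: "g \<in> carrier G" "h \<in> carrier G"
    have "\<pi> (commutator G g h) = \<one>\<^bsub>Q\<^esub>"
      unfolding \<pi>_commutator [OF gh] using Q.commutator_eq_one_iff CQ.m_comm \<pi>_closed gh by metis
    then show "commutator G g h \<in> powers G z" using \<pi>_one_iff gh by simp
  qed
next
  assume d: "derived G (carrier G) \<subseteq> powers G z"
  show "comm_group Q"
  proof (rule Q.group_comm_groupI)
    fix x y assume "x \<in> carrier Q" "y \<in> carrier Q"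
    then obtain g h where gh: "g \<in> carrier G" "h \<in> carrier G" "x = \<pi> g" "y = \<pi> h"
      by (metis carrier_Q_E)
    have "commutator G g h \<in> powers G z"
      by (rule subsetD [OF d commutator_in_derived [OF gh(1,2)]])
    then have "\<pi> (commutator G g h) = \<one>\<^bsub>Q\<^esub>" by (rule \<pi>_kernel)
    then have "commutator Q x y = \<one>\<^bsub>Q\<^esub>" unfolding \<pi>_commutator [OF gh(1,2)] gh(3,4) .
    then show "x \<otimes>\<^bsub>Q\<^esub> y = y \<otimes>\<^bsub>Q\<^esub> x"
      using Q.commutator_eq_one_iff [OF \<pi>_closed [OF gh(1)] \<pi>_closed [OF gh(2)]] gh(3,4) by simp
  qed
qed

lemma card_derived_Q:
  assumes "z \<in> derived G (carrier G)"
  shows "card (derived G (carrier G)) = p * card (derived Q (carrier Q))"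
proof -
  let ?D = "derived G (carrier G)"
  interpret D: group "G\<lparr>carrier := ?D\<rparr>" by (rule subgroup_imp_group [OF subgroup_derived])
  interpret r: group_hom "G\<lparr>carrier := ?D\<rparr>" Q \<pi>
    by unfold_locales (use hom_\<pi> subgroup.subset [OF subgroup_derived] in \<open>auto simp: hom_def Pi_iff subset_iff\<close>)
  have "powers G z \<subseteq> ?D" by (rule powers_in_subgroup [OF subgroup_derived assms])
  then have "kernel (G\<lparr>carrier := ?D\<rparr>) Q \<pi> = powers G z"
    using kernel_\<pi> subgroup.subset [OF subgroup_derived] unfolding kernel_def by auto
  then show ?thesis
    using r.order_kernel_image \<pi>.derived_img [of "carrier G"] card_powers_prime [OF zc z(3,2)]
    by (simp add: order_def surj_\<pi>)
qed

end

lemma Suc_choose_two: "Suc m choose 2 = m + (m choose 2)"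
  by (simp add: numeral_2_eq_2)

lemma H2_trivial_group:
  assumes "group G" "order G = 1"
  shows "finite (carrier (H2 G))" "order (H2 G) \<le> 1"
proof -
  interpret group G by fact
  have G: "carrier G = {\<one>\<^bsub>G\<^esub>}"
    using assms(2) unfolding order_def by (metis card_1_singletonE one_closed singletonD)
  have "carrier (H2 G) \<subseteq> {cohom_class G (\<lambda>q\<in>carrier G \<times> carrier G. 1)}" (is "_ \<subseteq> {cohom_class G ?u}")
  proof
    fix c assume "c \<in> carrier (H2 G)"
    then obtain \<alpha> where \<alpha>: "\<alpha> \<in> cocycles2 G" "c = cohom_class G \<alpha>" unfolding carrier_H2 by blast
    have u: "?u \<in> cocycles2 G" by (rule cocycles2I) auto
    have "cohom_class G ?u = cohom_class G \<alpha>"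
      by (rule cohom_class_eqI [OF u \<alpha>(1), of "\<lambda>g\<in>carrier G. \<alpha> (\<one>\<^bsub>G\<^esub>, \<one>\<^bsub>G\<^esub>)"])
         (use cocycle_nonzero [OF \<alpha>(1)] in \<open>auto simp: G coboundary_def cochains1_def\<close>)
    then show "c \<in> {cohom_class G ?u}" using \<alpha> by simp
  qed
  then show "finite (carrier (H2 G))" "order (H2 G) \<le> 1"
    unfolding order_def by (auto dest: finite_subset card_mono [rotated])
qed

lemma (in p_group) powers_mono_pow: "x \<in> carrier G \<Longrightarrow> powers G (x [^] (k::nat)) \<subseteq> powers G x"
  by (auto simp: powers_def nat_pow_pow)

text \<open>Both bounds are proved in one induction. For the first, \<open>z\<close> annihilates
  itself, so \<open>ann G z\<close> has order at least \<open>p\<close>, and passing from order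
  \<open>p^k\<close> to \<open>p^(k+1)\<close> adds \<open>k\<close> to the exponent. For the
  second, \<open>z\<close> is taken to be a \<open>p\<close>-th power, which enlarges the
  annihilator.\<close>

lemma H2_abelian:
  assumes "p_group G p m" and "comm_group G"
  shows "finite (carrier (H2 G))" "order (H2 G) \<le> p ^ (m choose 2)"
    and "\<And>a. a \<in> carrier G \<Longrightarrow> a [^]\<^bsub>G\<^esub> p \<noteq> \<one>\<^bsub>G\<^esub> \<Longrightarrow> order (H2 G) \<le> p ^ ((m - 1) choose 2)"
proof -
  have "finite (carrier (H2 G)) \<and> order (H2 G) \<le> p ^ (m choose 2) \<and>
    ((\<exists>a\<in>carrier G. a [^]\<^bsub>G\<^esub> p \<noteq> \<one>\<^bsub>G\<^esub>) \<longrightarrow> order (H2 G) \<le> p ^ ((m - 1) choose 2))"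
    if "p_group G p m" "comm_group G" for m and G :: "('a, 'b) monoid_scheme"
    using that
  proof (induction m arbitrary: G)
    case 0
    interpret p_group G p 0 by fact
    have "order G = 1" using order_G by simp
    note t = H2_trivial_group [OF is_group this]
    have "a [^]\<^bsub>G\<^esub> p = \<one>\<^bsub>G\<^esub>" if "a \<in> carrier G" for a
      using pow_order_one [OF that] that by (simp add: nat_pow_one)
    then show ?case using t by (simp add: numeral_2_eq_2)
  next
    case (Suc k)
    interpret p_group G p "Suc k" by fact
    interpret CG: comm_group G by fact
    have cen: "x \<in> center G" if "x \<in> carrier G" for x
      by (rule centerI [OF that]) (use CG.m_comm that in blast)
    \<comment> \<open>The inductive step for a given \<open>z\<close>, with \<open>c\<close> any
      known lower bound for the order of \<open>ann G z\<close>.\<close>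
    have step: "finite (carrier (H2 G)) \<and> order (H2 G) * c \<le> order (H2 Q) * p ^ Suc k \<and>
        (finite (carrier (H2 Q)) \<and> order (H2 Q) \<le> p ^ (k choose 2) \<and>
        ((\<exists>a\<in>carrier Q. a [^]\<^bsub>Q\<^esub> p \<noteq> \<one>\<^bsub>Q\<^esub>) \<longrightarrow> order (H2 Q) \<le> p ^ ((k - 1) choose 2)))"
      if cq: "central_quotient G p (Suc k) z Q \<pi>" and c: "c \<le> card (ann G z)"
      for z and Q :: "('a, 'b) monoid_scheme" and \<pi> c
    proof -
      interpret cq: central_quotient G p "Suc k" z Q \<pi> by fact
      have "derived G (carrier G) = {\<one>\<^bsub>G\<^esub>}" by (rule CG.derived_eq_singleton) simp
      then have "derived G (carrier G) \<subseteq> powers G z"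
        using subgroup.one_closed [OF cq.subgroup_K] by simp
      then have "comm_group Q" using cq.comm_Q_iff by simp
      note IH = Suc.IH [OF cq.p_group_Q [simplified] this]
      then have fin: "finite (carrier (H2 Q))" by simp
      show ?thesis
        using IH cq.H2_bound(1,2) [OF fin] mult_le_mono2 [OF c, of "order (H2 G)"]
        by (meson le_trans)
    qed
    have main: "finite (carrier (H2 G)) \<and> order (H2 G) \<le> p ^ (Suc k choose 2)"
    proof -
      have "carrier G \<noteq> {\<one>\<^bsub>G\<^esub>}"
        using order_G prime_gt_1_nat [OF prime_p] unfolding order_def by (intro notI) auto
      then obtain z where z: "z \<in> center G" "z \<noteq> \<one>\<^bsub>G\<^esub>" "z [^]\<^bsub>G\<^esub> p = \<one>\<^bsub>G\<^esub>"
        using normal_meets_center [OF normal_of_derived [OF subgroup_self]] derived_in_carrier by (metis order_refl)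
      obtain Q :: "('a, 'b) monoid_scheme" and \<pi> where cq: "central_quotient G p (Suc k) z Q \<pi>"
        using central_quotient_ex [OF z] by blast
      note zc = center_closed [OF z(1)]
      have "z \<in> ann G z" using zc by (simp add: ann_iff)
      then have "powers G z \<subseteq> ann G z"
        by (rule powers_in_subgroup [OF subgroup_ann [OF finite_carrier z(1)]])
      moreover have "finite (ann G z)" using finite_subset_carrier by (simp add: ann_def)
      ultimately have "p \<le> card (ann G z)" using card_powers_prime [OF zc z(3,2)] card_mono by metis
      note s = step [OF cq this]
      then have "order (H2 G) * p \<le> p ^ (k choose 2) * p ^ Suc k"
        by (meson le_trans mult_le_mono1)
      then have "order (H2 G) * p \<le> p ^ (Suc k choose 2) * p"
        by (simp add: Suc_choose_two power_add mult_ac)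
      then show ?thesis using s p_pos by simp
    qed
    have "order (H2 G) \<le> p ^ (k choose 2)" if b: "b \<in> carrier G" "b [^]\<^bsub>G\<^esub> p \<noteq> \<one>\<^bsub>G\<^esub>" for b
    proof -
      have "b [^]\<^bsub>G\<^esub> p \<in> carrier G" "b [^]\<^bsub>G\<^esub> p \<notin> {\<one>\<^bsub>G\<^esub>}" using b by auto
      then obtain j where j: "(b [^]\<^bsub>G\<^esub> p) [^]\<^bsub>G\<^esub> (p ^ j) \<notin> {\<one>\<^bsub>G\<^esub>}"
          "((b [^]\<^bsub>G\<^esub> p) [^]\<^bsub>G\<^esub> (p ^ j)) [^]\<^bsub>G\<^esub> p \<in> {\<one>\<^bsub>G\<^esub>}"
        using exists_pow_prime [OF triv_subgroup] by metis
      \<comment> \<open>The exponent \<open>j\<close> was chosen so that the \<open>p\<close>-th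
        power \<open>z\<close> of \<open>a\<close> has order exactly \<open>p\<close>.\<close>
      define a where "a = b [^]\<^bsub>G\<^esub> (p ^ j)"
      define z where "z = a [^]\<^bsub>G\<^esub> p"
      have ac: "a \<in> carrier G" using b by (simp add: a_def)
      have zb: "z = (b [^]\<^bsub>G\<^esub> p) [^]\<^bsub>G\<^esub> (p ^ j)"
        using b by (simp add: z_def a_def nat_pow_pow mult.commute)
      have z1: "z \<noteq> \<one>\<^bsub>G\<^esub>" "z [^]\<^bsub>G\<^esub> p = \<one>\<^bsub>G\<^esub>" using j unfolding zb by auto
      have zc: "z \<in> carrier G" using ac by (simp add: z_def)
      note zcen = cen [OF zc]
      obtain Q :: "('a, 'b) monoid_scheme" and \<pi> where cq: "central_quotient G p (Suc k) z Q \<pi>"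
        using central_quotient_ex [OF zcen z1] by blast
      interpret cq: central_quotient G p "Suc k" z Q \<pi> by (rule cq)
      have com: "g \<otimes>\<^bsub>G\<^esub> h = h \<otimes>\<^bsub>G\<^esub> g" if "g \<in> carrier G" "h \<in> carrier G" for g h
        using CG.m_comm that by blast
      have eaz: "eps \<alpha> a z = 1" if "\<alpha> \<in> cocycles2 G" for \<alpha>
        unfolding z_def using eps_pow_right [OF that ac ac refl] that ac by simp
      show ?thesis
      proof (cases "\<exists>q\<in>carrier Q. q [^]\<^bsub>Q\<^esub> p \<noteq> \<one>\<^bsub>Q\<^esub>")
        case True
        \<comment> \<open>Here the annihilator contains the powers of \<open>a\<close>, at least
          \<open>p * p\<close> elements, and the quotient again has exponent different from
          \<open>p\<close>, so the sharper inductive bound applies to it.\<close>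
        have "a \<in> ann G z" using ac eaz by (simp add: ann_iff)
        then have sub: "powers G a \<subseteq> ann G z"
          by (rule powers_in_subgroup [OF subgroup_ann [OF finite_carrier zcen]])
        have "a \<notin> powers G z"
        proof
          assume "a \<in> powers G z"
          then obtain i where i: "a = z [^]\<^bsub>G\<^esub> (i::nat)" by (auto simp: powers_def)
          have "(z [^]\<^bsub>G\<^esub> i) [^]\<^bsub>G\<^esub> p = z" by (simp only: i [symmetric] z_def [symmetric])
          moreover have "(z [^]\<^bsub>G\<^esub> i) [^]\<^bsub>G\<^esub> p = (z [^]\<^bsub>G\<^esub> p) [^]\<^bsub>G\<^esub> i"
            using zc by (simp add: nat_pow_pow mult.commute)
          ultimately show False using z1 by simp
        qed
        moreover have "a [^]\<^bsub>G\<^esub> p \<in> powers G z"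
          unfolding z_def [symmetric] powers_def by (rule image_eqI [of _ _ 1]) (use zc in auto)
        ultimately have "card (adjoin G (powers G z) a) = p * p"
          using card_adjoin [OF finite_carrier cq.subgroup_K ac _ _ prime_p] card_powers_prime [OF zc z1(2,1)] by simp
        moreover have "adjoin G (powers G z) a \<subseteq> ann G z"
        proof
          fix w assume "w \<in> adjoin G (powers G z) a"
          then obtain s i where w: "s \<in> powers G z" "w = s \<otimes>\<^bsub>G\<^esub> a [^]\<^bsub>G\<^esub> (i::nat)" by (auto simp: adjoin_def)
          have "s \<in> powers G a" using w(1) powers_mono_pow [OF ac] unfolding z_def by blast
          moreover have "a [^]\<^bsub>G\<^esub> i \<in> powers G a" by (simp add: powers_def)
          ultimately show "w \<in> ann G z"
            using w(2) sub subgroup.m_closed [OF subgroup_ann [OF finite_carrier zcen]] by blast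
        qed
        moreover have "finite (ann G z)" using finite_subset_carrier by (simp add: ann_def)
        ultimately have "p * p \<le> card (ann G z)" using card_mono by metis
        note s = step [OF cq this]
        have "k \<noteq> 0"
        proof
          assume "k = 0"
          have "p * p \<le> card (carrier G)"
            using \<open>p * p \<le> card (ann G z)\<close> card_mono [OF finite_carrier, of "ann G z"] by (auto simp: ann_def)
          then show False using order_G \<open>k = 0\<close> prime_gt_1_nat [OF prime_p] by (simp add: order_def)
        qed
        then obtain l where l: "k = Suc l" using not0_implies_Suc by blast
        have "order (H2 Q) \<le> p ^ (l choose 2)" using s True l by auto
        then have "order (H2 Q) * p ^ Suc k \<le> p ^ (l choose 2) * p ^ Suc k" by (rule mult_le_mono1)
        with s have "order (H2 G) * (p * p) \<le> p ^ (l choose 2) * p ^ Suc k" by linarith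
        then have "order (H2 G) * (p * p) \<le> p ^ (k choose 2) * (p * p)"
          by (simp add: l Suc_choose_two power_add mult_ac)
        then show ?thesis using p_pos by simp
      next
        case False
        \<comment> \<open>Now each \<open>g [^] p\<close> is a power of \<open>z\<close>.
          Multiplicativity moves the exponent across: pairing \<open>g\<close> with
          \<open>z = a [^] p\<close> is the same as pairing \<open>g [^] p\<close> with
          \<open>a\<close>, which is a power of the trivial pairing of \<open>z\<close> with
          \<open>a\<close>.\<close>
        have "carrier G \<subseteq> ann G z"
        proof
          fix g assume g: "g \<in> carrier G"
          have "\<pi> (g [^]\<^bsub>G\<^esub> p) = \<one>\<^bsub>Q\<^esub>" using False cq.\<pi>_closed [OF g] cq.\<pi>_pow [OF g] by simp
          then have "g [^]\<^bsub>G\<^esub> p \<in> powers G z" using cq.\<pi>_one_iff g by simp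
          then obtain i where i: "g [^]\<^bsub>G\<^esub> p = z [^]\<^bsub>G\<^esub> (i::nat)" by (auto simp: powers_def)
          have "eps \<alpha> g z = 1" if \<alpha>: "\<alpha> \<in> cocycles2 G" for \<alpha>
          proof -
            have "eps \<alpha> g z = eps \<alpha> g a ^ p"
              unfolding z_def by (rule eps_pow_right [OF \<alpha> g ac com [OF g ac]])
            also have "\<dots> = eps \<alpha> (z [^]\<^bsub>G\<^esub> i) a"
              unfolding i [symmetric] by (rule eps_pow_left [OF \<alpha> ac g com [OF ac g], symmetric])
            also have "\<dots> = eps \<alpha> z a ^ i" by (rule eps_pow_left [OF \<alpha> ac zc com [OF ac zc]])
            also have "eps \<alpha> z a = 1" using eaz [OF \<alpha>] eps_swap [of \<alpha> z a] by simp
            finally show ?thesis by simp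
          qed
          then show "g \<in> ann G z" using g by (simp add: ann_iff)
        qed
        then have "ann G z = carrier G" by (auto simp: ann_def)
        then have "p ^ Suc k \<le> card (ann G z)" using order_G by (simp add: order_def)
        from step [OF cq this] have "order (H2 G) * p ^ Suc k \<le> p ^ (k choose 2) * p ^ Suc k"
          by (meson le_trans mult_le_mono1)
        then show ?thesis using p_pos by simp
      qed
    qed
    then show ?case using main by auto
  qed
  then show "finite (carrier (H2 G))" "order (H2 G) \<le> p ^ (m choose 2)"
    and "\<And>a. a \<in> carrier G \<Longrightarrow> a [^]\<^bsub>G\<^esub> p \<noteq> \<one>\<^bsub>G\<^esub> \<Longrightarrow> order (H2 G) \<le> p ^ ((m - 1) choose 2)"
    using assms by blast+
qed


section \<open>Groups with derived subgroup of order \<open>p\<close>\<close>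

context group
begin

lemma central_left_commute:
  assumes "w \<in> center G" "x \<in> carrier G" "y \<in> carrier G"
  shows "x \<otimes> (w \<otimes> y) = w \<otimes> (x \<otimes> y)"
  using center_comm [OF assms(1,2)] center_closed [OF assms(1)] assms(2,3) by (metis m_assoc)

lemma central_pow: "w \<in> center G \<Longrightarrow> w [^] (i::nat) \<in> center G"
  by (rule subgroup_nat_pow_closed [OF subgroup_center])

lemma pow_commute_central:
  assumes x: "x \<in> carrier G" and y: "y \<in> carrier G" and w: "w \<in> center G" and e: "x \<otimes> y = w \<otimes> (y \<otimes> x)"
  shows "x [^] (i::nat) \<otimes> y = w [^] i \<otimes> (y \<otimes> x [^] i)"
proof (induction i)
  case (Suc i)
  note wc = center_closed [OF w]
  have "x [^] Suc i \<otimes> y = x [^] i \<otimes> (w \<otimes> (y \<otimes> x))" using x y by (simp add: m_assoc e)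
  also have "\<dots> = w \<otimes> (x [^] i \<otimes> y \<otimes> x)"
    using central_left_commute [OF w, of "x [^] i" "y \<otimes> x"] x y by (simp add: m_assoc)
  also have "\<dots> = w \<otimes> (w [^] i \<otimes> (y \<otimes> x [^] i) \<otimes> x)" by (simp only: Suc)
  also have "\<dots> = (w \<otimes> w [^] i) \<otimes> (y \<otimes> x [^] Suc i)" using x y wc by (simp add: m_assoc)
  also have "w \<otimes> w [^] i = w [^] Suc i" using wc by (metis nat_pow_Suc2)
  finally show ?case .
qed (use x y in simp)

lemma commute_pow_central:
  assumes x: "x \<in> carrier G" and y: "y \<in> carrier G" and w: "w \<in> center G" and e: "x \<otimes> y = w \<otimes> (y \<otimes> x)"
  shows "x \<otimes> y [^] (i::nat) = w [^] i \<otimes> (y [^] i \<otimes> x)"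
proof (induction i)
  case (Suc i)
  note wc = center_closed [OF w]
  have "x \<otimes> y [^] Suc i = (x \<otimes> y [^] i) \<otimes> y" using x y by (simp add: m_assoc)
  also have "\<dots> = w [^] i \<otimes> (y [^] i \<otimes> (x \<otimes> y))" unfolding Suc using x y wc by (simp add: m_assoc)
  also have "\<dots> = w [^] i \<otimes> (w \<otimes> (y [^] i \<otimes> (y \<otimes> x)))"
    unfolding e using central_left_commute [OF w, of "y [^] i" "y \<otimes> x"] x y by simp
  also have "\<dots> = w [^] Suc i \<otimes> (y [^] Suc i \<otimes> x)" using x y wc by (simp add: m_assoc)
  finally show ?case .
qed (use x y in simp)

text \<open>Moving the next \<open>x\<close> to the left past \<open>y [^] i\<close> costs
  \<open>w [^] i\<close>, and 0 + 1 + ... + (i - 1) is the binomial coefficient.\<close>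

lemma mult_pow_central:
  assumes x: "x \<in> carrier G" and y: "y \<in> carrier G" and w: "w \<in> center G" and e: "y \<otimes> x = w \<otimes> (x \<otimes> y)"
  shows "(x \<otimes> y) [^] (i::nat) = w [^] (i choose 2) \<otimes> (x [^] i \<otimes> y [^] i)"
proof (induction i)
  case 0
  show ?case using x y by (simp add: numeral_2_eq_2)
next
  case (Suc i)
  note wc = center_closed [OF w]
  have "(x \<otimes> y) [^] Suc i = w [^] (i choose 2) \<otimes> (x [^] i \<otimes> ((y [^] i \<otimes> x) \<otimes> y))"
    using Suc x y wc by (simp add: m_assoc)
  also have "y [^] i \<otimes> x = w [^] i \<otimes> (x \<otimes> y [^] i)" by (rule pow_commute_central [OF y x w e])
  also have "x [^] i \<otimes> (w [^] i \<otimes> (x \<otimes> y [^] i) \<otimes> y) = w [^] i \<otimes> (x [^] i \<otimes> (x \<otimes> y [^] i \<otimes> y))"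
    using central_left_commute [OF central_pow [OF w, of i], of "x [^] i" "x \<otimes> y [^] i \<otimes> y"] x y wc
    by (simp add: m_assoc)
  also have "w [^] (i choose 2) \<otimes> (w [^] i \<otimes> (x [^] i \<otimes> (x \<otimes> y [^] i \<otimes> y))) =
      w [^] (Suc i choose 2) \<otimes> (x [^] Suc i \<otimes> y [^] Suc i)"
    using x y wc nat_pow_mult [OF wc, of "i choose 2" i, symmetric] by (simp add: m_assoc Suc_choose_two add.commute)
  finally show ?case .
qed

end

text \<open>Up to isomorphism, these are the direct products of an elementary abelian group with the
  extraspecial group of order \<open>p\<^sup>3\<close> and exponent \<open>p\<close> for odd \<open>p\<close>, with the dihedral
  group of order 8 for \<open>p = 2\<close>.\<close>

definition heisenberg_like :: "('a, 'm) monoid_scheme \<Rightarrow> nat \<Rightarrow> bool" where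
  "heisenberg_like G p \<longleftrightarrow> (\<exists>a b. a \<in> carrier G \<and> b \<in> carrier G \<and> commutator G a b \<noteq> \<one>\<^bsub>G\<^esub> \<and>
     derived G (carrier G) \<subseteq> center G \<and> a [^]\<^bsub>G\<^esub> p = \<one>\<^bsub>G\<^esub> \<and> b [^]\<^bsub>G\<^esub> p = \<one>\<^bsub>G\<^esub> \<and>
     p * (p * card (center G)) = order G \<and> (\<forall>c\<in>center G. c [^]\<^bsub>G\<^esub> p = \<one>\<^bsub>G\<^esub>))"

locale prime_derived = p_group +
  assumes card_derived: "card (derived G (carrier G)) = p"
begin

lemma derived_central: "derived G (carrier G) \<subseteq> center G"
  by (rule prime_normal_central [OF derived_self_is_normal card_derived])

lemma commutator_central:
  "g \<in> carrier G \<Longrightarrow> h \<in> carrier G \<Longrightarrow> commutator G g h \<in> center G"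
  using commutator_in_derived derived_central by blast

lemma derived_pow: "x \<in> derived G (carrier G) \<Longrightarrow> x [^] p = \<one>"
  using powers_of_prime_card(2) [OF subgroup_derived card_derived] nat_pow_one by (cases "x = \<one>") auto

lemma derived_eq_powers:
  "x \<in> derived G (carrier G) \<Longrightarrow> x \<noteq> \<one> \<Longrightarrow> derived G (carrier G) = powers G x"
  by (rule powers_of_prime_card(1) [OF subgroup_derived card_derived])

lemma derived_mem_powers:
  "x \<in> derived G (carrier G) \<Longrightarrow> x \<noteq> \<one> \<Longrightarrow> z \<in> derived G (carrier G) \<Longrightarrow> z \<in> powers G x"
  using derived_eq_powers by blast

lemma noncommuting_ex:
  obtains a b where "a \<in> carrier G" "b \<in> carrier G" "commutator G a b \<noteq> \<one>"
proof (rule ccontr)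
  assume "\<not> thesis"
  with that have "commutator G a b = \<one>" if "a \<in> carrier G" "b \<in> carrier G" for a b using that by metis
  then have "derived G (carrier G) \<subseteq> {\<one>}" by (intro derived_subsetI [OF triv_subgroup]) simp
  then have "card (derived G (carrier G)) \<le> 1" using card_mono [of "{\<one>}"] by simp
  then show False using card_derived prime_gt_1_nat [OF prime_p] by simp
qed

text \<open>Moving \<open>x [^] p\<close> past \<open>g\<close> costs the \<open>p\<close>-th power
  of their central commutator, which is trivial because the derived subgroup has order
  \<open>p\<close>.\<close>

lemma pow_p_central:
  assumes x: "x \<in> carrier G" shows "x [^] p \<in> center G"
proof (rule centerI)
  fix g assume g: "g \<in> carrier G"
  have "x [^] p \<otimes> g = commutator G x g [^] p \<otimes> (g \<otimes> x [^] p)"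
    by (rule pow_commute_central [OF x g commutator_central [OF x g] commutator_mult [OF x g]])
  then show "g \<otimes> x [^] p = x [^] p \<otimes> g"
    using derived_pow [OF commutator_in_derived [OF x g]] x g by simp
qed (use x in simp)

text \<open>The analogue of splitting off a hyperbolic plane: the commutators of \<open>g\<close>
  with \<open>a\<close> and \<open>b\<close> are powers of \<open>[a,b]\<close>, and multiplying
  \<open>g\<close> by suitable powers of \<open>b\<close> and \<open>a\<close> cancels them, which
  leaves an element of the common centralizer.\<close>

lemma subgroup_eq_carrier:
  assumes a: "a \<in> carrier G" and b: "b \<in> carrier G" and ne: "commutator G a b \<noteq> \<one>"
    and S: "subgroup S G" "a \<in> S" "b \<in> S" "centralizer G a \<inter> centralizer G b \<subseteq> S"
  shows "S = carrier G"
proof (intro subset_antisym subsetI)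
  fix g assume g: "g \<in> carrier G"
  define z where "z = commutator G a b"
  have zD: "z \<in> derived G (carrier G)" unfolding z_def by (rule commutator_in_derived [OF a b])
  have zZ: "z \<in> center G" unfolding z_def by (rule commutator_central [OF a b])
  note zc = center_closed [OF zZ]
  have ab: "a \<otimes> b = z \<otimes> (b \<otimes> a)" unfolding z_def by (rule commutator_mult [OF a b])
  have z1: "z \<noteq> \<one>" using ne by (simp add: z_def)
  have "commutator G g a \<in> powers G z"
    by (rule derived_mem_powers [OF zD z1 commutator_in_derived [OF g a]])
  then obtain k where k: "commutator G g a = z [^] (k::nat)" by (auto simp: powers_def)
  note zkZ = central_pow [OF zZ, of k] note zkc = center_closed [OF zkZ]
  \<comment> \<open>The factor \<open>b [^] k\<close> cancels the commutator with
    \<open>a\<close>.\<close>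
  define h where "h = g \<otimes> b [^] k"
  have hc: "h \<in> carrier G" using g b by (simp add: h_def)
  have "z [^] k \<otimes> (a \<otimes> h) = (z [^] k \<otimes> (a \<otimes> g)) \<otimes> b [^] k" using g a b zkc by (simp add: h_def m_assoc)
  also have "z [^] k \<otimes> (a \<otimes> g) = g \<otimes> a" using commutator_mult [OF g a] k by simp
  also have "g \<otimes> a \<otimes> b [^] k = g \<otimes> (z [^] k \<otimes> (b [^] k \<otimes> a))"
    using commute_pow_central [OF a b zZ ab, of k] g a b by (simp add: m_assoc)
  also have "\<dots> = z [^] k \<otimes> (h \<otimes> a)"
    using central_left_commute [OF zkZ g, of "b [^] k \<otimes> a"] g a b by (simp add: h_def m_assoc)
  finally have ha: "a \<otimes> h = h \<otimes> a" using zkc a hc by simp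
  have "commutator G h b \<in> powers G z"
    by (rule derived_mem_powers [OF zD z1 commutator_in_derived [OF hc b]])
  then obtain l where l: "commutator G h b = z [^] (l::nat)" by (auto simp: powers_def)
  \<comment> \<open>A natural number congruent to \<open>- l\<close> modulo \<open>p\<close>, so
    that the factor \<open>a [^] i\<close> cancels the commutator with \<open>b\<close> while still
    commuting with \<open>a\<close>.\<close>
  define i where "i = l * (p - 1)"
  have "l + i = p * l" using p_pos by (cases p) (simp_all add: i_def mult.commute)
  then have zli: "z [^] i \<otimes> z [^] l = \<one>"
    using zc derived_pow [OF zD] by (simp add: nat_pow_mult add.commute flip: nat_pow_pow)
  define c where "c = h \<otimes> a [^] i"
  have cc: "c \<in> carrier G" using hc a by (simp add: c_def)
  have "c \<otimes> b = h \<otimes> (z [^] i \<otimes> (b \<otimes> a [^] i))"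
    using pow_commute_central [OF a b zZ ab, of i] hc a b by (simp add: c_def m_assoc)
  also have "\<dots> = z [^] i \<otimes> ((h \<otimes> b) \<otimes> a [^] i)"
    using central_left_commute [OF central_pow [OF zZ, of i] hc, of "b \<otimes> a [^] i"] hc a b by (simp add: m_assoc)
  also have "\<dots> = z [^] i \<otimes> ((z [^] l \<otimes> (b \<otimes> h)) \<otimes> a [^] i)"
    using commutator_mult [OF hc b] l by simp
  also have "\<dots> = (z [^] i \<otimes> z [^] l) \<otimes> (b \<otimes> c)" using zc hc a b by (simp add: c_def m_assoc)
  finally have cb: "c \<otimes> b = b \<otimes> c" unfolding zli using b cc by simp
  have "a \<otimes> a [^] i = a [^] i \<otimes> a" by (rule commute_pow [OF a a refl])
  moreover have "h \<in> centralizer G a" using ha hc by (simp add: centralizer_iff)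
  ultimately have "c \<in> centralizer G a"
    unfolding c_def using subgroup.m_closed [OF subgroup_centralizer [OF a]] a by (simp add: centralizer_iff)
  then have "c \<in> S" using S(4) cb cc by (auto simp: centralizer_iff)
  moreover have "c \<otimes> inv (a [^] i) \<otimes> inv (b [^] k) = g"
    using g a b by (simp add: c_def h_def m_assoc)
  moreover have "inv (a [^] i) \<in> S" "inv (b [^] k) \<in> S"
    using subgroup.m_inv_closed [OF S(1)] subgroup_nat_pow_closed [OF S(1)] S(2,3) by blast+
  ultimately show "g \<in> S" using subgroup.m_closed [OF S(1)] by metis
qed (use subgroup.subset [OF S(1)] in blast)

text \<open>Commutators take at most \<open>p\<close> values, so commuting with \<open>a\<close>,
  and then with \<open>b\<close>, costs a factor of at most \<open>p\<close> each.\<close>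

lemma order_le_common_centralizer:
  assumes a: "a \<in> carrier G" and b: "b \<in> carrier G"
  shows "p ^ n \<le> p * (p * card (centralizer G a \<inter> centralizer G b))"
proof -
  have finD: "finite (derived G (carrier G))"
    using finite_subset_carrier subgroup.subset [OF subgroup_derived] by blast
  note sa = subgroup_centralizer [OF a]
  have "card (carrier G) \<le> p * card (carrier G \<inter> centralizer G a)"
    using order_le_centralizer [OF finite_carrier a subset_refl subgroup_self finD commutator_in_derived]
    a card_derived by metis
  also have "carrier G \<inter> centralizer G a = centralizer G a" using subgroup.subset [OF sa] by blast
  finally have 1: "p ^ n \<le> p * card (centralizer G a)" using order_G by (simp add: order_def)
  have "commutator G g b \<in> derived G (carrier G)" if "g \<in> centralizer G a" for g
    using commutator_in_derived b that subgroup.mem_carrier [OF sa] by blast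
  then have "card (centralizer G a) \<le> p * card (centralizer G a \<inter> centralizer G b)"
    using order_le_centralizer [OF finite_carrier b subgroup.subset [OF sa] sa finD] card_derived by metis
  then show ?thesis using 1 by (meson le_trans mult_le_mono2)
qed

lemma common_centralizer_subset_ann:
  assumes a: "a \<in> carrier G" and b: "b \<in> carrier G"
  shows "centralizer G a \<inter> centralizer G b \<subseteq> ann G (commutator G a b)"
proof
  fix c assume "c \<in> centralizer G a \<inter> centralizer G b"
  then have "c \<in> carrier G" "c \<otimes> a = a \<otimes> c" "c \<otimes> b = b \<otimes> c" by (simp_all add: centralizer_iff)
  then show "c \<in> ann G (commutator G a b)" using eps_commutator a b by (simp add: ann_iff)
qed

lemma ann_derived:
  assumes "z \<in> derived G (carrier G)" "y \<in> derived G (carrier G)" "y \<noteq> \<one>"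
  shows "ann G y \<subseteq> ann G z"
  by (rule ann_powers) (use assms derived_central derived_mem_powers in blast)+

text \<open>If \<open>c\<close> and \<open>d\<close> in the common centralizer did not commute,
  \<open>[c,d]\<close> would generate the derived subgroup and be annihilated by \<open>a\<close>
  and \<open>b\<close>; together with the common centralizer these generate \<open>G\<close>,
  against the assumption on \<open>ann\<close>. So the common centralizer is abelian, and its
  elements, commuting also with \<open>a\<close> and \<open>b\<close>, are central.\<close>

lemma common_centralizer_eq_center:
  assumes a: "a \<in> carrier G" and b: "b \<in> carrier G" and ne: "commutator G a b \<noteq> \<one>"
    and an: "ann G (commutator G a b) \<noteq> carrier G"
  shows "centralizer G a \<inter> centralizer G b = center G"
proof (intro subset_antisym subsetI)
  let ?C = "centralizer G a \<inter> centralizer G b" and ?z = "commutator G a b"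
  have zD: "?z \<in> derived G (carrier G)" by (rule commutator_in_derived [OF a b])
  have Cc: "c \<in> carrier G" "c \<otimes> a = a \<otimes> c" "c \<otimes> b = b \<otimes> c" if "c \<in> ?C" for c
    using that by (auto simp: centralizer_iff)
  have comm: "c \<otimes> d = d \<otimes> c" if c: "c \<in> ?C" and d: "d \<in> ?C" for c d
  proof (rule ccontr)
    assume "c \<otimes> d \<noteq> d \<otimes> c"
    then have y1: "commutator G c d \<noteq> \<one>" using commutator_eq_one_iff Cc c d by blast
    have yD: "commutator G c d \<in> derived G (carrier G)" by (rule commutator_in_derived [OF Cc(1) [OF c] Cc(1) [OF d]])
    have "a \<in> ann G (commutator G c d)" "b \<in> ann G (commutator G c d)"
      using eps_commutator Cc [OF c] Cc [OF d] a b by (simp_all add: ann_iff)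
    then have "a \<in> ann G ?z" "b \<in> ann G ?z" using ann_derived [OF zD yD y1] by blast+
    then have "ann G ?z = carrier G"
      by (rule subgroup_eq_carrier [OF a b ne subgroup_ann [OF finite_carrier commutator_central [OF a b]]
            _ _ common_centralizer_subset_ann [OF a b]])
    then show False using an by simp
  qed
  fix c assume c: "c \<in> ?C"
  note s = subgroup_centralizer [OF Cc(1) [OF c]]
  have "centralizer G c = carrier G"
  proof (rule subgroup_eq_carrier [OF a b ne s])
    show "a \<in> centralizer G c" "b \<in> centralizer G c"
      unfolding centralizer_iff using a b Cc(2,3) [OF c] by simp_all
    show "?C \<subseteq> centralizer G c"
    proof
      fix d assume d: "d \<in> ?C"
      show "d \<in> centralizer G c" unfolding centralizer_iff using Cc(1) [OF d] comm [OF d c] by blast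
    qed
  qed
  then show "c \<in> center G"
    by (intro centerI Cc(1) [OF c]) (metis centralizer_iff)
next
  fix c assume "c \<in> center G"
  then show "c \<in> centralizer G a \<inter> centralizer G b" using center_in_centralizer a b by blast
qed

text \<open>Adjoining \<open>a\<close> and then \<open>b\<close> to the center enlarges it by a
  factor \<open>p\<close> each time; the opposite inequality is
  \<open>order_le_common_centralizer\<close>.\<close>

lemma card_center:
  assumes a: "a \<in> carrier G" and b: "b \<in> carrier G" and ne: "commutator G a b \<noteq> \<one>"
    and eq: "centralizer G a \<inter> centralizer G b = center G"
  shows "p * (p * card (center G)) = p ^ n"
proof (rule antisym)
  have nc: "a \<otimes> b \<noteq> b \<otimes> a" using ne commutator_eq_one_iff [OF a b] by simp
  have aZ: "a \<notin> center G"
  proof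
    assume "a \<in> center G"
    from center_comm [OF this b] nc show False by simp
  qed
  note fa = card_adjoin [OF finite_carrier subgroup_center a aZ pow_p_central [OF a] prime_p]
  have nZ: "center G \<lhd> G" by (rule normal_of_central [OF subgroup_center subset_refl])
  note s1 = subgroup_adjoin [OF finite_carrier nZ a]
  have Zs: "center G \<subseteq> adjoin G (center G) a" by (rule subset_adjoin [OF subgroup.subset [OF subgroup_center]])
  have "adjoin G (center G) a \<subseteq> centralizer G a"
  proof
    fix w assume "w \<in> adjoin G (center G) a"
    then obtain s i where w: "s \<in> center G" "w = s \<otimes> a [^] (i::nat)" by (auto simp: adjoin_def)
    have "a [^] i \<in> centralizer G a"
      by (rule subgroup_nat_pow_closed [OF subgroup_centralizer [OF a]]) (use a in \<open>simp add: centralizer_iff\<close>)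
    then show "w \<in> centralizer G a"
      using w subgroup.m_closed [OF subgroup_centralizer [OF a]] center_in_centralizer [OF w(1) a] by simp
  qed
  then have bn: "b \<notin> adjoin G (center G) a" using nc by (auto simp: centralizer_iff)
  have bp: "b [^] p \<in> adjoin G (center G) a" using pow_p_central [OF b] Zs by blast
  note fb = card_adjoin [OF finite_carrier s1 b bn bp prime_p]
  have "card (adjoin G (adjoin G (center G) a) b) \<le> card (carrier G)"
    by (rule card_mono [OF finite_carrier adjoin_subset_carrier [OF subgroup.subset [OF s1] b]])
  then show "p * (p * card (center G)) \<le> p ^ n" using fa fb order_G by (simp add: order_def)
  show "p ^ n \<le> p * (p * card (center G))" using order_le_common_centralizer [OF a b] eq by simp
qed

text \<open>The quotient by the derived subgroup is abelian. If some \<open>p\<close>-th power lies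
  outside the derived subgroup, this quotient has exponent different from \<open>p\<close> and the
  sharper abelian bound applies.\<close>

lemma H2_ann_bound:
  assumes z: "z \<in> derived G (carrier G)" "z \<noteq> \<one>"
  shows "finite (carrier (H2 G))"
    and "p * (order (H2 G) * card (ann G z)) \<le> p ^ ((n - 1) choose 2) * p ^ n"
    and "\<And>x. x \<in> carrier G \<Longrightarrow> x [^] p \<notin> derived G (carrier G) \<Longrightarrow>
      p * (order (H2 G) * card (ann G z)) \<le> p ^ ((n - 1 - 1) choose 2) * p ^ n"
proof -
  have zZ: "z \<in> center G" using z derived_central by blast
  obtain Q :: "('a, 'b) monoid_scheme" and \<pi> where cq: "central_quotient G p n z Q \<pi>"
    using central_quotient_ex [OF zZ z(2) derived_pow [OF z(1)]] by blast
  interpret cq: central_quotient G p n z Q \<pi> by (rule cq)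
  have D: "derived G (carrier G) = powers G z" by (rule derived_eq_powers [OF z])
  have cQ: "comm_group Q" using cq.comm_Q_iff D by simp
  note ab = H2_abelian [OF cq.p_group_Q cQ]
  note b = cq.H2_bound [OF ab(1)]
  show "finite (carrier (H2 G))" by (rule b(1))
  show "p * (order (H2 G) * card (ann G z)) \<le> p ^ ((n - 1) choose 2) * p ^ n"
    by (rule le_trans [OF b(3) [OF z(1)] mult_le_mono1 [OF ab(2)]])
  fix x assume x: "x \<in> carrier G" "x [^] p \<notin> derived G (carrier G)"
  have "\<pi> x [^]\<^bsub>Q\<^esub> p \<noteq> \<one>\<^bsub>Q\<^esub>"
    using x cq.\<pi>_one_iff [of "x [^] p"] cq.\<pi>_pow D by simp
  from ab(3) [OF cq.\<pi>_closed [OF x(1)] this]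
  show "p * (order (H2 G) * card (ann G z)) \<le> p ^ ((n - 1 - 1) choose 2) * p ^ n"
    by (rule le_trans [OF b(3) [OF z(1)] mult_le_mono1])
qed

text \<open>The annihilator contains the common centralizer of a noncommuting pair, so its order is
  at least \<open>p^(n-2)\<close>.\<close>

lemma H2_upper_bound: "finite (carrier (H2 G))" "order (H2 G) \<le> p ^ ((n - 1 choose 2) + 1)"
proof -
  obtain a b where ab: "a \<in> carrier G" "b \<in> carrier G" "commutator G a b \<noteq> \<one>" by (rule noncommuting_ex)
  let ?C = "centralizer G a \<inter> centralizer G b" and ?z = "commutator G a b"
  note h = H2_ann_bound [OF commutator_in_derived [OF ab(1,2)] ab(3)]
  show "finite (carrier (H2 G))" by (rule h(1))
  have "finite (ann G ?z)" using finite_subset_carrier by (simp add: ann_def)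
  then have "card ?C \<le> card (ann G ?z)"
    by (rule card_mono [OF _ common_centralizer_subset_ann [OF ab(1,2)]])
  then have "p * (order (H2 G) * card ?C) \<le> p * (order (H2 G) * card (ann G ?z))" by simp
  also note h(2)
  also have "p ^ (n - 1 choose 2) * p ^ n \<le> p ^ (n - 1 choose 2) * (p * (p * card ?C))"
    by (rule mult_le_mono2 [OF order_le_common_centralizer [OF ab(1,2)]])
  finally have "(p * card ?C) * order (H2 G) \<le> (p * card ?C) * p ^ ((n - 1 choose 2) + 1)"
    by (simp add: mult_ac)
  moreover have "card ?C > 0"
    using order_le_common_centralizer [OF ab(1,2)] p_pos by (intro Suc_leI gr0I) auto
  ultimately show "order (H2 G) \<le> p ^ ((n - 1 choose 2) + 1)" using p_pos by simp
qed

text \<open>Otherwise \<open>g [^] p\<close> would generate the derived subgroup, so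
  \<open>z\<close> would be a power of \<open>g\<close>, and \<open>g\<close> pairs trivially with
  its own powers.\<close>

lemma pow_p_eq_one:
  assumes g: "g \<in> carrier G" "g [^] p \<in> derived G (carrier G)" and z: "z \<in> derived G (carrier G)"
    and \<alpha>: "\<alpha> \<in> cocycles2 G" "eps \<alpha> g z \<noteq> 1"
  shows "g [^] p = \<one>"
proof (rule ccontr)
  assume "g [^] p \<noteq> \<one>"
  then have "z \<in> powers G (g [^] p)" by (rule derived_mem_powers [OF g(2) _ z])
  then obtain i where i: "z = g [^] (p * i)" using g(1) by (auto simp: powers_def nat_pow_pow)
  have "eps \<alpha> g z = 1" unfolding i using eps_pow_right [OF \<alpha>(1) g(1) g(1) refl] \<alpha>(1) g(1) by simp
  then show False using \<alpha>(2) by simp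
qed

text \<open>The lower bound leaves at most one factor \<open>p\<close> of slack in
  \<open>H2_upper_bound\<close>. Each conclusion holds because its failure would cost more than
  that, or would make the pairing with the derived subgroup trivial.\<close>

lemma large_multiplier:
  assumes big: "p ^ (n - 1 choose 2) \<le> order (H2 G)"
  obtains a b \<alpha> where "a \<in> carrier G" "b \<in> carrier G" "\<alpha> \<in> cocycles2 G" "commutator G a b \<noteq> \<one>"
    "eps \<alpha> a (commutator G a b) \<noteq> 1" "p * (p * card (center G)) = p ^ n"
    "\<And>c. c \<in> center G \<Longrightarrow> c [^] p = \<one>" "\<And>g. g \<in> carrier G \<Longrightarrow> g [^] p \<in> derived G (carrier G)"
    "center G \<subseteq> ann G (commutator G a b)"
proof -
  let ?D = "derived G (carrier G)"
  \<comment> \<open>If \<open>ann G z\<close> were everything, \<open>H2_ann_bound\<close> would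
    give \<open>p\<close> times the multiplier at most \<open>p ^ (n - 1 choose 2)\<close>.\<close>
  have an: "ann G z \<noteq> carrier G" if "z \<in> ?D" "z \<noteq> \<one>" for z
  proof
    assume e: "ann G z = carrier G"
    have "p * (p ^ (n - 1 choose 2) * p ^ n) \<le> p * (order (H2 G) * p ^ n)" using big by simp
    also have "\<dots> \<le> p ^ ((n - 1) choose 2) * p ^ n"
      using H2_ann_bound(2) [OF that] e order_G by (simp add: order_def)
    finally show False using prime_gt_1_nat [OF prime_p] by simp
  qed
  obtain a0 b0 where ab0: "a0 \<in> carrier G" "b0 \<in> carrier G" "commutator G a0 b0 \<noteq> \<one>" by (rule noncommuting_ex)
  define z0 where "z0 = commutator G a0 b0"
  have z0: "z0 \<in> ?D" "z0 \<noteq> \<one>" using commutator_in_derived ab0 by (auto simp: z0_def)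
  have eq0: "centralizer G a0 \<inter> centralizer G b0 = center G"
    by (rule common_centralizer_eq_center [OF ab0 an [OF z0, unfolded z0_def]])
  note cc = card_center [OF ab0 eq0]
  have Zann: "center G \<subseteq> ann G z" if "z \<in> ?D" for z
    using common_centralizer_subset_ann [OF ab0(1,2)] eq0 ann_derived [OF that z0] unfolding z0_def by blast
  obtain g where g: "g \<in> carrier G" "g \<notin> ann G z0" using an [OF z0] by (auto simp: ann_def)
  then obtain \<alpha> where \<alpha>: "\<alpha> \<in> cocycles2 G" "eps \<alpha> g z0 \<noteq> 1" by (auto simp: ann_iff)
  \<comment> \<open>The center lies in the annihilator, so the chosen \<open>g\<close> is noncentral
    and can serve as the first member of a noncommuting pair.\<close>
  have "g \<notin> center G" using g Zann [OF z0(1)] by blast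
  then obtain b where b: "b \<in> carrier G" "g \<otimes> b \<noteq> b \<otimes> g" using centerI [OF g(1)] by metis
  have ne: "commutator G g b \<noteq> \<one>" using b commutator_eq_one_iff [OF g(1) b(1)] by simp
  note yD = commutator_in_derived [OF g(1) b(1)]
  have e: "eps \<alpha> g (commutator G g b) \<noteq> 1"
  proof
    assume "eps \<alpha> g (commutator G g b) = 1"
    moreover obtain i where "z0 = commutator G g b [^] (i::nat)"
      using derived_mem_powers [OF yD ne z0(1)] by (auto simp: powers_def)
    moreover have "g \<otimes> commutator G g b = commutator G g b \<otimes> g"
      by (rule center_comm [OF commutator_central [OF g(1) b(1)] g(1)])
    ultimately show False using eps_pow_right [OF \<alpha>(1) g(1), of "commutator G g b" i] \<alpha>(2) g(1) b(1) by simp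
  qed
  \<comment> \<open>The central element \<open>x [^] p\<close> outside the derived subgroup forces
    the center to have order at least \<open>p * p\<close>, so \<open>n\<close> is at least 4. The
    sharper bound then gives C(n-1,2) <= C(n-2,2) + 1, that is \<open>n\<close> at most 3.\<close>
  have pD: "x [^] p \<in> ?D" if x: "x \<in> carrier G" for x
  proof (rule ccontr)
    assume n: "x [^] p \<notin> ?D"
    have finZ: "finite (center G)" by (rule finite_subset_carrier [OF subgroup.subset [OF subgroup_center]])
    have "?D \<subset> center G" using derived_central pow_p_central [OF x] n by blast
    then have "p < card (center G)" using psubset_card_mono [OF finZ] card_derived by metis
    moreover obtain k where k: "card (center G) = p ^ k" using card_subgroup [OF subgroup_center] by metis
    ultimately have "1 < k" using prime_gt_1_nat [OF prime_p] by (metis power_one_right power_less_imp_less_exp)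
    have "p ^ (k + 2) = p ^ n" using cc k by simp
    then have "n = k + 2" by (simp only: power_inject_exp [OF prime_gt_1_nat [OF prime_p]])
    moreover obtain m where "k = Suc (1 + m)" using less_imp_Suc_add [OF \<open>1 < k\<close>] by blast
    ultimately have m: "n = Suc (Suc (Suc (Suc m)))" by simp
    have "finite (ann G z0)" using finite_subset_carrier by (simp add: ann_def)
    then have "card (center G) \<le> card (ann G z0)" by (rule card_mono [OF _ Zann [OF z0(1)]])
    then have "p * (order (H2 G) * card (center G)) \<le> p * (order (H2 G) * card (ann G z0))" by simp
    also have "\<dots> \<le> p ^ ((n - 1 - 1) choose 2) * p ^ n" by (rule H2_ann_bound(3) [OF z0 x n])
    also have "\<dots> = p ^ ((n - 1 - 1) choose 2) * (p * (p * card (center G)))" using cc by simp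
    finally have "(p * card (center G)) * order (H2 G) \<le> (p * card (center G)) * p ^ (((n - 1 - 1) choose 2) + 1)"
      by (simp add: mult_ac)
    then have "order (H2 G) \<le> p ^ (((n - 1 - 1) choose 2) + 1)" using k p_pos by simp
    then have "p ^ (n - 1 choose 2) \<le> p ^ (((n - 1 - 1) choose 2) + 1)" using big by simp
    then have "(n - 1 choose 2) \<le> ((n - 1 - 1) choose 2) + 1"
      using prime_gt_1_nat [OF prime_p] by (simp only: power_increasing_iff)
    then show False unfolding m by (simp add: Suc_choose_two)
  qed
  \<comment> \<open>A nontrivial \<open>c [^] p\<close> would have \<open>z0\<close> among its
    powers. But \<open>g\<close> pairs with \<open>c [^] p\<close> as \<open>g [^] p\<close> does
    with \<open>c\<close>, and \<open>g [^] p\<close> is a power of \<open>z0\<close>, which pairs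
    trivially with the center.\<close>
  have "c [^] p = \<one>" if c: "c \<in> center G" for c
  proof (rule ccontr)
    assume n: "c [^] p \<noteq> \<one>"
    note cc = center_closed [OF c]
    have gc: "g \<otimes> c = c \<otimes> g" by (rule center_comm [OF c g(1)])
    obtain i where i: "z0 = (c [^] p) [^] (i::nat)"
      using derived_mem_powers [OF pD [OF cc] n z0(1)] by (auto simp: powers_def)
    obtain j where j: "g [^] p = z0 [^] (j::nat)"
      using derived_mem_powers [OF z0 pD [OF g(1)]] by (auto simp: powers_def)
    have z0c: "z0 \<in> carrier G" using z0 subgroup.mem_carrier [OF subgroup_derived] by blast
    have "eps \<alpha> g (c [^] p) = eps \<alpha> (g [^] p) c"
      using eps_pow_right [OF \<alpha>(1) g(1) cc gc] eps_pow_left [OF \<alpha>(1) cc g(1) gc [symmetric]] by simp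
    also have "\<dots> = eps \<alpha> z0 c ^ j"
      unfolding j by (rule eps_pow_left [OF \<alpha>(1) cc z0c center_comm [OF c z0c, symmetric]])
    also have "eps \<alpha> z0 c = 1"
      using Zann [OF z0(1)] c \<alpha>(1) eps_swap [of \<alpha> z0 c] by (auto simp: ann_iff)
    finally have "eps \<alpha> g (c [^] p) = 1" by simp
    moreover have "g \<otimes> c [^] p = c [^] p \<otimes> g" by (rule commute_pow [OF g(1) cc gc])
    ultimately have "eps \<alpha> g z0 = 1" unfolding i using eps_pow_right [OF \<alpha>(1) g(1), of "c [^] p" i] cc by simp
    then show False using \<alpha>(2) by simp
  qed
  then show thesis using that [OF g(1) b(1) \<alpha>(1) ne e cc _ pD Zann [OF yD]] by blast
qed

end


section \<open>Groups with larger derived subgroup\<close>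

text \<open>The preimage of the center of \<open>G\<close> modulo the subgroup generated by
  \<open>z\<close>, phrased by commutators so that no quotient has to be fixed.\<close>

definition center_mod :: "('a, 'm) monoid_scheme \<Rightarrow> 'a \<Rightarrow> 'a set" where
  "center_mod G z = {g \<in> carrier G. \<forall>h\<in>carrier G. commutator G g h \<in> powers G z}"

lemma prime_dvd_choose_two:
  assumes "Factorial_Ring.prime (p::nat)" "p \<noteq> 2" shows "p dvd (p choose 2)"
proof (rule dvd_choose_prime [OF _ _ _ assms(1)])
  show "2 < p" using assms prime_ge_2_nat [OF assms(1)] by simp
qed (use assms prime_gt_0_nat in auto)

section \<open>Groups with derived subgroup of order p and large multiplier\<close>

context prime_derived
begin

text \<open>The element \<open>a\<close> has order \<open>p\<close> since it pairs nontrivially with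
  \<open>[a,b]\<close>. If \<open>b\<close> does not have order \<open>p\<close> and
  \<open>p = 2\<close>, then \<open>a b\<close> replaces it: its square is the product of
  \<open>[b,a]\<close> and \<open>b^2\<close>, which are both the nontrivial element of the derived
  subgroup.\<close>

lemma heisenberg_like:
  assumes big: "p ^ (n - 1 choose 2) \<le> order (H2 G)"
  shows "heisenberg_like G p"
proof -
  obtain a b \<alpha> where ab: "a \<in> carrier G" "b \<in> carrier G" and \<alpha>: "\<alpha> \<in> cocycles2 G"
    and ne: "commutator G a b \<noteq> \<one>" and e: "eps \<alpha> a (commutator G a b) \<noteq> 1"
    and cen: "p * (p * card (center G)) = p ^ n" and cp: "\<And>c. c \<in> center G \<Longrightarrow> c [^] p = \<one>"
    and pD: "\<And>g. g \<in> carrier G \<Longrightarrow> g [^] p \<in> derived G (carrier G)"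
    using large_multiplier [OF big] by metis
  let ?z = "commutator G a b"
  note zD = commutator_in_derived [OF ab] and zZ = commutator_central [OF ab]
  have ap: "a [^] p = \<one>" by (rule pow_p_eq_one [OF ab(1) pD [OF ab(1)] zD \<alpha> e])
  have intro: "heisenberg_like G p"
    if "c \<in> carrier G" "commutator G a c \<noteq> \<one>" "c [^] p = \<one>" for c
    unfolding heisenberg_like_def using that ab(1) derived_central ap cen cp order_G by metis
  show ?thesis
  proof (cases "b [^] p = \<one>")
    case True
    then show ?thesis by (rule intro [OF ab(2) ne])
  next
    case False
    let ?w = "commutator G b a"
    have w: "?w \<in> center G" "?w \<in> derived G (carrier G)"
      by (rule commutator_central [OF ab(2,1)], rule commutator_in_derived [OF ab(2,1)])
    note wc = center_closed [OF w(1)]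
    have abp: "(a \<otimes> b) [^] p = ?w [^] (p choose 2) \<otimes> b [^] p"
      using mult_pow_central [OF ab w(1) commutator_mult [OF ab(2,1)], of p] ap ab by simp
    have nab: "a \<otimes> b \<noteq> b \<otimes> a" using ne commutator_eq_one_iff [OF ab] by simp
    show ?thesis
    proof (cases "p = 2")
      case True
      have "?w \<noteq> \<one>" using nab commutator_eq_one_iff [OF ab(2,1)] by metis
      have "?w = b [^] p"
      proof (rule ccontr)
        assume neq: "?w \<noteq> b [^] p"
        have "{\<one>, ?w, b [^] p} \<subseteq> derived G (carrier G)"
          using w(2) pD [OF ab(2)] subgroup.one_closed [OF subgroup_derived] by blast
        moreover have "finite (derived G (carrier G))"
          using finite_subset_carrier subgroup.subset [OF subgroup_derived] by blast
        ultimately have "card {\<one>, ?w, b [^] p} \<le> 2" using card_mono card_derived True by metis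
        moreover have "card {\<one>, ?w, b [^] p} = 3" using neq \<open>?w \<noteq> \<one>\<close> False by (simp add: eq_commute)
        ultimately show False by simp
      qed
      moreover have "p choose 2 = 1" using True by (simp add: numeral_2_eq_2)
      ultimately have "(a \<otimes> b) [^] p = ?w \<otimes> ?w" using abp wc by simp
      also have "\<dots> = ?w [^] p" using True wc by (simp add: numeral_2_eq_2)
      also have "\<dots> = \<one>" by (rule derived_pow [OF w(2)])
      finally have "(a \<otimes> b) [^] p = \<one>" .
      moreover have "commutator G a (a \<otimes> b) \<noteq> \<one>"
        using commutator_eq_one_iff [of a "a \<otimes> b"] nab ab by (simp add: m_assoc)
      ultimately show ?thesis using intro [of "a \<otimes> b"] ab by blast
    next
      case odd: False
      \<comment> \<open>For odd \<open>p\<close> the binomial coefficient is divisible by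
        \<open>p\<close>, so \<open>a b\<close> and \<open>b\<close> have the same nontrivial
        \<open>p\<close>-th power. Both then pair trivially with \<open>[a,b]\<close>, and hence so
        does \<open>a\<close>, a contradiction.\<close>
      obtain m where m: "p choose 2 = p * m" using prime_dvd_choose_two [OF prime_p odd] by blast
      have "?w [^] (p choose 2) = (?w [^] p) [^] m" unfolding m using wc by (simp add: nat_pow_pow)
      then have "(a \<otimes> b) [^] p = b [^] p" using abp derived_pow [OF w(2)] ab by simp
      then have "(a \<otimes> b) [^] p \<noteq> \<one>" using False by simp
      then have "eps \<alpha> (a \<otimes> b) ?z = 1" "eps \<alpha> b ?z = 1"
        using pow_p_eq_one [OF _ pD zD \<alpha>] ab False by blast+
      moreover have "eps \<alpha> (a \<otimes> b) ?z = eps \<alpha> a ?z * eps \<alpha> b ?z"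
        by (rule eps_mult_left [OF \<alpha> center_closed [OF zZ] ab center_comm [OF zZ ab(1)] center_comm [OF zZ ab(2)]])
      ultimately show ?thesis using e by simp
    qed
  qed
qed

text \<open>At the maximum no room is left between the center and the annihilator, so every
  noncentral \<open>g\<close> pairs nontrivially with a commutator and has order \<open>p\<close> by
  \<open>pow_p_eq_one\<close>. This is applied to quotients in the second case.\<close>

lemma maximal_multiplier:
  assumes big: "p ^ ((n - 1 choose 2) + 1) \<le> order (H2 G)"
  shows "p * (p * card (center G)) = p ^ n" "\<And>g. g \<in> carrier G \<Longrightarrow> g [^] p = \<one>"
proof -
  have "p ^ (n - 1 choose 2) \<le> p ^ ((n - 1 choose 2) + 1)"
    by (rule power_increasing) (use p_pos in auto)
  then have large: "p ^ (n - 1 choose 2) \<le> order (H2 G)" using big by (rule le_trans)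
  obtain a b \<alpha> where ab: "a \<in> carrier G" "b \<in> carrier G"
    and ne: "commutator G a b \<noteq> \<one>" 
    and cen: "p * (p * card (center G)) = p ^ n" and cp: "\<And>c. c \<in> center G \<Longrightarrow> c [^] p = \<one>"
    and pD: "\<And>g. g \<in> carrier G \<Longrightarrow> g [^] p \<in> derived G (carrier G)"
    and Zann: "center G \<subseteq> ann G (commutator G a b)"
    using large_multiplier [OF large] by metis
  let ?z = "commutator G a b"
  note zD = commutator_in_derived [OF ab]
  show "p * (p * card (center G)) = p ^ n" by (rule cen)
  have "p * (p ^ ((n - 1 choose 2) + 1) * card (ann G ?z)) \<le> p * (order (H2 G) * card (ann G ?z))"
    using big by simp
  also have "\<dots> \<le> p ^ ((n - 1) choose 2) * p ^ n" by (rule H2_ann_bound(2) [OF zD ne])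
  finally have "(p ^ ((n - 1 choose 2) + 1) * p) * card (ann G ?z) \<le> (p ^ ((n - 1 choose 2) + 1) * p) * card (center G)"
    unfolding cen [symmetric] by (simp add: mult_ac)
  then have "card (ann G ?z) \<le> card (center G)" using p_pos by simp
  moreover have "finite (ann G ?z)" using finite_subset_carrier by (simp add: ann_def)
  ultimately have eq: "center G = ann G ?z" using Zann by (metis card_seteq)
  fix g assume g: "g \<in> carrier G"
  show "g [^] p = \<one>"
  proof (cases "g \<in> center G")
    case False
    then obtain \<alpha> where "\<alpha> \<in> cocycles2 G" "eps \<alpha> g ?z \<noteq> 1" using g unfolding eq by (auto simp: ann_iff)
    then show ?thesis by (rule pow_p_eq_one [OF g pD [OF g] zD])
  qed (rule cp)
qed

end

section \<open>Descent to nonabelian quotients\<close>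

lemma (in p_group) noncomm_facts:
  assumes "\<not> comm_group G"
  shows "p dvd card (derived G (carrier G))"
    and "card (derived G (carrier G)) \<noteq> p \<Longrightarrow> p * p \<le> card (derived G (carrier G))"
    and "\<exists>z. z \<in> derived G (carrier G) \<and> z \<in> center G \<and> z \<noteq> \<one> \<and> z [^] p = \<one>"
    and "n > 0"
proof -
  let ?D = "derived G (carrier G)"
  have ne: "?D \<noteq> {\<one>}"
  proof
    assume D: "?D = {\<one>}"
    have "comm_group G"
    proof (rule group_comm_groupI)
      fix x y assume xy: "x \<in> carrier G" "y \<in> carrier G"
      have "commutator G x y = \<one>" using commutator_in_derived [OF xy] D by simp
      then show "x \<otimes> y = y \<otimes> x" using commutator_eq_one_iff [OF xy] by simp
    qed
    then show False using assms by simp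
  qed
  show d: "p dvd card ?D" by (rule p_dvd_card_subgroup [OF subgroup_derived ne])
  show "\<exists>z. z \<in> ?D \<and> z \<in> center G \<and> z \<noteq> \<one> \<and> z [^] p = \<one>"
    using normal_meets_center [OF derived_self_is_normal ne] by metis
  obtain k where k: "k \<le> n" "card ?D = p ^ k" using card_subgroup [OF subgroup_derived] by metis
  have "k \<noteq> 0" using d k prime_gt_1_nat [OF prime_p] by (intro notI) simp
  then show "n > 0" using k by simp
  assume "card ?D \<noteq> p"
  then have "k \<noteq> 1" using k by (intro notI) simp
  then have "2 \<le> k" using \<open>k \<noteq> 0\<close> by simp
  then have "p ^ 2 \<le> p ^ k" using p_pos by (intro power_increasing) auto
  then show "p * p \<le> card ?D" using k by (simp add: power2_eq_square)
qed

lemma (in central_quotient) noncomm_Q: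
  assumes "z \<in> derived G (carrier G)" "card (derived G (carrier G)) \<noteq> p"
  shows "\<not> comm_group Q"
proof
  assume "comm_group Q"
  then have "derived G (carrier G) \<subseteq> powers G z" using comm_Q_iff by simp
  moreover have "powers G z \<subseteq> derived G (carrier G)" by (rule powers_in_subgroup [OF subgroup_derived assms(1)])
  ultimately show False using assms(2) card_powers_prime [OF zc z(3,2)] by simp
qed

text \<open>This is nonnegativity of the generalized corank. If the derived subgroup has order at
  least \<open>p * p\<close>, a central \<open>z\<close> of order \<open>p\<close> in it leaves a
  nonabelian quotient, and \<open>ann G z\<close> contains the derived subgroup; the resulting
  exponent is even one smaller than claimed.\<close>

lemma H2_nonabelian_bound:
  assumes "p_group G p n" "\<not> comm_group G"
  shows "finite (carrier (H2 G))" "order (H2 G) \<le> p ^ ((n - 1 choose 2) + 1)"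
proof -
  have "finite (carrier (H2 G)) \<and> order (H2 G) \<le> p ^ ((n - 1 choose 2) + 1)"
    if "p_group G p n" "\<not> comm_group G" for n and G :: "('a, 'b) monoid_scheme"
    using that
  proof (induction n arbitrary: G)
    case (0 G)
    interpret p_group G p 0 by fact
    show ?case using noncomm_facts(4) [OF 0(2)] by simp
  next
    case (Suc k G)
    interpret p_group G p "Suc k" by fact
    show ?case
    proof (cases "card (derived G (carrier G)) = p")
      case True
      interpret prime_derived G p "Suc k" by unfold_locales (rule True)
      show ?thesis using H2_upper_bound by simp
    next
      case False
      obtain z where z: "z \<in> derived G (carrier G)" "z \<in> center G" "z \<noteq> \<one>\<^bsub>G\<^esub>" "z [^]\<^bsub>G\<^esub> p = \<one>\<^bsub>G\<^esub>"
        using noncomm_facts(3) [OF Suc.prems(2)] by blast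
      obtain Q :: "('a, 'b) monoid_scheme" and \<pi> where cq: "central_quotient G p (Suc k) z Q \<pi>"
        using central_quotient_ex [OF z(2-4)] by blast
      interpret cq: central_quotient G p "Suc k" z Q \<pi> by (rule cq)
      note nQ = cq.noncomm_Q [OF z(1) False]
      have pQ: "p_group Q p k" using cq.p_group_Q by simp
      note IH = Suc.IH [OF pQ nQ]
      then have fin: "finite (carrier (H2 Q))" by simp
      note b = cq.H2_bound [OF fin]
      have "k > 0" using p_group.noncomm_facts(4) [OF pQ nQ] .
      then obtain l where l: "k = Suc l" using gr0_implies_Suc by blast
      have "finite (ann G z)" using finite_subset_carrier by (simp add: ann_def)
      then have "card (derived G (carrier G)) \<le> card (ann G z)"
        by (rule card_mono [OF _ derived_subset_ann [OF finite_carrier z(2)]])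
      then have "p * p \<le> card (ann G z)" using noncomm_facts(2) [OF Suc.prems(2) False] by linarith
      then have "p * (order (H2 G) * (p * p)) \<le> p * (order (H2 G) * card (ann G z))" by simp
      also note b(3) [OF z(1)]
      also have "order (H2 Q) * p ^ Suc k \<le> p ^ ((k - 1 choose 2) + 1) * p ^ Suc k"
        using IH by (intro mult_le_mono1) simp
      finally have "(p * p * p) * order (H2 G) \<le> (p * p * p) * p ^ (k choose 2)"
        unfolding l by (simp add: Suc_choose_two power_add mult_ac)
      then have "order (H2 G) \<le> p ^ (k choose 2)" using p_pos by simp
      also have "\<dots> \<le> p ^ ((k choose 2) + 1)" using p_pos by simp
      finally show ?thesis using b(1) by simp
    qed
  qed
  then show "finite (carrier (H2 G))" "order (H2 G) \<le> p ^ ((n - 1 choose 2) + 1)" using assms by blast+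
qed

text \<open>The equality case of the preceding estimate. The conditions are stated for all
  admissible \<open>z\<close>, because the structure comes from comparing independent choices of
  \<open>z\<close>.\<close>

locale square_derived = p_group +
  assumes card_derived: "card (derived G (carrier G)) = p * p"
    and n_ge: "n \<ge> 4"
    and ann_eq: "\<And>z. z \<in> derived G (carrier G) \<Longrightarrow> z \<in> center G \<Longrightarrow> z \<noteq> \<one> \<Longrightarrow> z [^] p = \<one> \<Longrightarrow>
      ann G z = derived G (carrier G)"
    and pow_p: "\<And>z g. z \<in> derived G (carrier G) \<Longrightarrow> z \<in> center G \<Longrightarrow> z \<noteq> \<one> \<Longrightarrow> z [^] p = \<one> \<Longrightarrow>
      g \<in> carrier G \<Longrightarrow> g [^] p \<in> powers G z"
    and derived_subset_center_mod: "\<And>z. z \<in> derived G (carrier G) \<Longrightarrow> z \<in> center G \<Longrightarrow> z \<noteq> \<one> \<Longrightarrow> z [^] p = \<one> \<Longrightarrow>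
      derived G (carrier G) \<subseteq> center_mod G z"
    and card_center_mod: "\<And>z. z \<in> derived G (carrier G) \<Longrightarrow> z \<in> center G \<Longrightarrow> z \<noteq> \<one> \<Longrightarrow> z [^] p = \<one> \<Longrightarrow>
      p * (p * card (center_mod G z)) = p ^ n"

lemma (in central_quotient) center_mod_eq: "center_mod G z = {g \<in> carrier G. \<pi> g \<in> center Q}"
proof (intro subset_antisym subsetI)
  fix g assume g: "g \<in> center_mod G z"
  then have gc: "g \<in> carrier G" by (simp add: center_mod_def)
  have "\<pi> g \<in> center Q"
  proof (rule Q.centerI [OF \<pi>_closed [OF gc]])
    fix q assume "q \<in> carrier Q"
    then obtain h where h: "h \<in> carrier G" "q = \<pi> h" by (rule carrier_Q_E)
    have "commutator G g h \<in> powers G z" using g h by (simp add: center_mod_def)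
    then have "commutator Q (\<pi> g) (\<pi> h) = \<one>\<^bsub>Q\<^esub>" using \<pi>_commutator [OF gc h(1)] \<pi>_kernel by metis
    then show "q \<otimes>\<^bsub>Q\<^esub> \<pi> g = \<pi> g \<otimes>\<^bsub>Q\<^esub> q"
      using Q.commutator_eq_one_iff [OF \<pi>_closed [OF gc] \<pi>_closed [OF h(1)]] h(2) by simp
  qed
  then show "g \<in> {g \<in> carrier G. \<pi> g \<in> center Q}" using gc by simp
next
  fix g assume "g \<in> {g \<in> carrier G. \<pi> g \<in> center Q}"
  then have g: "g \<in> carrier G" "\<pi> g \<in> center Q" by auto
  have "commutator G g h \<in> powers G z" if h: "h \<in> carrier G" for h
  proof -
    have "\<pi> g \<otimes>\<^bsub>Q\<^esub> \<pi> h = \<pi> h \<otimes>\<^bsub>Q\<^esub> \<pi> g" using Q.center_comm [OF g(2) \<pi>_closed [OF h]] by simp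
    then have "commutator Q (\<pi> g) (\<pi> h) = \<one>\<^bsub>Q\<^esub>"
      using Q.commutator_eq_one_iff [OF \<pi>_closed [OF g(1)] \<pi>_closed [OF h]] by simp
    then have "\<pi> (commutator G g h) = \<one>\<^bsub>Q\<^esub>" using \<pi>_commutator [OF g(1) h] by simp
    then show ?thesis using \<pi>_one_iff [OF commutator_closed [OF g(1) h]] by simp
  qed
  then show "g \<in> center_mod G z" using g by (simp add: center_mod_def)
qed

lemma (in central_quotient) card_center_mod: "card (center_mod G z) = p * card (center Q)"
proof -
  let ?C = "center_mod G z"
  have s: "subgroup ?C G"
  proof (rule finite_subgroupI [OF finite_carrier])
    show "\<one> \<in> ?C" unfolding center_mod_eq using subgroup.one_closed [OF Q.subgroup_center] by simp
    fix x y assume "x \<in> ?C" "y \<in> ?C"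
    then show "x \<otimes> y \<in> ?C" unfolding center_mod_eq using subgroup.m_closed [OF Q.subgroup_center] by simp
  qed (auto simp: center_mod_def)
  interpret C: group "G\<lparr>carrier := ?C\<rparr>" by (rule subgroup_imp_group [OF s])
  interpret r: group_hom "G\<lparr>carrier := ?C\<rparr>" Q \<pi>
    by unfold_locales (use hom_\<pi> subgroup.subset [OF s] in \<open>auto simp: hom_def Pi_iff subset_iff\<close>)
  have "kernel (G\<lparr>carrier := ?C\<rparr>) Q \<pi> = powers G z"
  proof (intro subset_antisym subsetI)
    fix x assume "x \<in> kernel (G\<lparr>carrier := ?C\<rparr>) Q \<pi>"
    then have "x \<in> carrier G" "\<pi> x = \<one>\<^bsub>Q\<^esub>" by (auto simp: kernel_def center_mod_def)
    then show "x \<in> powers G z" using \<pi>_one_iff by simp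
  next
    fix x assume x: "x \<in> powers G z"
    then have "x \<in> ?C" unfolding center_mod_eq
      using powers_carrier \<pi>_kernel subgroup.one_closed [OF Q.subgroup_center] by simp
    then show "x \<in> kernel (G\<lparr>carrier := ?C\<rparr>) Q \<pi>" using \<pi>_kernel [OF x] by (simp add: kernel_def)
  qed
  moreover have "\<pi> ` ?C = center Q"
  proof (intro subset_antisym subsetI)
    fix q assume q: "q \<in> center Q"
    obtain g where "g \<in> carrier G" "q = \<pi> g" by (rule carrier_Q_E [OF Q.center_closed [OF q]])
    then show "q \<in> \<pi> ` ?C" unfolding center_mod_eq using q by auto
  qed (auto simp: center_mod_eq)
  ultimately show ?thesis
    using r.order_kernel_image card_powers_prime [OF zc z(3,2)] by (simp add: order_def)
qed

text \<open>The estimates for \<open>ann G z\<close> and for the multiplier of the quotient must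
  both be sharp. So \<open>ann G z\<close> is the derived subgroup, of order \<open>p * p\<close>,
  and the quotient has derived subgroup of order \<open>p\<close> and maximal multiplier;
  \<open>maximal_multiplier\<close> supplies its exponent and its center.\<close>

lemma (in p_group) square_derivedI:
  assumes nc: "\<not> comm_group G" and cD: "card (derived G (carrier G)) \<noteq> p"
    and big: "p ^ (n - 1 choose 2) \<le> order (H2 G)"
  shows "square_derived G p n"
proof -
  let ?D = "derived G (carrier G)"
  have main: "ann G z = ?D \<and> card ?D = p * p \<and> n \<ge> 4 \<and> (\<forall>g\<in>carrier G. g [^] p \<in> powers G z) \<and>
      ?D \<subseteq> center_mod G z \<and> p * (p * card (center_mod G z)) = p ^ n"
    if z: "z \<in> ?D" "z \<in> center G" "z \<noteq> \<one>" "z [^] p = \<one>" for z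
  proof -
    obtain Q :: "('a, 'b) monoid_scheme" and \<pi> where cq: "central_quotient G p n z Q \<pi>"
      using central_quotient_ex [OF z(2-4)] by blast
    interpret cq: central_quotient G p n z Q \<pi> by (rule cq)
    note nQ = cq.noncomm_Q [OF z(1) cD]
    note pQ = cq.p_group_Q
    note IH = H2_nonabelian_bound [OF pQ nQ]
    note b = cq.H2_bound [OF IH(1)]
    have "n - 1 > 0" using p_group.noncomm_facts(4) [OF pQ nQ] .
    then obtain l where l: "n = Suc (Suc l)" by (metis Suc_pred' gr0_conv_Suc zero_less_diff Suc_diff_1 less_trans zero_less_one)
    have finA: "finite (ann G z)" using finite_subset_carrier by (simp add: ann_def)
    have DA: "?D \<subseteq> ann G z" by (rule derived_subset_ann [OF finite_carrier z(2)])
    have D2: "p * p \<le> card ?D" by (rule noncomm_facts(2) [OF nc cD])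
    have "p * (p ^ (n - 1 choose 2) * card (ann G z)) \<le> p * (order (H2 G) * card (ann G z))" using big by simp
    also note b(3) [OF z(1)]
    finally have b1: "p * (p ^ (n - 1 choose 2) * card (ann G z)) \<le> order (H2 Q) * p ^ n" .
    also have "\<dots> \<le> p ^ ((n - 1 - 1 choose 2) + 1) * p ^ n" by (rule mult_le_mono1 [OF IH(2)])
    finally have "(p * p ^ (n - 1 choose 2)) * card (ann G z) \<le> (p * p ^ (n - 1 choose 2)) * (p * p)"
      unfolding l by (simp add: Suc_choose_two power_add mult_ac)
    then have "card (ann G z) \<le> p * p" using p_pos by simp
    then have "card (ann G z) \<le> card ?D" using D2 by linarith
    then have eq: "?D = ann G z" using DA finA by (metis card_seteq)
    then have c: "card ?D = p * p" using D2 \<open>card (ann G z) \<le> p * p\<close> by simp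
    from b1 have "p ^ n * p ^ ((n - 1 - 1 choose 2) + 1) \<le> p ^ n * order (H2 Q)"
      unfolding eq [symmetric] c l by (simp add: Suc_choose_two power_add mult_ac)
    then have bigQ: "p ^ ((n - 1 - 1 choose 2) + 1) \<le> order (H2 Q)" using p_pos by simp
    have "p * p = p * card (derived Q (carrier Q))" using cq.card_derived_Q [OF z(1)] c by simp
    then have cQ: "card (derived Q (carrier Q)) = p" using p_pos by simp
    interpret Q: prime_derived Q p "n - 1"
      by (intro prime_derived.intro pQ prime_derived_axioms.intro cQ)
    note mx = Q.maximal_multiplier [OF bigQ]
    have "card (derived Q (carrier Q)) \<le> card (center Q)"
      by (rule card_mono [OF Q.finite_subset_carrier [OF subgroup.subset [OF cq.Q.subgroup_center]] Q.derived_central])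
    \<comment> \<open>The center of the quotient has index \<open>p * p\<close> and contains the
      derived subgroup of order \<open>p\<close>; this is the source of
      \<open>n \<ge> 4\<close>.\<close>
    then have "p * (p * p) \<le> p ^ (n - 1)" unfolding mx(1) [symmetric] cQ by simp
    then have "p ^ 3 \<le> p ^ (n - 1)" by (simp add: numeral_3_eq_3)
    then have "3 \<le> n - 1" using prime_gt_1_nat [OF prime_p] by (simp only: power_increasing_iff)
    moreover have "g [^] p \<in> powers G z" if g: "g \<in> carrier G" for g
      using mx(2) [OF cq.\<pi>_closed [OF g]] cq.\<pi>_pow [OF g] cq.\<pi>_one_iff [of "g [^] p"] g by simp
    moreover have "?D \<subseteq> center_mod G z"
    proof
      fix d assume d: "d \<in> ?D"
      have dc: "d \<in> carrier G" using subgroup.mem_carrier [OF subgroup_derived d] .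
      have "\<pi> d \<in> derived Q (carrier Q)"
        using imageI [OF d, of \<pi>] unfolding cq.\<pi>.derived_img [OF subset_refl, symmetric] cq.surj_\<pi> .
      then show "d \<in> center_mod G z" unfolding cq.center_mod_eq using Q.derived_central dc by blast
    qed
    moreover have "p * (p * card (center_mod G z)) = p ^ n"
      using mx(1) cq.card_center_mod unfolding l by simp
    ultimately show ?thesis using eq c by simp
  qed
  obtain z where z: "z \<in> ?D" "z \<in> center G" "z \<noteq> \<one>" "z [^] p = \<one>"
    using noncomm_facts(3) [OF nc] by blast
  note m = main [OF z]
  show ?thesis
  proof (intro square_derived.intro square_derived_axioms.intro)
    show "p_group G p n" by (rule p_group_axioms)
    show "card ?D = p * p" "4 \<le> n" using m by auto
  qed (use main in blast)+
qed

text \<open>Up to isomorphism, this is the semidirect product of \<open>(\<int>/p)\<^sup>4\<close> by \<open>\<int>/p\<close> with two Jordan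
  blocks of size 2.\<close>

definition two_block_like :: "('a, 'm) monoid_scheme \<Rightarrow> nat \<Rightarrow> bool" where
  "two_block_like G p \<longleftrightarrow> order G = p ^ 5 \<and> (\<exists>z1 z2 c1 c2 g.
     z1 \<in> center G \<and> z2 \<in> center G \<and> c1 \<in> carrier G \<and> c2 \<in> carrier G \<and> g \<in> carrier G \<and>
     (\<forall>x\<in>{z1, z2, c1, c2, g}. x [^]\<^bsub>G\<^esub> p = \<one>\<^bsub>G\<^esub>) \<and>
     z1 \<notin> {\<one>\<^bsub>G\<^esub>} \<and> z2 \<notin> adjoin G {\<one>\<^bsub>G\<^esub>} z1 \<and> c1 \<notin> adjoin G (adjoin G {\<one>\<^bsub>G\<^esub>} z1) z2 \<and>
     c2 \<notin> adjoin G (adjoin G (adjoin G {\<one>\<^bsub>G\<^esub>} z1) z2) c1 \<and>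
     g \<notin> adjoin G (adjoin G (adjoin G (adjoin G {\<one>\<^bsub>G\<^esub>} z1) z2) c1) c2 \<and>
     derived G (carrier G) \<subseteq> adjoin G (adjoin G {\<one>\<^bsub>G\<^esub>} z1) z2 \<and>
     c1 \<otimes>\<^bsub>G\<^esub> c2 = c2 \<otimes>\<^bsub>G\<^esub> c1 \<and> commutator G g c1 = z1 \<and> commutator G g c2 = z2)"

lemma (in group) adjoin_one_eq_powers:
  assumes "x \<in> carrier G" shows "adjoin G {\<one>} x = powers G x"
  using assms by (auto simp: powers_def adjoin_def image_iff)

lemma (in p_group) card_strict_subgroup:
  assumes S: "subgroup S G" "S \<noteq> carrier G" shows "p * card S \<le> p ^ n"
proof -
  obtain k where k: "k \<le> n" "card S = p ^ k" using card_subgroup [OF S(1)] by metis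
  have "k \<noteq> n"
  proof
    assume "k = n"
    then have "card S = card (carrier G)" using k order_G by (simp add: order_def)
    then have "S = carrier G" using card_subset_eq [OF finite_carrier subgroup.subset [OF S(1)]] by simp
    then show False using S(2) by simp
  qed
  then have "Suc k \<le> n" using k by simp
  then have "p ^ Suc k \<le> p ^ n" using p_pos by (intro power_increasing) auto
  then show ?thesis using k by simp
qed

section \<open>Structure of the groups with derived subgroup of order p^2\<close>

context square_derived
begin

lemma central_elt:
  obtains z where "z \<in> derived G (carrier G)" "z \<in> center G" "z \<noteq> \<one>" "z [^] p = \<one>"
proof -
  have "derived G (carrier G) \<noteq> {\<one>}"
  proof
    assume "derived G (carrier G) = {\<one>}"
    then have "p * p = 1" using card_derived by simp
    then show False using prime_gt_1_nat [OF prime_p] by simp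
  qed
  then show thesis using normal_meets_center [OF derived_self_is_normal] that by metis
qed

lemma finite_derived: "finite (derived G (carrier G))"
  by (rule finite_subset_carrier [OF subgroup.subset [OF subgroup_derived]])

lemma derived_closed: "x \<in> derived G (carrier G) \<Longrightarrow> x \<in> carrier G"
  by (rule subgroup.mem_carrier [OF subgroup_derived])

text \<open>If \<open>u \<in> G'\<close> were not central, \<open>[g,u] = k \<noteq> 1\<close>, then for every \<open>c\<close> commuting with \<open>u\<close>
  conjugation by \<open>g\<close> would give \<open>\<epsilon>(c,u) = \<epsilon>(c\<^sup>g,u\<^sup>g) = \<epsilon>(c,u) \<epsilon>(c,k)\<close>, making the centralizer
  of \<open>u\<close> a subset of \<open>ann G k = G'\<close>.\<close>

lemma derived_central: "derived G (carrier G) \<subseteq> center G"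
proof
  let ?D = "derived G (carrier G)"
  fix u assume u: "u \<in> ?D"
  note uc = derived_closed [OF u]
  show "u \<in> center G"
  proof (rule ccontr)
    assume nu: "u \<notin> center G"
    obtain z where z: "z \<in> ?D" "z \<in> center G" "z \<noteq> \<one>" "z [^] p = \<one>" by (rule central_elt)
    note zc = center_closed [OF z(2)]
    let ?K = "powers G z"
    have sK: "subgroup ?K G" by (rule subgroup_powers [OF finite_carrier zc])
    have KZ: "?K \<subseteq> center G" by (rule powers_in_subgroup [OF subgroup_center z(2)])
    have KD: "?K \<subseteq> ?D" by (rule powers_in_subgroup [OF subgroup_derived z(1)])
    have uK: "u \<notin> ?K" using nu KZ by blast
    have "card (adjoin G ?K u) = p * p"
      using card_adjoin [OF finite_carrier sK uc uK pow_p [OF z uc] prime_p] card_powers_prime [OF zc z(4,3)] by simp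
    moreover have "adjoin G ?K u \<subseteq> ?D"
    proof
      fix w assume "w \<in> adjoin G ?K u"
      then obtain s i where "s \<in> ?K" "w = s \<otimes> u [^] (i::nat)" by (auto simp: adjoin_def)
      then show "w \<in> ?D"
        using KD subgroup.m_closed [OF subgroup_derived] subgroup_nat_pow_closed [OF subgroup_derived u] by blast
    qed
    \<comment> \<open>The derived subgroup is generated by the central \<open>z\<close> and by
      \<open>u\<close>, so all of its elements commute with \<open>u\<close>.\<close>
    ultimately have D: "adjoin G ?K u = ?D" using card_derived finite_derived by (simp add: card_subset_eq)
    have comK: "commutator G u g \<in> ?K" if "g \<in> carrier G" for g
      using derived_subset_center_mod [OF z] u that by (auto simp: center_mod_def)
    obtain g where g: "g \<in> carrier G" "g \<otimes> u \<noteq> u \<otimes> g" using nu centerI [OF uc] by metis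
    define k where "k = inv (commutator G u g)"
    have kK: "k \<in> ?K" unfolding k_def using comK [OF g(1)] subgroup.m_inv_closed [OF sK] by blast
    have kZ: "k \<in> center G" and kD: "k \<in> ?D" using kK KZ KD by blast+
    note kc = center_closed [OF kZ]
    have gu: "g \<otimes> u \<otimes> inv g = k \<otimes> u"
      unfolding k_def commutator_def using g uc by (simp add: inv_mult_group m_assoc)
    have k1: "k \<noteq> \<one>"
    proof
      assume "k = \<one>"
      then have "g \<otimes> u \<otimes> inv g \<otimes> g = u \<otimes> g" using gu uc by simp
      then show False using g uc by (simp add: m_assoc)
    qed
    have kp: "k [^] p = \<one>"
    proof -
      obtain i where "k = z [^] (i::nat)" using kK by (auto simp: powers_def)
      then have "k [^] p = (z [^] p) [^] i" using zc by (simp add: nat_pow_pow mult.commute)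
      then show ?thesis using z(4) by simp
    qed
    have "centralizer G u \<subseteq> ann G k"
    proof
      fix c assume c: "c \<in> centralizer G u"
      then have cc: "c \<in> carrier G" and cu: "c \<otimes> u = u \<otimes> c" by (auto simp: centralizer_iff)
      define w where "w = commutator G g c"
      have wD: "w \<in> ?D" unfolding w_def by (rule commutator_in_derived [OF g(1) cc])
      note wc = derived_closed [OF wD]
      have gcw: "g \<otimes> c \<otimes> inv g = w \<otimes> c" unfolding w_def commutator_def using g cc by (simp add: m_assoc)
      obtain s i where si: "s \<in> ?K" "w = s \<otimes> u [^] (i::nat)" using wD unfolding D [symmetric] by (auto simp: adjoin_def)
      have sZ: "s \<in> center G" using si KZ by blast
      note sc = center_closed [OF sZ]
      have su: "s \<otimes> u = u \<otimes> s" using center_comm [OF sZ uc] by simp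
      have uiu: "u [^] i \<otimes> u = u \<otimes> u [^] i" using commute_pow [OF uc uc refl, of i] by simp
      have wu: "w \<otimes> u = u \<otimes> w"
        using subgroup.m_closed [OF subgroup_centralizer [OF uc], of s "u [^] i"] su uiu sc uc si(2) by (simp add: centralizer_iff)
      have wcu: "(w \<otimes> c) \<otimes> u = u \<otimes> (w \<otimes> c)"
        using subgroup.m_closed [OF subgroup_centralizer [OF uc], of w c] wu cu wc cc by (simp add: centralizer_iff)
      have wcc: "w \<otimes> c \<in> carrier G" using wc cc by simp
      have "eps \<alpha> c k = 1" if \<alpha>: "\<alpha> \<in> cocycles2 G" for \<alpha>
      proof -
        \<comment> \<open>Conjugation turns \<open>c\<close> into \<open>w \<otimes> c\<close> and
          \<open>u\<close> into \<open>k \<otimes> u\<close>. The extra factors involving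
          \<open>w\<close> vanish: \<open>w\<close> is in the derived subgroup and so annihilates
          \<open>k\<close>, and it is a power of \<open>z\<close> times a power of \<open>u\<close>,
          both of which pair trivially with \<open>u\<close>.\<close>
        have "eps \<alpha> c u = eps \<alpha> (w \<otimes> c) (k \<otimes> u)"
          using eps_conj [OF \<alpha> g(1) cc uc cu] unfolding gcw gu by simp
        also have "\<dots> = eps \<alpha> (w \<otimes> c) k * eps \<alpha> (w \<otimes> c) u"
          by (rule eps_mult_right [OF \<alpha> wcc kc uc center_comm [OF kZ wcc] wcu])
        also have "eps \<alpha> (w \<otimes> c) k = eps \<alpha> w k * eps \<alpha> c k"
          by (rule eps_mult_left [OF \<alpha> kc wc cc center_comm [OF kZ wc] center_comm [OF kZ cc]])
        also have "eps \<alpha> w k = 1"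
          using ann_eq [OF kD kZ k1 kp] wD \<alpha> unfolding ann_def by blast
        also have "eps \<alpha> (w \<otimes> c) u = eps \<alpha> w u * eps \<alpha> c u"
          by (rule eps_mult_left [OF \<alpha> uc wc cc wu cu])
        also have "eps \<alpha> w u = 1"
        proof -
          have "eps \<alpha> w u = eps \<alpha> s u * eps \<alpha> (u [^] i) u"
            unfolding si(2) by (rule eps_mult_left [OF \<alpha> uc sc nat_pow_closed [OF uc] su uiu])
          also have "eps \<alpha> (u [^] i) u = 1" using eps_pow_left [OF \<alpha> uc uc refl] \<alpha> uc by simp
          also have "eps \<alpha> s u = 1"
          proof -
            obtain j where j: "s = z [^] (j::nat)" using si(1) by (auto simp: powers_def)
            have "eps \<alpha> u z = 1" using ann_eq [OF z] u \<alpha> unfolding ann_def by blast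
            then have "eps \<alpha> z u = 1" using eps_swap [of \<alpha> z u] by simp
            then show ?thesis unfolding j using eps_pow_left [OF \<alpha> uc zc center_comm [OF z(2) uc]] by simp
          qed
          finally show ?thesis by simp
        qed
        finally show ?thesis using eps_nonzero [OF \<alpha> cc uc] by simp
      qed
      then show "c \<in> ann G k" using cc by (simp add: ann_iff)
    qed
    then have "centralizer G u \<subseteq> ?D" using ann_eq [OF kD kZ k1 kp] by simp
    then have 1: "card (centralizer G u) \<le> p * p" using card_mono [OF finite_derived] card_derived by metis
    have finK: "finite ?K" by (rule finite_subset_carrier [OF subgroup.subset [OF sK]])
    have comK': "commutator G h u \<in> ?K" if h: "h \<in> carrier G" for h
    proof -
      have "commutator G h u = inv (commutator G u h)"
        unfolding commutator_def using h uc by (simp add: inv_mult_group m_assoc)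
      then show ?thesis using comK [OF h] subgroup.m_inv_closed [OF sK] by simp
    qed
    \<comment> \<open>Commutators with \<open>u\<close> take at most \<open>p\<close> values, while
      its centralizer has at most \<open>p * p\<close> elements; this contradicts
      \<open>n \<ge> 4\<close>.\<close>
    have "card (carrier G) \<le> card ?K * card (carrier G \<inter> centralizer G u)"
      by (rule order_le_centralizer [OF finite_carrier uc subset_refl subgroup_self finK comK'])
    also have "carrier G \<inter> centralizer G u = centralizer G u" by (auto simp: centralizer_iff)
    also have "card ?K * card (centralizer G u) \<le> p * (p * p)"
      using 1 card_powers_prime [OF zc z(4,3)] by simp
    finally have "p ^ n \<le> p ^ 3" using order_G by (simp add: order_def numeral_3_eq_3)
    then have "n \<le> 3" using prime_gt_1_nat [OF prime_p] by (simp only: power_increasing_iff)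
    then show False using n_ge by simp
  qed
qed

text \<open>As commutators are central, the \<open>p\<close>-th power of \<open>[g,h]\<close> is the
  commutator of \<open>g [^] p\<close> with \<open>h\<close>, and \<open>g [^] p\<close> is central
  because it is a power of \<open>z\<close>.\<close>

lemma derived_pow: "x \<in> derived G (carrier G) \<Longrightarrow> x [^] p = \<one>"
proof -
  obtain z where z: "z \<in> derived G (carrier G)" "z \<in> center G" "z \<noteq> \<one>" "z [^] p = \<one>" by (rule central_elt)
  have "subgroup {x \<in> center G. x [^] p = \<one>} G"
  proof (rule finite_subgroupI [OF finite_carrier])
    fix x y assume "x \<in> {x \<in> center G. x [^] p = \<one>}" "y \<in> {x \<in> center G. x [^] p = \<one>}"
    then have xy: "x \<in> center G" "y \<in> center G" "x [^] p = \<one>" "y [^] p = \<one>" by auto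
    have "(x \<otimes> y) [^] p = x [^] p \<otimes> y [^] p"
      by (rule pow_mult_distrib [OF center_comm [OF xy(2) center_closed [OF xy(1)]] center_closed [OF xy(1)] center_closed [OF xy(2)]])
    then show "x \<otimes> y \<in> {x \<in> center G. x [^] p = \<one>}"
      using xy subgroup.m_closed [OF subgroup_center] by simp
  qed (use center_closed subgroup.one_closed [OF subgroup_center] in auto)
  then have "derived G (carrier G) \<subseteq> {x \<in> center G. x [^] p = \<one>}"
  proof (rule derived_subsetI)
    fix g h assume gh: "g \<in> carrier G" "h \<in> carrier G"
    have w: "commutator G g h \<in> center G" using derived_central commutator_in_derived [OF gh] by blast
    have "powers G z \<subseteq> center G" by (rule powers_in_subgroup [OF subgroup_center z(2)])
    then have gp: "g [^] p \<in> center G" using pow_p [OF z gh(1)] by blast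
    have "g [^] p \<otimes> h = commutator G g h [^] p \<otimes> (h \<otimes> g [^] p)"
      by (rule pow_commute_central [OF gh w commutator_mult [OF gh]])
    also have "h \<otimes> g [^] p = g [^] p \<otimes> h" by (rule center_comm [OF gp gh(2)])
    finally have "commutator G g h [^] p = \<one>"
      using gh by (metis commutator_closed l_cancel_one' m_closed nat_pow_closed r_cancel_one')
    then show "commutator G g h \<in> {x \<in> center G. x [^] p = \<one>}" using w by simp
  qed
  then show "x \<in> derived G (carrier G) \<Longrightarrow> x [^] p = \<one>" by blast
qed

text \<open>Symmetry of annihilation: a central \<open>c\<close> is annihilated by the derived
  subgroup, in particular by \<open>z\<close>, so \<open>c\<close> lies in
  \<open>ann G z\<close>.\<close>

lemma center_eq_derived: "center G = derived G (carrier G)"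
proof (intro subset_antisym derived_central subsetI)
  fix c assume c: "c \<in> center G"
  obtain z where z: "z \<in> derived G (carrier G)" "z \<in> center G" "z \<noteq> \<one>" "z [^] p = \<one>" by (rule central_elt)
  have "z \<in> ann G c" using derived_subset_ann [OF finite_carrier c] z(1) by blast
  then have "c \<in> ann G z" using center_closed [OF c] eps_swap [of _ c z] by (auto simp: ann_iff)
  then show "c \<in> derived G (carrier G)" using ann_eq [OF z] by simp
qed

lemma card_center: "card (center G) = p * p"
  using card_derived center_eq_derived by simp

lemma powers_trivial_inter:
  assumes x: "x \<in> center G" and y: "y \<in> center G" and ny: "y \<notin> powers G x"
    and t: "t \<in> powers G x" "t \<in> powers G y"
  shows "t = \<one>"
proof (rule ccontr)
  assume "t \<noteq> \<one>"
  have yp: "y [^] p = \<one>" using derived_pow y center_eq_derived by simp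
  have "y \<in> powers G t" by (rule pow_coprime_generates [OF center_closed [OF y] yp t(2) \<open>t \<noteq> \<one>\<close>])
  moreover have "powers G t \<subseteq> powers G x"
    by (rule powers_in_subgroup [OF subgroup_powers [OF finite_carrier center_closed [OF x]] t(1)])
  ultimately show False using ny by blast
qed

lemma center_pair:
  obtains x y where "x \<in> center G" "y \<in> center G" "x \<noteq> \<one>" "y \<notin> powers G x"
proof -
  obtain z where z: "z \<in> derived G (carrier G)" "z \<in> center G" "z \<noteq> \<one>" "z [^] p = \<one>" by (rule central_elt)
  have "card (powers G z) < card (center G)"
    using card_powers_prime [OF center_closed [OF z(2)] z(4,3)] card_center prime_gt_1_nat [OF prime_p] by simp
  then have "\<not> center G \<subseteq> powers G z"
    using card_mono [OF finite_subset_carrier [OF powers_subset_carrier [OF center_closed [OF z(2)]]]] by (metis leD)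
  then show thesis using that z by blast
qed

text \<open>The \<open>p\<close>-th power of \<open>g\<close> lies in the cyclic groups of two
  independent central elements, which meet trivially.\<close>

lemma exponent: "g \<in> carrier G \<Longrightarrow> g [^] p = \<one>"
proof -
  assume g: "g \<in> carrier G"
  obtain x y where xy: "x \<in> center G" "y \<in> center G" "x \<noteq> \<one>" "y \<notin> powers G x" by (rule center_pair)
  have "y \<noteq> \<one>" using xy subgroup.one_closed [OF subgroup_powers [OF finite_carrier center_closed [OF xy(1)]]] by metis
  have d: "x \<in> derived G (carrier G)" "y \<in> derived G (carrier G)" using xy center_eq_derived by auto
  show ?thesis
    by (rule powers_trivial_inter [OF xy(1,2,4) pow_p [OF d(1) xy(1,3) derived_pow [OF d(1)] g]
          pow_p [OF d(2) xy(2) \<open>y \<noteq> \<one>\<close> derived_pow [OF d(2)] g]])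
qed

text \<open>Since commutators are central, \<open>g \<mapsto> [g,h]\<close> is
  multiplicative.\<close>

lemma subgroup_center_mod:
  assumes z: "z \<in> center G" shows "subgroup (center_mod G z) G"
proof (rule finite_subgroupI [OF finite_carrier])
  note sK = subgroup_powers [OF finite_carrier center_closed [OF z]]
  have "commutator G \<one> h = \<one>" if "h \<in> carrier G" for h using that by (simp add: commutator_def)
  then show "\<one> \<in> center_mod G z" using subgroup.one_closed [OF sK] by (simp add: center_mod_def)
  fix g g' assume gg: "g \<in> center_mod G z" "g' \<in> center_mod G z"
  then have c: "g \<in> carrier G" "g' \<in> carrier G" by (auto simp: center_mod_def)
  have "commutator G (g \<otimes> g') h \<in> powers G z" if h: "h \<in> carrier G" for h
  proof -
    let ?s = "commutator G g h" and ?t = "commutator G g' h"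
    have t: "?t \<in> center G" using commutator_in_derived [OF c(2) h] derived_central by blast
    have "(g \<otimes> g') \<otimes> h = g \<otimes> (?t \<otimes> (h \<otimes> g'))" using commutator_mult [OF c(2) h] c h by (simp add: m_assoc)
    also have "\<dots> = ?t \<otimes> ((g \<otimes> h) \<otimes> g')" using central_left_commute [OF t c(1), of "h \<otimes> g'"] c h by (simp add: m_assoc)
    also have "\<dots> = ?t \<otimes> ((?s \<otimes> (h \<otimes> g)) \<otimes> g')" using commutator_mult [OF c(1) h] by simp
    also have "\<dots> = (?t \<otimes> ?s) \<otimes> (h \<otimes> (g \<otimes> g'))" using c h by (simp add: m_assoc)
    finally have "commutator G (g \<otimes> g') h = ?t \<otimes> ?s" using c h by (intro commutator_eqI) simp_all
    then show ?thesis using gg h subgroup.m_closed [OF sK] by (simp add: center_mod_def)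
  qed
  then show "g \<otimes> g' \<in> center_mod G z" using c by (simp add: center_mod_def)
qed (auto simp: center_mod_def)

lemma center_subset_center_mod:
  assumes z: "z \<in> center G" shows "center G \<subseteq> center_mod G z"
proof
  fix c assume c: "c \<in> center G"
  have "commutator G c h = \<one>" if h: "h \<in> carrier G" for h
    using commutator_eq_one_iff [OF center_closed [OF c] h] center_comm [OF c h] by simp
  then show "c \<in> center_mod G z"
    using subgroup.one_closed [OF subgroup_powers [OF finite_carrier center_closed [OF z]]] center_closed [OF c]
    by (simp add: center_mod_def)
qed

lemma center_mod_inter:
  assumes x: "x \<in> center G" and y: "y \<in> center G" and ny: "y \<notin> powers G x"
  shows "center_mod G x \<inter> center_mod G y = center G"
proof (intro subset_antisym subsetI)
  fix c assume c: "c \<in> center_mod G x \<inter> center_mod G y"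
  then have cc: "c \<in> carrier G" by (simp add: center_mod_def)
  show "c \<in> center G"
  proof (rule centerI [OF cc])
    fix h assume h: "h \<in> carrier G"
    have "commutator G c h = \<one>"
      by (rule powers_trivial_inter [OF x y ny]) (use c h in \<open>auto simp: center_mod_def\<close>)
    then show "h \<otimes> c = c \<otimes> h" using commutator_eq_one_iff [OF cc h] by simp
  qed
next
  fix c assume "c \<in> center G"
  then show "c \<in> center_mod G x \<inter> center_mod G y"
    using center_subset_center_mod x y by blast
qed

lemma commutator_inv: "g \<in> carrier G \<Longrightarrow> h \<in> carrier G \<Longrightarrow> commutator G g h = inv (commutator G h g)"
  unfolding commutator_def by (simp add: inv_mult_group m_assoc)

text \<open>The commutator of \<open>c\<close> and \<open>d\<close> is a power of \<open>x\<close>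
  as well as of \<open>y\<close>, so it is trivial.\<close>

lemma center_mod_commute:
  assumes x: "x \<in> center G" and y: "y \<in> center G" and ny: "y \<notin> powers G x"
    and c: "c \<in> center_mod G x" and d: "d \<in> center_mod G y"
  shows "c \<otimes> d = d \<otimes> c"
proof -
  have cd: "c \<in> carrier G" "d \<in> carrier G" using c d by (auto simp: center_mod_def)
  have "commutator G c d \<in> powers G y"
    unfolding commutator_inv [OF cd]
    by (rule subgroup.m_inv_closed [OF subgroup_powers [OF finite_carrier center_closed [OF y]]])
       (use d cd in \<open>auto simp: center_mod_def\<close>)
  moreover have "commutator G c d \<in> powers G x" using c cd by (auto simp: center_mod_def)
  ultimately have "commutator G c d = \<one>" using powers_trivial_inter [OF x y ny] by blast
  then show ?thesis using commutator_eq_one_iff [OF cd] by simp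
qed

lemma card_center_mod_central:
  assumes "x \<in> center G" "x \<noteq> \<one>" shows "p * (p * card (center_mod G x)) = p ^ n"
  using card_center_mod [of x] assms derived_pow center_eq_derived by simp

text \<open>For order \<open>p^4\<close> every \<open>center_mod G x\<close> with nontrivial central
  \<open>x\<close> would be the center. But the centralizer of a noncentral \<open>a\<close>
  contains \<open>a\<close> and the center, hence has index \<open>p\<close>, so all commutators
  with \<open>a\<close> are powers of a single \<open>x\<close>, which puts \<open>a\<close> into
  \<open>center_mod G x\<close>.\<close>

lemma n_ne_4: "n \<noteq> 4"
proof
  assume n: "n = 4"
  obtain a where a: "a \<in> carrier G" "a \<notin> center G"
  proof -
    have "card (center G) \<noteq> card (carrier G)"
    proof
      assume e: "card (center G) = card (carrier G)"
      have "card (center G) = p ^ 4" unfolding e using order_G n unfolding order_def by simp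
      then have "p ^ 2 = p ^ 4" using card_center by (simp add: power2_eq_square)
      then show False by (simp only: power_inject_exp [OF prime_gt_1_nat [OF prime_p]])
    qed
    then show ?thesis using that subgroup.subset [OF subgroup_center] by (metis subsetI subset_antisym)
  qed
  obtain b where b: "b \<in> carrier G" "b \<otimes> a \<noteq> a \<otimes> b" using a centerI by metis
  define x where "x = commutator G b a"
  have xZ: "x \<in> center G" unfolding x_def using commutator_in_derived [OF b(1) a(1)] derived_central by blast
  note xc = center_closed [OF xZ]
  have x1: "x \<noteq> \<one>" unfolding x_def using b commutator_eq_one_iff [OF b(1) a(1)] by simp
  let ?C = "centralizer G a"
  note sC = subgroup_centralizer [OF a(1)]
  have one: "\<one> \<in> ?C" by (rule subgroup.one_closed [OF sC])
  have ZC: "center G \<subseteq> ?C" using center_in_centralizer [OF _ a(1)] by blast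
  have nC: "?C \<lhd> G" by (rule normal_of_derived [OF sC]) (use ZC center_eq_derived in simp)
  have "adjoin G (center G) a \<subseteq> ?C"
  proof
    fix w assume "w \<in> adjoin G (center G) a"
    then obtain s i where w: "s \<in> center G" "w = s \<otimes> a [^] (i::nat)" by (auto simp: adjoin_def)
    have "a [^] i \<in> ?C" by (rule subgroup_nat_pow_closed [OF sC]) (use a in \<open>simp add: centralizer_iff\<close>)
    then show "w \<in> ?C" using w ZC subgroup.m_closed [OF sC] by blast
  qed
  moreover have "card (adjoin G (center G) a) = p * (p * p)"
    using card_adjoin [OF finite_carrier subgroup_center a _ prime_p] exponent [OF a(1)]
      subgroup.one_closed [OF subgroup_center] card_center by simp
  moreover have "finite ?C" by (rule finite_subset_carrier [OF subgroup.subset [OF sC]])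
  ultimately have c3: "p * (p * p) \<le> card ?C" by (metis card_mono)
  have bC: "b \<notin> ?C" using b by (simp add: centralizer_iff)
  have "card (adjoin G ?C b) = p * card ?C"
    using card_adjoin [OF finite_carrier sC b(1) bC _ prime_p] exponent [OF b(1)] one by simp
  then have "card (carrier G) \<le> card (adjoin G ?C b)"
    using c3 order_G n by (simp add: order_def numeral_eq_Suc)
  then have full: "adjoin G ?C b = carrier G"
    using card_seteq [OF finite_carrier adjoin_subset_carrier [OF subgroup.subset [OF sC] b(1)]] by blast
  have "a \<in> center_mod G x"
    unfolding center_mod_def
  proof (intro CollectI conjI ballI a(1))
    fix h assume h: "h \<in> carrier G"
    then obtain c i where c: "c \<in> ?C" "h = c \<otimes> b [^] (i::nat)" unfolding full [symmetric] by (auto simp: adjoin_def)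
    then have cc: "c \<in> carrier G" "c \<otimes> a = a \<otimes> c" by (auto simp: centralizer_iff)
    have "h \<otimes> a = c \<otimes> (x [^] i \<otimes> (a \<otimes> b [^] i))"
      using pow_commute_central [OF b(1) a(1) xZ, of i] commutator_mult [OF b(1) a(1)] c(2) cc a b x_def by (simp add: m_assoc)
    also have "\<dots> = x [^] i \<otimes> (c \<otimes> (a \<otimes> b [^] i))"
      by (rule central_left_commute [OF central_pow [OF xZ] cc(1)]) (use a b in simp)
    also have "c \<otimes> (a \<otimes> b [^] i) = (c \<otimes> a) \<otimes> b [^] i" using cc(1) a b by (simp add: m_assoc)
    also have "(c \<otimes> a) \<otimes> b [^] i = a \<otimes> h" unfolding cc(2) c(2) using cc(1) a b by (simp add: m_assoc)
    finally have "commutator G h a = x [^] i" using h a xc by (intro commutator_eqI) simp_all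
    then have "commutator G h a \<in> powers G x" by (simp add: powers_def)
    then show "commutator G a h \<in> powers G x"
      unfolding commutator_inv [OF a(1) h]
      by (rule subgroup.m_inv_closed [OF subgroup_powers [OF finite_carrier xc]])
  qed
  moreover have "center_mod G x = center G"
  proof -
    have "(p * p) * card (center_mod G x) = (p * p) * (p * p)"
      using card_center_mod_central [OF xZ x1] n by (simp add: numeral_eq_Suc mult_ac)
    then have "card (center_mod G x) = p * p" using p_pos by simp
    moreover have "finite (center_mod G x)"
      by (rule finite_subset_carrier [OF subgroup.subset [OF subgroup_center_mod [OF xZ]]])
    ultimately show ?thesis using card_subset_eq [OF _ center_subset_center_mod [OF xZ]] card_center by simp
  qed
  ultimately show False using a by simp
qed

lemma n_ge_5: "n \<ge> 5"
  using n_ge n_ne_4 by simp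

lemma center_mod_noncentral:
  assumes x: "x \<in> center G" "x \<noteq> \<one>" obtains c where "c \<in> center_mod G x" "c \<notin> center G"
proof -
  have "center_mod G x \<noteq> center G"
  proof
    assume "center_mod G x = center G"
    then have "p * (p * (p * p)) = p ^ n" using card_center_mod_central [OF x] card_center by simp
    then have "p ^ 4 = p ^ n" by (simp add: numeral_eq_Suc)
    then have "4 = n" by (simp only: power_inject_exp [OF prime_gt_1_nat [OF prime_p]])
    then show False using n_ne_4 by simp
  qed
  then show thesis using that center_subset_center_mod [OF x(1)] by blast
qed

text \<open>A noncentral element of \<open>center_mod G x\<close> commutes with
  \<open>center_mod\<close> of two further lines of the center. Each of these has order
  \<open>p^(n-2)\<close> and they meet in the center, so the centralizer has order at least
  \<open>p^(2n-6)\<close>. Being proper it has order at most \<open>p^(n-1)\<close>, whence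
  \<open>n\<close> is at most 5.\<close>

lemma n_eq_5: "n = 5"
proof -
  obtain x y where xy: "x \<in> center G" "y \<in> center G" "x \<noteq> \<one>" "y \<notin> powers G x" by (rule center_pair)
  note xc = center_closed [OF xy(1)] and yc = center_closed [OF xy(2)]
  note sx = subgroup_powers [OF finite_carrier xc] and sy = subgroup_powers [OF finite_carrier yc]
  have xm: "x \<in> powers G x" and ym: "y \<in> powers G y"
    unfolding powers_def using xc yc by (metis nat_pow_eone rangeI)+
  have y1: "y \<noteq> \<one>" using xy(4) subgroup.one_closed [OF sx] by metis
  \<comment> \<open>A generator of a third subgroup of order \<open>p\<close> in the center,
    different from those of \<open>x\<close> and \<open>y\<close>.\<close>
  define w where "w = x \<otimes> y"
  have wZ: "w \<in> center G" unfolding w_def using xy subgroup.m_closed [OF subgroup_center] by blast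
  have wx: "w \<notin> powers G x"
  proof
    assume "w \<in> powers G x"
    then have "inv x \<otimes> w \<in> powers G x" using xm subgroup.m_closed [OF sx] subgroup.m_inv_closed [OF sx] by blast
    then show False using xy(4) xc yc by (simp add: w_def)
  qed
  have wy: "w \<notin> powers G y"
  proof
    assume "w \<in> powers G y"
    then have "w \<otimes> inv y \<in> powers G y" using ym subgroup.m_closed [OF sy] subgroup.m_inv_closed [OF sy] by blast
    then have "x \<in> powers G y" using xc yc by (simp add: w_def m_assoc)
    then show False using powers_trivial_inter [OF xy(1,2,4) xm] xy(3) by blast
  qed
  have w1: "w \<noteq> \<one>" using wx subgroup.one_closed [OF sx] by metis
  obtain c where c: "c \<in> center_mod G x" "c \<notin> center G" by (rule center_mod_noncentral [OF xy(1,3)])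
  have cc: "c \<in> carrier G" using c by (simp add: center_mod_def)
  let ?S = "centralizer G c"
  have sub: "center_mod G y \<subseteq> ?S" "center_mod G w \<subseteq> ?S"
    using center_mod_commute [OF xy(1,2,4) c(1)] center_mod_commute [OF xy(1) wZ wx c(1)]
    by (auto simp: centralizer_iff center_mod_def)
  have "card (center_mod G y) * card (center_mod G w) \<le> card ?S * card (center_mod G y \<inter> center_mod G w)"
    by (rule card_mult_le_inter [OF finite_carrier subgroup_center_mod [OF xy(2)] subgroup_center_mod [OF wZ]
          subgroup_centralizer [OF cc] sub])
  then have 1: "card (center_mod G y) * card (center_mod G w) \<le> card ?S * (p * p)"
    unfolding center_mod_inter [OF xy(2) wZ wy] card_center .
  have "?S \<noteq> carrier G"
  proof
    assume e: "?S = carrier G"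
    have "c \<in> center G" by (rule centerI [OF cc]) (use e in \<open>auto simp: centralizer_iff\<close>)
    then show False using c(2) by simp
  qed
  then have 2: "p * card ?S \<le> p ^ n" by (rule card_strict_subgroup [OF subgroup_centralizer [OF cc]])
  have "p * (p ^ n * p ^ n) = p ^ 5 * (card (center_mod G y) * card (center_mod G w))"
  proof -
    have "p ^ n * p ^ n = (p * (p * card (center_mod G y))) * (p * (p * card (center_mod G w)))"
      using card_center_mod_central [OF xy(2) y1] card_center_mod_central [OF wZ w1] by simp
    then show ?thesis by (simp add: numeral_eq_Suc mult_ac)
  qed
  also have "\<dots> \<le> p ^ 5 * (card ?S * (p * p))" using 1 by simp
  also have "\<dots> = p ^ 6 * (p * card ?S)" by (simp add: numeral_eq_Suc mult_ac)
  also have "\<dots> \<le> p ^ 6 * p ^ n" using 2 by simp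
  finally have "p ^ (1 + n + n) \<le> p ^ (6 + n)" by (simp only: power_add power_one_right mult_ac)
  then have "1 + n + n \<le> 6 + n" by (simp only: power_increasing_iff [OF prime_gt_1_nat [OF prime_p]])
  then show ?thesis using n_ge_5 by simp
qed

text \<open>Noncentral elements of \<open>center_mod\<close> for two independent central elements
  commute and, with the center, generate an abelian subgroup of order \<open>p^4\<close>. The last
  generator is any element outside it.\<close>

theorem two_block_like: "two_block_like G p"
proof -
  obtain x y where xy: "x \<in> center G" "y \<in> center G" "x \<noteq> \<one>" "y \<notin> powers G x" by (rule center_pair)
  note xc = center_closed [OF xy(1)] and yc = center_closed [OF xy(2)]
  note sx = subgroup_powers [OF finite_carrier xc] and sy = subgroup_powers [OF finite_carrier yc]
  have y1: "y \<noteq> \<one>" using xy(4) subgroup.one_closed [OF sx] by metis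
  obtain c1 where c1: "c1 \<in> center_mod G x" "c1 \<notin> center G" by (rule center_mod_noncentral [OF xy(1,3)])
  obtain c2 where c2: "c2 \<in> center_mod G y" "c2 \<notin> center G" by (rule center_mod_noncentral [OF xy(2) y1])
  have cc: "c1 \<in> carrier G" "c2 \<in> carrier G" using c1 c2 by (auto simp: center_mod_def)
  have com: "c1 \<otimes> c2 = c2 \<otimes> c1" by (rule center_mod_commute [OF xy(1,2,4) c1(1) c2(1)])
  let ?S3 = "adjoin G (center G) c1"
  have nZ: "center G \<lhd> G" by (rule normal_of_central [OF subgroup_center subset_refl])
  have s3: "subgroup ?S3 G" by (rule subgroup_adjoin [OF finite_carrier nZ cc(1)])
  have Z3: "center G \<subseteq> ?S3" by (rule subset_adjoin [OF subgroup.subset [OF subgroup_center]])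
  have n3: "?S3 \<lhd> G" by (rule normal_of_derived [OF s3]) (use Z3 center_eq_derived in simp)
  have oneZ: "\<one> \<in> center G" by (rule subgroup.one_closed [OF subgroup_center])
  have k3: "card ?S3 = p * (p * p)"
    using card_adjoin [OF finite_carrier subgroup_center cc(1) c1(2) _ prime_p] exponent [OF cc(1)] oneZ card_center by simp
  have "?S3 \<subseteq> center_mod G x"
  proof
    fix w assume "w \<in> ?S3"
    then obtain s i where w: "s \<in> center G" "w = s \<otimes> c1 [^] (i::nat)" by (auto simp: adjoin_def)
    show "w \<in> center_mod G x"
      unfolding w(2) using subgroup.m_closed [OF subgroup_center_mod [OF xy(1)]]
        subgroup_nat_pow_closed [OF subgroup_center_mod [OF xy(1)] c1(1)] center_subset_center_mod [OF xy(1)] w(1) by blast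
  qed
  then have c23: "c2 \<notin> ?S3" using center_mod_inter [OF xy(1,2,4)] c2 by blast
  let ?S4 = "adjoin G ?S3 c2"
  have s4: "subgroup ?S4 G" by (rule subgroup_adjoin [OF finite_carrier n3 cc(2)])
  have "\<one> \<in> ?S3" using oneZ Z3 by blast
  then have k4: "card ?S4 = p * (p * (p * p))"
    using card_adjoin [OF finite_carrier s3 cc(2) c23 _ prime_p] exponent [OF cc(2)] k3 by simp
  have S34: "?S3 \<subseteq> ?S4" by (rule subset_adjoin [OF subgroup.subset [OF s3]])
  have oG: "card (carrier G) = p * (p * (p * (p * p)))" using order_G n_eq_5 by (simp add: order_def numeral_eq_Suc)
  have "?S4 \<noteq> carrier G" using k4 oG p_pos prime_gt_1_nat [OF prime_p] by auto
  then obtain g where g: "g \<in> carrier G" "g \<notin> ?S4" using subgroup.subset [OF s4] by blast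
  have c1S: "c1 \<in> ?S4" using self_in_adjoin [OF oneZ cc(1)] S34 by blast
  have c2S: "c2 \<in> ?S4" by (rule self_in_adjoin [OF \<open>\<one> \<in> ?S3\<close> cc(2)])
  have S4abel: "?S4 \<subseteq> centralizer G c" if c: "c \<in> {c1, c2}" for c
  proof -
    have cG: "c \<in> carrier G" using c cc by blast
    note sC = subgroup_centralizer [OF cG]
    have m: "c1 \<in> centralizer G c" "c2 \<in> centralizer G c" using c cc com by (auto simp: centralizer_iff)
    have Z: "center G \<subseteq> centralizer G c" using center_in_centralizer [OF _ cG] by blast
    show ?thesis
    proof
      fix w assume "w \<in> ?S4"
      then obtain v j where v: "v \<in> ?S3" "w = v \<otimes> c2 [^] (j::nat)" by (auto simp: adjoin_def)
      then obtain s i where s: "s \<in> center G" "v = s \<otimes> c1 [^] (i::nat)" by (auto simp: adjoin_def)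
      have "v \<in> centralizer G c"
        unfolding s(2) using subgroup.m_closed [OF sC] Z s(1) subgroup_nat_pow_closed [OF sC m(1)] by blast
      then show "w \<in> centralizer G c"
        unfolding v(2) using subgroup.m_closed [OF sC] subgroup_nat_pow_closed [OF sC m(2)] by blast
    qed
  qed
  \<comment> \<open>Otherwise the centralizer of \<open>c\<close> would contain \<open>g\<close>
    besides the subgroup of index \<open>p\<close>, hence be everything, and \<open>c\<close> would
    be central.\<close>
  have nc: "commutator G g c \<noteq> \<one>" if c: "c \<in> {c1, c2}" for c
  proof
    assume e: "commutator G g c = \<one>"
    have cG: "c \<in> carrier G" and cZ: "c \<notin> center G" using c cc c1 c2 by auto
    note sC = subgroup_centralizer [OF cG]
    have gC: "g \<in> centralizer G c" using e commutator_eq_one_iff [OF g(1) cG] g(1) by (simp add: centralizer_iff)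
    have "?S4 \<subset> centralizer G c" using S4abel [OF c] gC g(2) by blast
    then have "card ?S4 < card (centralizer G c)"
      by (rule psubset_card_mono [OF finite_subset_carrier [OF subgroup.subset [OF sC]]])
    moreover have "centralizer G c \<noteq> carrier G"
    proof
      assume e: "centralizer G c = carrier G"
      have "c \<in> center G" by (rule centerI [OF cG]) (use e in \<open>auto simp: centralizer_iff\<close>)
      then show False using cZ by simp
    qed
    then have "p * card (centralizer G c) \<le> p ^ n" by (rule card_strict_subgroup [OF sC])
    then have "p * card (centralizer G c) \<le> p * card ?S4" unfolding k4 n_eq_5 by (simp add: numeral_eq_Suc)
    ultimately show False using p_pos by simp
  qed
  \<comment> \<open>These commutators lie on the lines of \<open>x\<close> and \<open>y\<close> and
    replace them as generators of the center, which normalizes the commutator relations without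
    changing \<open>c1\<close>, \<open>c2\<close> or \<open>g\<close>.\<close>
  define z1 z2 where "z1 = commutator G g c1" and "z2 = commutator G g c2"
  have zx: "z1 \<in> powers G x" unfolding z1_def commutator_inv [OF g(1) cc(1)]
    by (rule subgroup.m_inv_closed [OF sx]) (use c1(1) g(1) in \<open>simp add: center_mod_def\<close>)
  have zy: "z2 \<in> powers G y" unfolding z2_def commutator_inv [OF g(1) cc(2)]
    by (rule subgroup.m_inv_closed [OF sy]) (use c2(1) g(1) in \<open>simp add: center_mod_def\<close>)
  have z1: "z1 \<noteq> \<one>" "z2 \<noteq> \<one>" unfolding z1_def z2_def using nc by auto
  have zZ: "z1 \<in> center G" "z2 \<in> center G" unfolding z1_def z2_def
    using commutator_in_derived g(1) cc center_eq_derived by auto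
  note zc = center_closed [OF zZ(1)] center_closed [OF zZ(2)]
  have "powers G z1 \<subseteq> powers G x" by (rule powers_in_subgroup [OF sx zx])
  then have z2n: "z2 \<notin> powers G z1" using powers_trivial_inter [OF xy(1,2,4) _ zy] z1(2) by blast
  have kz1: "card (powers G z1) = p" by (rule card_powers_prime [OF zc(1) exponent [OF zc(1)] z1(1)])
  note sz1 = subgroup_powers [OF finite_carrier zc(1)]
  let ?S2 = "adjoin G (adjoin G {\<one>} z1) z2"
  have S2: "?S2 = center G"
  proof (rule card_subset_eq [OF finite_subset_carrier [OF subgroup.subset [OF subgroup_center]]])
    have "z2 [^] p \<in> powers G z1" using exponent [OF zc(2)] subgroup.one_closed [OF sz1] by simp
    then show "card ?S2 = card (center G)"
      unfolding adjoin_one_eq_powers [OF zc(1)]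
      using card_adjoin [OF finite_carrier sz1 zc(2) z2n _ prime_p] kz1 card_center by simp
    show "?S2 \<subseteq> center G"
    proof
      fix w assume "w \<in> ?S2"
      then obtain v j where v: "v \<in> powers G z1" "w = v \<otimes> z2 [^] (j::nat)"
        unfolding adjoin_one_eq_powers [OF zc(1)] by (auto simp: adjoin_def)
      show "w \<in> center G"
        unfolding v(2) using powers_in_subgroup [OF subgroup_center zZ(1)] v(1) central_pow [OF zZ(2)]
          subgroup.m_closed [OF subgroup_center] by blast
    qed
  qed
  show ?thesis
    unfolding two_block_like_def
  proof (rule conjI, use order_G n_eq_5 in simp, rule exI [of _ z1], rule exI [of _ z2], rule exI [of _ c1],
      rule exI [of _ c2], rule exI [of _ g], unfold S2, intro conjI)
    show "\<forall>w\<in>{z1, z2, c1, c2, g}. w [^] p = \<one>"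
      by (intro ballI exponent) (use zc cc g(1) in \<open>elim insertE; simp\<close>)
    show "z2 \<notin> adjoin G {\<one>} z1" unfolding adjoin_one_eq_powers [OF zc(1)] by (rule z2n)
    show "z1 \<notin> {\<one>}" using z1(1) by simp
    show "derived G (carrier G) \<subseteq> center G" by (rule derived_central)
    show "commutator G g c1 = z1" "commutator G g c2 = z2" by (simp_all only: z1_def z2_def)
  qed (fact zZ cc g(1) c1(2) c23 g(2) com)+
qed

end


section \<open>Uniqueness\<close>

lemma (in group) adjoin_subsetI:
  assumes "subgroup W G" "S \<subseteq> W" "x \<in> W" shows "adjoin G S x \<subseteq> W"
proof
  fix w assume "w \<in> adjoin G S x"
  then obtain s i where w: "s \<in> S" "w = s \<otimes> x [^] (i::nat)" by (auto simp: adjoin_def)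
  then have "s \<in> W" using assms by blast
  then show "w \<in> W"
    unfolding w(2) using subgroup.m_closed [OF assms(1)] subgroup_nat_pow_closed [OF assms(1,3)] by simp
qed

locale p_group_pair = G: p_group G p n + H: p_group H p n
  for G :: "('a, 'm) monoid_scheme" (structure) and H :: "('b, 'k) monoid_scheme" and p n
begin

text \<open>A partial isomorphism. The map is a total function whose values outside \<open>S\<close>
  are irrelevant, so successive extensions are compared only on the smaller subgroup.\<close>

definition embedding :: "'a set \<Rightarrow> ('a \<Rightarrow> 'b) \<Rightarrow> bool" where
  "embedding S \<sigma> \<longleftrightarrow> subgroup S G \<and> \<sigma> \<in> hom (G\<lparr>carrier := S\<rparr>) H \<and> inj_on \<sigma> S"

lemma embedding_one: "embedding S \<sigma> \<Longrightarrow> \<sigma> \<one> = \<one>\<^bsub>H\<^esub>"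
proof -
  assume e: "embedding S \<sigma>"
  then interpret S: group "G\<lparr>carrier := S\<rparr>" by (intro G.subgroup_imp_group) (simp add: embedding_def)
  show ?thesis using hom_one [of \<sigma> "G\<lparr>carrier := S\<rparr>" H] e by (simp add: embedding_def S.is_group)
qed

lemma embedding_mult:
  "embedding S \<sigma> \<Longrightarrow> x \<in> S \<Longrightarrow> y \<in> S \<Longrightarrow> \<sigma> (x \<otimes> y) = \<sigma> x \<otimes>\<^bsub>H\<^esub> \<sigma> y"
  unfolding embedding_def using hom_mult [of \<sigma> "G\<lparr>carrier := S\<rparr>" H x y] by simp

lemma embedding_closed: "embedding S \<sigma> \<Longrightarrow> x \<in> S \<Longrightarrow> \<sigma> x \<in> carrier H"
  unfolding embedding_def using hom_in_carrier [of \<sigma> "G\<lparr>carrier := S\<rparr>" H x] by simp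

lemma embedding_trivial: "embedding {\<one>} (\<lambda>_. \<one>\<^bsub>H\<^esub>)"
  by (simp add: embedding_def G.triv_subgroup hom_def)

lemma embedding_extend:
  assumes e: "embedding S \<sigma>" and S: "S \<lhd> G"
    and x: "x \<in> carrier G" "x \<notin> S" "x [^] p = \<one>"
    and y: "y \<in> carrier H" "y \<notin> \<sigma> ` S" "y [^]\<^bsub>H\<^esub> p = \<one>\<^bsub>H\<^esub>"
    and conj: "\<And>s. s \<in> S \<Longrightarrow> \<sigma> (x \<otimes> s \<otimes> inv x) = y \<otimes>\<^bsub>H\<^esub> \<sigma> s \<otimes>\<^bsub>H\<^esub> inv\<^bsub>H\<^esub> y"
  obtains \<tau> where "embedding (adjoin G S x) \<tau>" "\<And>s. s \<in> S \<Longrightarrow> \<tau> s = \<sigma> s" "\<tau> x = y"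
    "\<tau> ` adjoin G S x = adjoin H (\<sigma> ` S) y"
proof -
  have h: "\<sigma> \<in> hom (G\<lparr>carrier := S\<rparr>) H" "inj_on \<sigma> S" using e by (auto simp: embedding_def)
  obtain \<tau> where \<tau>: "\<tau> \<in> hom (G\<lparr>carrier := adjoin G S x\<rparr>) H" "inj_on \<tau> (adjoin G S x)"
    "\<And>s. s \<in> S \<Longrightarrow> \<tau> s = \<sigma> s" "\<tau> x = y" "\<tau> ` adjoin G S x = adjoin H (\<sigma> ` S) y"
    using G.hom_extend_inj [OF G.finite_carrier H.is_group S x G.prime_p h y H.finite_carrier conj] by blast
  have "embedding (adjoin G S x) \<tau>"
    unfolding embedding_def using \<tau>(1,2) G.subgroup_adjoin [OF G.finite_carrier S x(1)] by blast
  then show thesis using that \<tau>(3-5) by blast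
qed

lemma conj_of_commute:
  assumes "group K" "x \<in> carrier K" "s \<in> carrier K" "x \<otimes>\<^bsub>K\<^esub> s = s \<otimes>\<^bsub>K\<^esub> x"
  shows "x \<otimes>\<^bsub>K\<^esub> s \<otimes>\<^bsub>K\<^esub> inv\<^bsub>K\<^esub> x = s"
proof -
  interpret K: group K by fact
  show ?thesis unfolding assms(4) using assms(2,3) by (simp add: K.m_assoc)
qed

lemma embedding_extend_commuting:
  assumes e: "embedding S \<sigma>" and S: "S \<lhd> G"
    and x: "x \<in> carrier G" "x \<notin> S" "x [^] p = \<one>"
    and y: "y \<in> carrier H" "y \<notin> \<sigma> ` S" "y [^]\<^bsub>H\<^esub> p = \<one>\<^bsub>H\<^esub>"
    and c: "S \<subseteq> centralizer G x" "\<sigma> ` S \<subseteq> centralizer H y"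
  obtains \<tau> where "embedding (adjoin G S x) \<tau>" "\<And>s. s \<in> S \<Longrightarrow> \<tau> s = \<sigma> s" "\<tau> x = y"
    "\<tau> ` adjoin G S x = adjoin H (\<sigma> ` S) y"
proof (rule embedding_extend [OF e S x y])
  fix s assume s: "s \<in> S"
  then have 1: "s \<in> centralizer G x" "\<sigma> s \<in> centralizer H y" using c by blast+
  have "x \<otimes> s \<otimes> inv x = s"
    by (rule conj_of_commute [OF G.is_group x(1)]) (use 1(1) in \<open>simp_all add: G.centralizer_iff\<close>)
  moreover have "y \<otimes>\<^bsub>H\<^esub> \<sigma> s \<otimes>\<^bsub>H\<^esub> inv\<^bsub>H\<^esub> y = \<sigma> s"
    by (rule conj_of_commute [OF H.is_group y(1)]) (use 1(2) in \<open>simp_all add: H.centralizer_iff\<close>)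
  ultimately show "\<sigma> (x \<otimes> s \<otimes> inv x) = y \<otimes>\<^bsub>H\<^esub> \<sigma> s \<otimes>\<^bsub>H\<^esub> inv\<^bsub>H\<^esub> y" by simp
qed (rule that)

text \<open>The condition for extending by \<open>g\<close> and \<open>h\<close> is closed under
  products, so it has to be checked only on generators of \<open>T\<close>.\<close>

lemma subgroup_conj_compatible:
  assumes e: "embedding T \<tau>" and T: "T \<lhd> G" and g: "g \<in> carrier G" and h: "h \<in> carrier H"
  shows "subgroup {w \<in> T. \<tau> (g \<otimes> w \<otimes> inv g) = h \<otimes>\<^bsub>H\<^esub> \<tau> w \<otimes>\<^bsub>H\<^esub> inv\<^bsub>H\<^esub> h} G" (is "subgroup ?W G")
proof -
  interpret T: normal T G by fact
  show ?thesis
  proof (rule G.finite_subgroupI [OF G.finite_carrier])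
    show "?W \<subseteq> carrier G" using T.subset by blast
    show "\<one> \<in> ?W" using T.one_closed g h embedding_one [OF e] by simp
    fix u v assume "u \<in> ?W" "v \<in> ?W"
    then have u: "u \<in> T" "\<tau> (g \<otimes> u \<otimes> inv g) = h \<otimes>\<^bsub>H\<^esub> \<tau> u \<otimes>\<^bsub>H\<^esub> inv\<^bsub>H\<^esub> h"
      and v: "v \<in> T" "\<tau> (g \<otimes> v \<otimes> inv g) = h \<otimes>\<^bsub>H\<^esub> \<tau> v \<otimes>\<^bsub>H\<^esub> inv\<^bsub>H\<^esub> h" by auto
    have uc: "u \<in> carrier G" "v \<in> carrier G" using u v T.subset by blast+
    note tc = embedding_closed [OF e u(1)] embedding_closed [OF e v(1)]
    have "g \<otimes> (u \<otimes> v) \<otimes> inv g = (g \<otimes> u \<otimes> inv g) \<otimes> (g \<otimes> v \<otimes> inv g)"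
      using g uc by (simp add: G.m_assoc)
    then have "\<tau> (g \<otimes> (u \<otimes> v) \<otimes> inv g) =
        (h \<otimes>\<^bsub>H\<^esub> \<tau> u \<otimes>\<^bsub>H\<^esub> inv\<^bsub>H\<^esub> h) \<otimes>\<^bsub>H\<^esub> (h \<otimes>\<^bsub>H\<^esub> \<tau> v \<otimes>\<^bsub>H\<^esub> inv\<^bsub>H\<^esub> h)"
      using embedding_mult [OF e T.inv_op_closed2 [OF g u(1)] T.inv_op_closed2 [OF g v(1)]] u(2) v(2) by simp
    also have "\<dots> = h \<otimes>\<^bsub>H\<^esub> \<tau> (u \<otimes> v) \<otimes>\<^bsub>H\<^esub> inv\<^bsub>H\<^esub> h"
      using h tc embedding_mult [OF e u(1) v(1)] by (simp add: H.m_assoc)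
    finally show "u \<otimes> v \<in> ?W" using T.m_closed [OF u(1) v(1)] by simp
  qed
qed

lemma conj_compatible_central:
  assumes e: "embedding T \<tau>" and w: "w \<in> T" "w \<in> center G" "\<tau> w \<in> center H"
    and g: "g \<in> carrier G" and h: "h \<in> carrier H"
  shows "\<tau> (g \<otimes> w \<otimes> inv g) = h \<otimes>\<^bsub>H\<^esub> \<tau> w \<otimes>\<^bsub>H\<^esub> inv\<^bsub>H\<^esub> h"
proof -
  have "g \<otimes> w \<otimes> inv g = w"
    by (rule conj_of_commute [OF G.is_group g G.center_closed [OF w(2)] G.center_comm [OF w(2) g]])
  moreover have "h \<otimes>\<^bsub>H\<^esub> \<tau> w \<otimes>\<^bsub>H\<^esub> inv\<^bsub>H\<^esub> h = \<tau> w"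
    by (rule conj_of_commute [OF H.is_group h H.center_closed [OF w(3)] H.center_comm [OF w(3) h]])
  ultimately show ?thesis by simp
qed

lemma conj_compatible_commutator:
  assumes e: "embedding T \<tau>" and w: "w \<in> T" "w \<in> carrier G" and cw: "commutator G g w \<in> T"
    and g: "g \<in> carrier G" and h: "h \<in> carrier H"
    and eq: "\<tau> (commutator G g w) = commutator H h (\<tau> w)"
  shows "\<tau> (g \<otimes> w \<otimes> inv g) = h \<otimes>\<^bsub>H\<^esub> \<tau> w \<otimes>\<^bsub>H\<^esub> inv\<^bsub>H\<^esub> h"
proof -
  have "g \<otimes> w \<otimes> inv g = commutator G g w \<otimes> w"
    using g w(2) by (simp add: commutator_def G.m_assoc)
  then have "\<tau> (g \<otimes> w \<otimes> inv g) = commutator H h (\<tau> w) \<otimes>\<^bsub>H\<^esub> \<tau> w"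
    using embedding_mult [OF e cw w(1)] eq by simp
  also have "\<dots> = h \<otimes>\<^bsub>H\<^esub> \<tau> w \<otimes>\<^bsub>H\<^esub> inv\<^bsub>H\<^esub> h"
    using h embedding_closed [OF e w(1)] by (simp add: commutator_def H.m_assoc)
  finally show ?thesis .
qed

lemma iso_of_embedding:
  assumes e: "embedding S \<sigma>" and S: "card S = p ^ n" shows "H \<cong> G"
proof -
  have cards: "card (carrier G) = p ^ n" "card (carrier H) = p ^ n"
    using G.order_G H.order_G by (simp_all add: order_def)
  have sS: "subgroup S G" using e by (simp add: embedding_def)
  have "S = carrier G"
    using card_subset_eq [OF G.finite_carrier subgroup.subset [OF sS]] S cards by simp
  then have h: "\<sigma> \<in> hom G H" "inj_on \<sigma> (carrier G)" using e by (simp_all add: embedding_def)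
  have "\<sigma> ` carrier G = carrier H"
  proof (rule card_subset_eq [OF H.finite_carrier])
    show "\<sigma> ` carrier G \<subseteq> carrier H" using hom_carrier [OF h(1)] .
    show "card (\<sigma> ` carrier G) = card (carrier H)" using card_image [OF h(2)] cards by simp
  qed
  then have "\<sigma> \<in> iso G H" using h by (simp add: iso_def bij_betw_def)
  then have "G \<cong> H" by (auto simp: is_iso_def)
  then show ?thesis by (rule G.iso_sym)
qed

text \<open>Both centers are vector spaces of equal dimension over the field with \<open>p\<close>
  elements. The map between the lines of \<open>z\<close> and \<open>z'\<close> is extended by
  adjoining independent elements on both sides until the centers are exhausted.\<close>

lemma embedding_center:
  assumes z: "z \<in> center G" "z \<noteq> \<one>" and z': "z' \<in> center H" "z' \<noteq> \<one>\<^bsub>H\<^esub>"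
    and G: "\<And>c. c \<in> center G \<Longrightarrow> c [^] p = \<one>" and H: "\<And>c. c \<in> center H \<Longrightarrow> c [^]\<^bsub>H\<^esub> p = \<one>\<^bsub>H\<^esub>"
    and card: "card (center G) = card (center H)"
  obtains \<sigma> where "embedding (center G) \<sigma>" "\<sigma> ` center G = center H" "\<sigma> z = z'"
proof -
  have finG: "finite (center G)" by (rule G.finite_subset_carrier [OF subgroup.subset [OF G.subgroup_center]])
  have finH: "finite (center H)" by (rule H.finite_subset_carrier [OF subgroup.subset [OF H.subgroup_center]])
  have step: "\<exists>\<tau>. embedding (adjoin G S x) \<tau> \<and> (\<forall>s\<in>S. \<tau> s = \<sigma> s) \<and> \<tau> x = y \<and>
      adjoin G S x \<subseteq> center G \<and> \<tau> ` adjoin G S x \<subseteq> center H \<and> card (adjoin G S x) = p * card S"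
    if e: "embedding S \<sigma>" and S: "S \<subseteq> center G" "\<sigma> ` S \<subseteq> center H"
      and x: "x \<in> center G" "x \<notin> S" and y: "y \<in> center H" "y \<notin> \<sigma> ` S" for S \<sigma> x y
  proof -
    have sS: "subgroup S G" using e by (simp add: embedding_def)
    note xc = G.center_closed [OF x(1)] and yc = H.center_closed [OF y(1)]
    have "S \<subseteq> centralizer G x" using S G.center_in_centralizer [OF _ xc] by blast
    moreover have "\<sigma> ` S \<subseteq> centralizer H y" using S H.center_in_centralizer [OF _ yc] by blast
    ultimately obtain \<tau> where \<tau>: "embedding (adjoin G S x) \<tau>" "\<And>s. s \<in> S \<Longrightarrow> \<tau> s = \<sigma> s" "\<tau> x = y"
        "\<tau> ` adjoin G S x = adjoin H (\<sigma> ` S) y"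
      using embedding_extend_commuting [OF e G.normal_of_central [OF sS S(1)] xc x(2) G [OF x(1)] yc y(2) H [OF y(1)]] by blast
    have "adjoin G S x \<subseteq> center G" by (rule G.adjoin_subsetI [OF G.subgroup_center S(1) x(1)])
    moreover have "\<tau> ` adjoin G S x \<subseteq> center H"
      unfolding \<tau>(4) by (rule H.adjoin_subsetI [OF H.subgroup_center S(2) y(1)])
    moreover have "card (adjoin G S x) = p * card S"
      by (rule G.card_adjoin [OF G.finite_carrier sS xc x(2) _ G.prime_p])
         (use G [OF x(1)] subgroup.one_closed [OF sS] in simp)
    ultimately show ?thesis using \<tau>(1-3) by blast
  qed
  have grow: "\<exists>\<tau>. embedding (center G) \<tau> \<and> \<tau> ` center G \<subseteq> center H \<and> \<tau> z = z'"
    if "embedding S \<sigma>" "S \<subseteq> center G" "\<sigma> ` S \<subseteq> center H" "z \<in> S" "\<sigma> z = z'" for S \<sigma>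
    using that
  proof (induction "card (center G) - card S" arbitrary: S \<sigma> rule: less_induct)
    case less
    show ?case
    proof (cases "S = center G")
      case True
      then show ?thesis using less.prems by blast
    next
      case False
      then obtain x where x: "x \<in> center G" "x \<notin> S" using less.prems(2) by blast
      have "S \<subset> center G" using False less.prems(2) by blast
      then have lt: "card S < card (center G)" by (rule psubset_card_mono [OF finG])
      have "inj_on \<sigma> S" using less.prems(1) by (simp add: embedding_def)
      then have "card (\<sigma> ` S) < card (center H)" using lt card by (simp add: card_image)
      then obtain y where y: "y \<in> center H" "y \<notin> \<sigma> ` S"
        using card_mono [OF finite_imageI [OF finite_subset [OF less.prems(2) finG]], of "center H" \<sigma>]
        by (metis leD subsetI)
      obtain \<tau> where \<tau>: "embedding (adjoin G S x) \<tau>" "\<And>s. s \<in> S \<Longrightarrow> \<tau> s = \<sigma> s"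
        "adjoin G S x \<subseteq> center G" "\<tau> ` adjoin G S x \<subseteq> center H" "card (adjoin G S x) = p * card S"
        using step [OF less.prems(1-3) x y] by blast
      have "card S > 0" using less.prems(4) finite_subset [OF less.prems(2) finG] by (metis card_gt_0_iff empty_iff)
      then have "card S < card (adjoin G S x)" using \<tau>(5) prime_gt_1_nat [OF G.prime_p] by simp
      then have d: "card (center G) - card (adjoin G S x) < card (center G) - card S" using lt by linarith
      have "S \<subseteq> carrier G" using less.prems(2) subgroup.subset [OF G.subgroup_center] by blast
      then have zA: "z \<in> adjoin G S x" using G.subset_adjoin less.prems(4) by blast
      show ?thesis
        by (rule less.hyps [OF d \<tau>(1,3,4) zA]) (use \<tau>(2) less.prems in simp)
    qed
  qed
  obtain \<sigma> where \<sigma>: "embedding (adjoin G {\<one>} z) \<sigma>" "\<sigma> z = z'"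
      "adjoin G {\<one>} z \<subseteq> center G" "\<sigma> ` adjoin G {\<one>} z \<subseteq> center H"
    using step [OF embedding_trivial, of z z'] z z' subgroup.one_closed [OF G.subgroup_center]
      subgroup.one_closed [OF H.subgroup_center] by auto
  obtain \<tau> where \<tau>: "embedding (center G) \<tau>" "\<tau> ` center G \<subseteq> center H" "\<tau> z = z'"
    using grow [OF \<sigma>(1,3,4) G.self_in_adjoin [OF _ G.center_closed [OF z(1)]] \<sigma>(2)] by blast
  have "card (\<tau> ` center G) = card (center H)"
    using \<tau>(1) card by (simp add: embedding_def card_image)
  then have "\<tau> ` center G = center H" by (rule card_subset_eq [OF finH \<tau>(2)])
  then show thesis using that \<tau> by blast
qed

text \<open>The centers are matched so that the chosen commutators correspond. This is exactly what
  makes conjugation by the second generator compatible once the first has been adjoined.\<close>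

theorem heisenberg_like_unique:
  assumes "heisenberg_like G p" "heisenberg_like H p" shows "H \<cong> G"
proof -
  \<comment> \<open>The names are exchanged relative to the definition: the second element of the
    pair is adjoined first.\<close>
  obtain b a where ab: "b \<in> carrier G" "a \<in> carrier G" "commutator G b a \<noteq> \<one>"
      "derived G (carrier G) \<subseteq> center G" "b [^] p = \<one>" "a [^] p = \<one>"
    and cG: "p * (p * card (center G)) = p ^ n" and eG: "\<And>c. c \<in> center G \<Longrightarrow> c [^] p = \<one>"
    using assms(1) unfolding heisenberg_like_def G.order_G by blast
  obtain b' a' where ab': "b' \<in> carrier H" "a' \<in> carrier H" "commutator H b' a' \<noteq> \<one>\<^bsub>H\<^esub>"
      "derived H (carrier H) \<subseteq> center H" "b' [^]\<^bsub>H\<^esub> p = \<one>\<^bsub>H\<^esub>" "a' [^]\<^bsub>H\<^esub> p = \<one>\<^bsub>H\<^esub>"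
    and cH: "p * (p * card (center H)) = p ^ n" and eH: "\<And>c. c \<in> center H \<Longrightarrow> c [^]\<^bsub>H\<^esub> p = \<one>\<^bsub>H\<^esub>"
    using assms(2) unfolding heisenberg_like_def H.order_G by blast
  have zG: "commutator G b a \<in> center G" using G.commutator_in_derived [OF ab(1,2)] ab(4) by blast
  have zH: "commutator H b' a' \<in> center H" using H.commutator_in_derived [OF ab'(1,2)] ab'(4) by blast
  have "p * (p * card (center G)) = p * (p * card (center H))" using cG cH by simp
  then have card: "card (center G) = card (center H)" using G.p_pos by simp
  obtain \<sigma> where \<sigma>: "embedding (center G) \<sigma>" "\<sigma> ` center G = center H" "\<sigma> (commutator G b a) = commutator H b' a'"
    using embedding_center [OF zG ab(3) zH ab'(3) eG eH card] by blast
  have nG: "b \<otimes> a \<noteq> a \<otimes> b" using ab(3) G.commutator_eq_one_iff [OF ab(1,2)] by simp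
  have nH: "b' \<otimes>\<^bsub>H\<^esub> a' \<noteq> a' \<otimes>\<^bsub>H\<^esub> b'" using ab'(3) H.commutator_eq_one_iff [OF ab'(1,2)] by simp
  have aZ: "a \<notin> center G" using nG G.center_comm [OF _ ab(1)] by blast
  have aZ': "a' \<notin> \<sigma> ` center G" unfolding \<sigma>(2) using nH H.center_comm [OF _ ab'(1)] by blast
  have nZ: "center G \<lhd> G" by (rule G.normal_of_central [OF G.subgroup_center subset_refl])
  have "center G \<subseteq> centralizer G a" using G.center_in_centralizer [OF _ ab(2)] by blast
  moreover have "\<sigma> ` center G \<subseteq> centralizer H a'" unfolding \<sigma>(2) using H.center_in_centralizer [OF _ ab'(2)] by blast
  ultimately obtain \<tau> where \<tau>: "embedding (adjoin G (center G) a) \<tau>" "\<And>s. s \<in> center G \<Longrightarrow> \<tau> s = \<sigma> s" "\<tau> a = a'"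
    "\<tau> ` adjoin G (center G) a = adjoin H (\<sigma> ` center G) a'"
    using embedding_extend_commuting [OF \<sigma>(1) nZ ab(2) aZ ab(6) ab'(2) aZ' ab'(6)] by blast
  let ?T = "adjoin G (center G) a"
  have sT: "subgroup ?T G" using \<tau>(1) by (simp add: embedding_def)
  have ZT: "center G \<subseteq> ?T" by (rule G.subset_adjoin [OF subgroup.subset [OF G.subgroup_center]])
  have aT: "a \<in> ?T" by (rule G.self_in_adjoin [OF subgroup.one_closed [OF G.subgroup_center] ab(2)])
  have nT: "?T \<lhd> G" by (rule G.normal_of_derived [OF sT]) (use ab(4) ZT in blast)
  have "?T \<subseteq> centralizer G a"
    by (rule G.adjoin_subsetI [OF G.subgroup_centralizer [OF ab(2)]])
       (use G.center_in_centralizer [OF _ ab(2)] ab(2) in \<open>auto simp: G.centralizer_iff\<close>)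
  then have bT: "b \<notin> ?T" using nG by (auto simp: G.centralizer_iff)
  have "\<tau> ` ?T \<subseteq> centralizer H a'"
    unfolding \<tau>(4) \<sigma>(2)
    by (rule H.adjoin_subsetI [OF H.subgroup_centralizer [OF ab'(2)]])
       (use H.center_in_centralizer [OF _ ab'(2)] ab'(2) in \<open>auto simp: H.centralizer_iff\<close>)
  then have bT': "b' \<notin> \<tau> ` ?T" using nH unfolding H.centralizer_iff subset_iff by blast
  let ?W = "{w \<in> ?T. \<tau> (b \<otimes> w \<otimes> inv b) = b' \<otimes>\<^bsub>H\<^esub> \<tau> w \<otimes>\<^bsub>H\<^esub> inv\<^bsub>H\<^esub> b'}"
  have "?T \<subseteq> ?W"
  proof (rule G.adjoin_subsetI [OF subgroup_conj_compatible [OF \<tau>(1) nT ab(1) ab'(1)]])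
    show "center G \<subseteq> ?W"
    proof
      fix w assume w: "w \<in> center G"
      have wT: "w \<in> ?T" using w ZT by blast
      have "\<tau> w \<in> center H" using \<tau>(2) [OF w] \<sigma>(2) w by auto
      then show "w \<in> ?W" using conj_compatible_central [OF \<tau>(1) wT w _ ab(1) ab'(1)] wT by blast
    qed
    have "\<tau> (commutator G b a) = commutator H b' (\<tau> a)" using \<tau>(2) [OF zG] \<sigma>(3) \<tau>(3) by simp
    then show "a \<in> ?W"
      using conj_compatible_commutator [OF \<tau>(1) aT ab(2) subsetD [OF ZT zG] ab(1) ab'(1)] aT by blast
  qed
  then have cj: "\<tau> (b \<otimes> s \<otimes> inv b) = b' \<otimes>\<^bsub>H\<^esub> \<tau> s \<otimes>\<^bsub>H\<^esub> inv\<^bsub>H\<^esub> b'" if "s \<in> ?T" for s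
    using that by blast
  obtain \<rho> where \<rho>: "embedding (adjoin G ?T b) \<rho>"
    by (rule embedding_extend [OF \<tau>(1) nT ab(1) bT ab(5) ab'(1) bT' ab'(5)]) (erule cj, rule that)
  have "card ?T = p * card (center G)"
    by (rule G.card_adjoin [OF G.finite_carrier G.subgroup_center ab(2) aZ _ G.prime_p])
       (use ab(6) subgroup.one_closed [OF G.subgroup_center] in simp)
  moreover have "card (adjoin G ?T b) = p * card ?T"
    by (rule G.card_adjoin [OF G.finite_carrier sT ab(1) bT _ G.prime_p])
       (use ab(5) subgroup.one_closed [OF sT] in simp)
  ultimately have "card (adjoin G ?T b) = p ^ n" using cG by simp
  then show ?thesis by (rule iso_of_embedding [OF \<rho>])
qed

text \<open>The first four generators span an abelian subgroup, so only orders and independence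
  matter for them. The last one acts through the two prescribed commutators.\<close>

theorem two_block_like_unique:
  assumes "two_block_like G p" "two_block_like H p" shows "H \<cong> G"
proof -
  let ?S1 = "\<lambda>z1. adjoin G {\<one>} z1" and ?T1 = "\<lambda>z1. adjoin H {\<one>\<^bsub>H\<^esub>} z1"
  obtain z1 z2 c1 c2 g where zZ: "z1 \<in> center G" "z2 \<in> center G" and cc: "c1 \<in> carrier G" "c2 \<in> carrier G" "g \<in> carrier G"
    and ex: "\<forall>x\<in>{z1, z2, c1, c2, g}. x [^] p = \<one>"
    and ni: "z1 \<notin> {\<one>}" "z2 \<notin> ?S1 z1" "c1 \<notin> adjoin G (?S1 z1) z2"
      "c2 \<notin> adjoin G (adjoin G (?S1 z1) z2) c1" "g \<notin> adjoin G (adjoin G (adjoin G (?S1 z1) z2) c1) c2"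
    and der: "derived G (carrier G) \<subseteq> adjoin G (?S1 z1) z2"
    and com: "c1 \<otimes> c2 = c2 \<otimes> c1" "commutator G g c1 = z1" "commutator G g c2 = z2"
    using assms(1) unfolding two_block_like_def by blast
  obtain z1' z2' c1' c2' g' where zZ': "z1' \<in> center H" "z2' \<in> center H" and cc': "c1' \<in> carrier H" "c2' \<in> carrier H" "g' \<in> carrier H"
    and ex': "\<forall>x\<in>{z1', z2', c1', c2', g'}. x [^]\<^bsub>H\<^esub> p = \<one>\<^bsub>H\<^esub>"
    and ni': "z1' \<notin> {\<one>\<^bsub>H\<^esub>}" "z2' \<notin> ?T1 z1'" "c1' \<notin> adjoin H (?T1 z1') z2'"
      "c2' \<notin> adjoin H (adjoin H (?T1 z1') z2') c1'" "g' \<notin> adjoin H (adjoin H (adjoin H (?T1 z1') z2') c1') c2'"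
    and com': "c1' \<otimes>\<^bsub>H\<^esub> c2' = c2' \<otimes>\<^bsub>H\<^esub> c1'" "commutator H g' c1' = z1'" "commutator H g' c2' = z2'"
    using assms(2) unfolding two_block_like_def by blast
  have n5: "p ^ n = p ^ 5" using assms(1) G.order_G by (simp add: two_block_like_def)
  have exG: "z1 [^] p = \<one>" "z2 [^] p = \<one>" "c1 [^] p = \<one>" "c2 [^] p = \<one>" "g [^] p = \<one>"
    using ex by simp_all
  have exH: "z1' [^]\<^bsub>H\<^esub> p = \<one>\<^bsub>H\<^esub>" "z2' [^]\<^bsub>H\<^esub> p = \<one>\<^bsub>H\<^esub>" "c1' [^]\<^bsub>H\<^esub> p = \<one>\<^bsub>H\<^esub>" "c2' [^]\<^bsub>H\<^esub> p = \<one>\<^bsub>H\<^esub>" "g' [^]\<^bsub>H\<^esub> p = \<one>\<^bsub>H\<^esub>"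
    using ex' by simp_all
  note zc = G.center_closed [OF zZ(1)] G.center_closed [OF zZ(2)]
  note zc' = H.center_closed [OF zZ'(1)] H.center_closed [OF zZ'(2)]
  define S1 S2 S3 S4 where "S1 = ?S1 z1" and "S2 = adjoin G S1 z2" and "S3 = adjoin G S2 c1" and "S4 = adjoin G S3 c2"
  define T1 T2 T3 T4 where "T1 = ?T1 z1'" and "T2 = adjoin H T1 z2'" and "T3 = adjoin H T2 c1'" and "T4 = adjoin H T3 c2'"
  note niG = ni [folded S1_def, folded S2_def, folded S3_def, folded S4_def]
  note niH = ni' [folded T1_def, folded T2_def, folded T3_def, folded T4_def]
  note derG = der [folded S1_def, folded S2_def]
  have oneG: "{\<one>} \<subseteq> center G" using subgroup.one_closed [OF G.subgroup_center] by simp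
  have oneH: "{\<one>\<^bsub>H\<^esub>} \<subseteq> center H" using subgroup.one_closed [OF H.subgroup_center] by simp
  have S1Z: "S1 \<subseteq> center G" unfolding S1_def by (rule G.adjoin_subsetI [OF G.subgroup_center oneG zZ(1)])
  have S2Z: "S2 \<subseteq> center G" unfolding S2_def by (rule G.adjoin_subsetI [OF G.subgroup_center S1Z zZ(2)])
  have T1Z: "T1 \<subseteq> center H" unfolding T1_def by (rule H.adjoin_subsetI [OF H.subgroup_center oneH zZ'(1)])
  have T2Z: "T2 \<subseteq> center H" unfolding T2_def by (rule H.adjoin_subsetI [OF H.subgroup_center T1Z zZ'(2)])
  have centG: "S \<subseteq> centralizer G x" if "S \<subseteq> center G" "x \<in> carrier G" for S x
    using that G.center_in_centralizer by blast
  have centH: "S \<subseteq> centralizer H x" if "S \<subseteq> center H" "x \<in> carrier H" for S x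
    using that H.center_in_centralizer by blast
  have im0: "(\<lambda>_. \<one>\<^bsub>H\<^esub>) ` {\<one>} = {\<one>\<^bsub>H\<^esub>}" by simp
  obtain s1 where s1: "embedding S1 s1" "s1 z1 = z1'" "s1 ` S1 = T1"
    using embedding_extend_commuting [OF embedding_trivial G.one_is_normal zc(1) niG(1) exG(1) zc'(1) niH(1) [folded im0]
        exH(1) centG [OF oneG zc(1)] centH [OF oneH zc'(1), folded im0]]
    unfolding S1_def T1_def im0 by blast
  have sub1: "subgroup S1 G" using s1 by (simp add: embedding_def)
  obtain s2 where s2: "embedding S2 s2" "\<And>s. s \<in> S1 \<Longrightarrow> s2 s = s1 s" "s2 z2 = z2'" "s2 ` S2 = T2"
    using embedding_extend_commuting [OF s1(1) G.normal_of_central [OF sub1 S1Z] zc(2) niG(2) exG(2) zc'(2) niH(2) [folded s1(3)]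
        exH(2) centG [OF S1Z zc(2)] centH [OF T1Z zc'(2), folded s1(3)]]
    unfolding S2_def T2_def s1(3) by blast
  have sub2: "subgroup S2 G" using s2 by (simp add: embedding_def)
  obtain s3 where s3: "embedding S3 s3" "\<And>s. s \<in> S2 \<Longrightarrow> s3 s = s2 s" "s3 c1 = c1'" "s3 ` S3 = T3"
    using embedding_extend_commuting [OF s2(1) G.normal_of_central [OF sub2 S2Z] cc(1) niG(3) exG(3) cc'(1) niH(3) [folded s2(4)]
        exH(3) centG [OF S2Z cc(1)] centH [OF T2Z cc'(1), folded s2(4)]]
    unfolding S3_def T3_def s2(4) by blast
  have sub3: "subgroup S3 G" using s3 by (simp add: embedding_def)
  have S23: "S2 \<subseteq> S3" unfolding S3_def by (rule G.subset_adjoin [OF subgroup.subset [OF sub2]])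
  have n3: "S3 \<lhd> G" by (rule G.normal_of_derived [OF sub3]) (use derG S23 in blast)
  have c3: "S3 \<subseteq> centralizer G c2" unfolding S3_def
    by (rule G.adjoin_subsetI [OF G.subgroup_centralizer [OF cc(2)] centG [OF S2Z cc(2)]])
       (use com(1) cc in \<open>simp add: G.centralizer_iff\<close>)
  have c3': "T3 \<subseteq> centralizer H c2'" unfolding T3_def
    by (rule H.adjoin_subsetI [OF H.subgroup_centralizer [OF cc'(2)] centH [OF T2Z cc'(2)]])
       (use com'(1) cc' in \<open>simp add: H.centralizer_iff\<close>)
  obtain s4 where s4: "embedding S4 s4" "\<And>s. s \<in> S3 \<Longrightarrow> s4 s = s3 s" "s4 c2 = c2'" "s4 ` S4 = T4"
    using embedding_extend_commuting [OF s3(1) n3 cc(2) niG(4) exG(4) cc'(2) niH(4) [folded s3(4)]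
        exH(4) c3 c3' [folded s3(4)]]
    unfolding S4_def T4_def s3(4) by blast
  have sub4: "subgroup S4 G" using s4 by (simp add: embedding_def)
  have S34: "S3 \<subseteq> S4" unfolding S4_def by (rule G.subset_adjoin [OF subgroup.subset [OF sub3]])
  have n4: "S4 \<lhd> G" by (rule G.normal_of_derived [OF sub4]) (use derG S23 S34 in blast)
  have mem: "z1 \<in> S2" "z2 \<in> S2" "c1 \<in> S3" "c2 \<in> S4"
  proof -
    have "z1 \<in> S1" unfolding S1_def by (rule G.self_in_adjoin [OF _ zc(1)]) simp
    then show "z1 \<in> S2" unfolding S2_def using G.subset_adjoin [OF subgroup.subset [OF sub1]] by blast
    show "z2 \<in> S2" unfolding S2_def by (rule G.self_in_adjoin [OF subgroup.one_closed [OF sub1] zc(2)])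
    show "c1 \<in> S3" unfolding S3_def by (rule G.self_in_adjoin [OF subgroup.one_closed [OF sub2] cc(1)])
    show "c2 \<in> S4" unfolding S4_def by (rule G.self_in_adjoin [OF subgroup.one_closed [OF sub3] cc(2)])
  qed
  have z1S1: "z1 \<in> S1" unfolding S1_def by (rule G.self_in_adjoin [OF _ zc(1)]) simp
  have S2e: "s4 s = s2 s" if "s \<in> S2" for s
    using s4(2) [of s] s3(2) [OF that] S23 that by (metis subsetD)
  have v: "s4 z1 = z1'" "s4 z2 = z2'" "s4 c1 = c1'"
    using S2e [OF mem(1)] s2(2) [OF z1S1] s1(2) S2e [OF mem(2)] s2(3) s4(2) [OF mem(3)] s3(3) by simp_all
  \<comment> \<open>Compatibility with conjugation by the last generator is checked on the central
    part and on \<open>c1\<close> and \<open>c2\<close>.\<close>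
  let ?W = "{w \<in> S4. s4 (g \<otimes> w \<otimes> inv g) = g' \<otimes>\<^bsub>H\<^esub> s4 w \<otimes>\<^bsub>H\<^esub> inv\<^bsub>H\<^esub> g'}"
  note sW = subgroup_conj_compatible [OF s4(1) n4 cc(3) cc'(3)]
  have W2: "S2 \<subseteq> ?W"
  proof
    fix w assume w: "w \<in> S2"
    have wS: "w \<in> S4" and wZ: "w \<in> center G" using w S23 S34 S2Z by blast+
    have "s4 w \<in> T2" using S2e [OF w] s2(4) w by auto
    then have "s4 w \<in> center H" using T2Z by blast
    then show "w \<in> ?W" using conj_compatible_central [OF s4(1) wS wZ _ cc(3) cc'(3)] wS by blast
  qed
  have zS4: "z1 \<in> S4" "z2 \<in> S4" "c1 \<in> S4" using mem S23 S34 by blast+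
  have W3: "S3 \<subseteq> ?W" unfolding S3_def
  proof (rule G.adjoin_subsetI [OF sW W2])
    have 1: "commutator G g c1 \<in> S4" using zS4 com by simp
    have 2: "s4 (commutator G g c1) = commutator H g' (s4 c1)" using v com com' by simp
    show "c1 \<in> ?W" using conj_compatible_commutator [OF s4(1) zS4(3) cc(1) 1 cc(3) cc'(3) 2] zS4 by blast
  qed
  have "S4 \<subseteq> ?W"
  proof -
    have 1: "commutator G g c2 \<in> S4" using zS4 com by simp
    have 2: "s4 (commutator G g c2) = commutator H g' (s4 c2)" using v com com' s4(3) by simp
    have "c2 \<in> ?W" using conj_compatible_commutator [OF s4(1) mem(4) cc(2) 1 cc(3) cc'(3) 2] mem by blast
    then have "adjoin G S3 c2 \<subseteq> ?W" by (rule G.adjoin_subsetI [OF sW W3])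
    then show ?thesis by (simp only: S4_def [symmetric])
  qed
  then have cj: "s4 (g \<otimes> s \<otimes> inv g) = g' \<otimes>\<^bsub>H\<^esub> s4 s \<otimes>\<^bsub>H\<^esub> inv\<^bsub>H\<^esub> g'" if "s \<in> S4" for s
    using that by blast
  obtain s5 where s5: "embedding (adjoin G S4 g) s5"
    by (rule embedding_extend [OF s4(1) n4 cc(3) niG(5) exG(5) cc'(3) niH(5) [folded s4(4)] exH(5)])
       (erule cj, rule that)
  have cd: "card (adjoin G S x) = p * card S" if "subgroup S G" "x \<in> carrier G" "x \<notin> S" "x [^] p = \<one>" for S x
    by (rule G.card_adjoin [OF G.finite_carrier that(1-3) _ G.prime_p]) (use that subgroup.one_closed in metis)
  have "card (adjoin G S4 g) = p ^ n"
    unfolding cd [OF sub4 cc(3) niG(5) exG(5)]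
    unfolding S4_def cd [OF sub3 cc(2) niG(4) exG(4)]
    unfolding S3_def cd [OF sub2 cc(1) niG(3) exG(3)]
    unfolding S2_def cd [OF sub1 zc(2) niG(2) exG(2)]
    unfolding S1_def cd [OF G.triv_subgroup zc(1) niG(1) exG(1)] n5 by (simp add: numeral_eq_Suc)
  then show ?thesis by (rule iso_of_embedding [OF s5])
qed

end


section \<open>Group algebras\<close>

abbreviation group_algebra :: "('a, 'm) monoid_scheme \<Rightarrow> (complex, 'a \<Rightarrow> complex) module" where
  "group_algebra G \<equiv> twisted_group_algebra G (\<lambda>q\<in>carrier G \<times> carrier G. 1)"

definition basis_elt :: "('a, 'm) monoid_scheme \<Rightarrow> 'a \<Rightarrow> ('a \<Rightarrow> complex)" where
  "basis_elt G g = (\<lambda>k\<in>carrier G. if k = g then 1 else 0)"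

definition extend_linearly :: "('a, 'm) monoid_scheme \<Rightarrow> ('a \<Rightarrow> complex) \<Rightarrow> ('a \<Rightarrow> complex) \<Rightarrow> complex" where
  "extend_linearly G \<chi> x = (\<Sum>g\<in>carrier G. x g * \<chi> g)"

lemma group_algebra_simps:
  "carrier (group_algebra G) = carrier G \<rightarrow>\<^sub>E UNIV"
  "x \<oplus>\<^bsub>group_algebra G\<^esub> y = (\<lambda>k\<in>carrier G. x k + y k)"
  "c \<odot>\<^bsub>group_algebra G\<^esub> x = (\<lambda>k\<in>carrier G. c * x k)"
  by (simp_all add: twisted_group_algebra_def)

lemma basis_elt_closed [simp]: "basis_elt G g \<in> carrier (group_algebra G)"
  by (simp add: group_algebra_simps basis_elt_def)

lemma group_algebra_one:
  "group G \<Longrightarrow> \<one>\<^bsub>group_algebra G\<^esub> = basis_elt G \<one>\<^bsub>G\<^esub>"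
  by (auto simp: twisted_group_algebra_def basis_elt_def group.is_monoid monoid.one_closed)

lemma basis_elt_mult:
  assumes "group G" "finite (carrier G)" "g \<in> carrier G" "h \<in> carrier G"
  shows "basis_elt G g \<otimes>\<^bsub>group_algebra G\<^esub> basis_elt G h = basis_elt G (g \<otimes>\<^bsub>G\<^esub> h)"
  unfolding basis_elt_def twisted_group_algebra_basis_mult [OF assms]
  using assms(3,4) by (auto simp: twisted_group_algebra_def)

lemma extend_linearly_basis:
  "finite (carrier G) \<Longrightarrow> g \<in> carrier G \<Longrightarrow> extend_linearly G \<chi> (basis_elt G g) = \<chi> g"
  by (simp add: extend_linearly_def basis_elt_def if_distrib [of "\<lambda>t. t * _"] cong: if_cong)

lemma extend_linearly_add:
  "extend_linearly G \<chi> (x \<oplus>\<^bsub>group_algebra G\<^esub> y) = extend_linearly G \<chi> x + extend_linearly G \<chi> y"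
  by (simp add: extend_linearly_def group_algebra_simps ring_distribs sum.distrib)

lemma extend_linearly_smult:
  "extend_linearly G \<chi> (c \<odot>\<^bsub>group_algebra G\<^esub> x) = c * extend_linearly G \<chi> x"
  by (simp add: extend_linearly_def group_algebra_simps sum_distrib_left mult.assoc)

lemma extend_linearly_mult:
  assumes "group G" and fin: "finite (carrier G)"
    and \<chi>: "\<And>g h. g \<in> carrier G \<Longrightarrow> h \<in> carrier G \<Longrightarrow> \<chi> (g \<otimes>\<^bsub>G\<^esub> h) = \<chi> g * \<chi> h"
  shows "extend_linearly G \<chi> (x \<otimes>\<^bsub>group_algebra G\<^esub> y) = extend_linearly G \<chi> x * extend_linearly G \<chi> y"
proof -
  interpret group G by fact
  let ?C = "carrier G"
  have "extend_linearly G \<chi> (x \<otimes>\<^bsub>group_algebra G\<^esub> y) =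
      (\<Sum>k\<in>?C. \<Sum>q\<in>{q \<in> ?C \<times> ?C. fst q \<otimes>\<^bsub>G\<^esub> snd q = k}. x (fst q) * \<chi> (fst q) * (y (snd q) * \<chi> (snd q)))"
    unfolding extend_linearly_def
  proof (rule sum.cong [OF refl])
    fix k assume k: "k \<in> ?C"
    have "(x \<otimes>\<^bsub>group_algebra G\<^esub> y) k * \<chi> k =
        (\<Sum>(g, h)\<in>{(g, h). g \<in> ?C \<and> h \<in> ?C \<and> g \<otimes>\<^bsub>G\<^esub> h = k}.
          x g * y h * (\<lambda>q\<in>?C \<times> ?C. 1) (g, h)) * \<chi> k"
      using k by (simp add: twisted_group_algebra_def)
    also have "\<dots> = (\<Sum>q\<in>{q \<in> ?C \<times> ?C. fst q \<otimes>\<^bsub>G\<^esub> snd q = k}. x (fst q) * \<chi> (fst q) * (y (snd q) * \<chi> (snd q)))"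
      unfolding sum_distrib_right by (rule sum.cong) (auto simp: \<chi>)
    finally show "(x \<otimes>\<^bsub>group_algebra G\<^esub> y) k * \<chi> k =
      (\<Sum>q\<in>{q \<in> ?C \<times> ?C. fst q \<otimes>\<^bsub>G\<^esub> snd q = k}. x (fst q) * \<chi> (fst q) * (y (snd q) * \<chi> (snd q)))" .
  qed
  also have "\<dots> = (\<Sum>q\<in>?C \<times> ?C. x (fst q) * \<chi> (fst q) * (y (snd q) * \<chi> (snd q)))"
    by (rule sum.group) (use fin in auto)
  also have "\<dots> = extend_linearly G \<chi> x * extend_linearly G \<chi> y"
    unfolding extend_linearly_def sum_product sum.cartesian_product by (simp add: case_prod_unfold)
  finally show ?thesis .
qed

lemma linear_functionals_eqI:
  assumes fin: "finite (carrier G)" and x: "x \<in> carrier (group_algebra G)"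
    and add: "\<And>x y. x \<in> carrier (group_algebra G) \<Longrightarrow> y \<in> carrier (group_algebra G) \<Longrightarrow>
      F (x \<oplus>\<^bsub>group_algebra G\<^esub> y) = F x + F y \<and> F' (x \<oplus>\<^bsub>group_algebra G\<^esub> y) = F' x + (F' y :: complex)"
    and smult: "\<And>c x. x \<in> carrier (group_algebra G) \<Longrightarrow>
      F (c \<odot>\<^bsub>group_algebra G\<^esub> x) = c * F x \<and> F' (c \<odot>\<^bsub>group_algebra G\<^esub> x) = c * F' x"
    and basis: "\<And>g. g \<in> carrier G \<Longrightarrow> F (basis_elt G g) = F' (basis_elt G g)"
  shows "F x = F' x"
proof -
  let ?r = "\<lambda>S. \<lambda>k\<in>carrier G. if k \<in> S then x k else 0"
  have "F (?r S) = F' (?r S)" if "S \<subseteq> carrier G" for S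
    using finite_subset [OF that fin] that
  proof (induction S rule: finite_induct)
    case empty
    \<comment> \<open>The zero vector is written as a scalar multiple of an arbitrary basis
      function, so that homogeneity alone gives its value.\<close>
    have "?r {} = 0 \<odot>\<^bsub>group_algebra G\<^esub> basis_elt G undefined"
      by (simp add: group_algebra_simps)
    then show ?case using smult [of "basis_elt G undefined" 0] by simp
  next
    case (insert g S)
    have IH: "F (?r S) = F' (?r S)" and g: "g \<in> carrier G" using insert.IH insert.prems by blast+
    have eq: "?r (insert g S) = ?r S \<oplus>\<^bsub>group_algebra G\<^esub> (x g \<odot>\<^bsub>group_algebra G\<^esub> basis_elt G g)"
      using insert.hyps(2) by (auto simp: group_algebra_simps basis_elt_def)
    have c: "?r S \<in> carrier (group_algebra G)" "x g \<odot>\<^bsub>group_algebra G\<^esub> basis_elt G g \<in> carrier (group_algebra G)"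
      by (simp_all add: group_algebra_simps)
    show ?case
      unfolding eq add [OF c, THEN conjunct1] add [OF c, THEN conjunct2] IH
        smult [OF basis_elt_closed, THEN conjunct1] smult [OF basis_elt_closed, THEN conjunct2] basis [OF g] ..
  qed
  from this [OF subset_refl] show ?thesis
  proof -
    have "?r (carrier G) = x"
      by (rule extensionalityI [of _ "carrier G"]) (use x in \<open>auto simp: group_algebra_simps PiE_iff\<close>)
    then show "F (?r (carrier G)) = F' (?r (carrier G)) \<Longrightarrow> F x = F' x" by simp
  qed
qed

text \<open>Equality of the orders of the derived subgroups comes from two inequalities, and this
  reversal provides the second.\<close>

lemma algebra_isomorphic_sym:
  assumes "group G" "finite (carrier G)" and "algebra_isomorphic (group_algebra G) B"
  shows "algebra_isomorphic B (group_algebra G)"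
proof -
  let ?A = "group_algebra G"
  interpret group G by fact
  have "(\<lambda>q\<in>carrier G \<times> carrier G. 1) \<in> cocycles2 G" by (rule cocycles2I) auto
  then have R: "ring ?A" by (rule ring_twisted_group_algebra [OF assms(1,2)])
  obtain \<phi> where \<phi>: "\<phi> \<in> ring_iso ?A B" and s: "\<And>c x. x \<in> carrier ?A \<Longrightarrow> \<phi> (c \<odot>\<^bsub>?A\<^esub> x) = c \<odot>\<^bsub>B\<^esub> \<phi> x"
    using assms(3) unfolding algebra_isomorphic_def by blast
  let ?\<psi> = "inv_into (carrier ?A) \<phi>"
  have bij: "bij_betw \<phi> (carrier ?A) (carrier B)" using \<phi> by (simp add: ring_iso_def)
  have "?\<psi> (c \<odot>\<^bsub>B\<^esub> y) = c \<odot>\<^bsub>?A\<^esub> ?\<psi> y" if y: "y \<in> carrier B" for c y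
  proof -
    have x: "?\<psi> y \<in> carrier ?A" "\<phi> (?\<psi> y) = y"
      using bij_betw_inv_into_right [OF bij y] bij_betwE [OF bij_betw_inv_into [OF bij]] y by auto
    have "c \<odot>\<^bsub>?A\<^esub> ?\<psi> y \<in> carrier ?A" by (simp add: group_algebra_simps)
    from bij_betw_inv_into_left [OF bij this] show ?thesis unfolding s [OF x(1)] x(2) .
  qed
  then show ?thesis
    unfolding algebra_isomorphic_def using ring_iso_set_sym [OF R \<phi>] by blast
qed

text \<open>A character of \<open>H\<close> is an algebra homomorphism \<open>\<complex>H \<rightarrow> \<complex>\<close>; composing it with an isomorphism
  \<open>\<complex>G \<cong> \<complex>H\<close> gives a character of \<open>G\<close>.\<close>

lemma card_chars_le:
  fixes G :: "('a, 'm) monoid_scheme" and H :: "('b, 'k) monoid_scheme"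
  assumes G: "group G" "finite (carrier G)" and H: "group H" "finite (carrier H)"
    and iso: "algebra_isomorphic (group_algebra G) (group_algebra H)"
    and finX: "finite (chars G (derived G (carrier G)) (carrier G))"
  shows "card (chars H (derived H (carrier H)) (carrier H)) \<le> card (chars G (derived G (carrier G)) (carrier G))"
proof -
  interpret G: group G by (rule G(1))
  interpret H: group H by (rule H(1))
  let ?A = "group_algebra G" and ?B = "group_algebra H"
  let ?XG = "chars G (derived G (carrier G)) (carrier G)" and ?XH = "chars H (derived H (carrier H)) (carrier H)"
  obtain \<phi> where \<phi>: "\<phi> \<in> ring_iso ?A ?B" and s: "\<And>c x. x \<in> carrier ?A \<Longrightarrow> \<phi> (c \<odot>\<^bsub>?A\<^esub> x) = c \<odot>\<^bsub>?B\<^esub> \<phi> x"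
    using iso unfolding algebra_isomorphic_def by blast
  have hom: "\<phi> \<in> ring_hom ?A ?B" and bij: "bij_betw \<phi> (carrier ?A) (carrier ?B)"
    using \<phi> by (simp_all add: ring_iso_def)
  define \<Phi> where "\<Phi> \<chi> = (\<lambda>g\<in>carrier G. extend_linearly H \<chi> (\<phi> (basis_elt G g)))" for \<chi>
  have mult: "\<chi> (g \<otimes>\<^bsub>H\<^esub> h) = \<chi> g * \<chi> h" if "\<chi> \<in> ?XH" "g \<in> carrier H" "h \<in> carrier H" for \<chi> g h
    using that hom_mult [of \<chi> "H\<lparr>carrier := carrier H\<rparr>" complex_units g h] by (simp add: chars_def)
  have nonzero: "\<chi> g \<noteq> 0" if "\<chi> \<in> ?XH" "g \<in> carrier H" for \<chi> g
    using that hom_in_carrier [of \<chi> "H\<lparr>carrier := carrier H\<rparr>" complex_units g] by (simp add: chars_def)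
  have "\<Phi> \<chi> \<in> ?XG" if \<chi>: "\<chi> \<in> ?XH" for \<chi>
  proof -
    have m: "\<Phi> \<chi> (g \<otimes>\<^bsub>G\<^esub> h) = \<Phi> \<chi> g * \<Phi> \<chi> h" if gh: "g \<in> carrier G" "h \<in> carrier G" for g h
    proof -
      have "\<phi> (basis_elt G (g \<otimes>\<^bsub>G\<^esub> h)) = \<phi> (basis_elt G g) \<otimes>\<^bsub>?B\<^esub> \<phi> (basis_elt G h)"
        unfolding basis_elt_mult [OF G gh, symmetric] by (rule ring_hom_mult [OF hom]) simp_all
      then show ?thesis
        using gh extend_linearly_mult [OF H mult [OF \<chi>]] by (simp add: \<Phi>_def)
    qed
    have "\<chi> \<one>\<^bsub>H\<^esub> = 1" using mult [OF \<chi> H.one_closed H.one_closed] nonzero [OF \<chi> H.one_closed] by simp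
    moreover have "\<phi> (basis_elt G \<one>\<^bsub>G\<^esub>) = basis_elt H \<one>\<^bsub>H\<^esub>"
      using ring_hom_one [OF hom] by (simp add: group_algebra_one G H)
    ultimately have one: "\<Phi> \<chi> \<one>\<^bsub>G\<^esub> = 1" by (simp add: \<Phi>_def extend_linearly_basis H)
    have nz: "\<Phi> \<chi> g \<noteq> 0" if g: "g \<in> carrier G" for g
    proof -
      have "\<Phi> \<chi> g * \<Phi> \<chi> (inv\<^bsub>G\<^esub> g) = 1" using m [OF g G.inv_closed [OF g]] g one by simp
      then show ?thesis by (metis mult_zero_left zero_neq_one)
    qed
    have "\<Phi> \<chi> w = 1" if "w \<in> derived G (carrier G)" for w
      using G(2) nz m that by (rule G.multiplicative_trivial_on_derived)
    moreover have "\<Phi> \<chi> \<in> hom (G\<lparr>carrier := carrier G\<rparr>) complex_units"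
      by (rule homI) (use nz m in simp_all)
    moreover have "\<Phi> \<chi> \<in> extensional (carrier G)" by (simp add: \<Phi>_def)
    ultimately show ?thesis by (simp add: chars_def)
  qed
  moreover have "inj_on \<Phi> ?XH"
  proof (rule inj_onI)
    fix \<chi> \<chi>' assume c: "\<chi> \<in> ?XH" "\<chi>' \<in> ?XH" and e: "\<Phi> \<chi> = \<Phi> \<chi>'"
    show "\<chi> = \<chi>'"
    proof (rule extensionalityI [of _ "carrier H"])
      show "\<chi> \<in> extensional (carrier H)" "\<chi>' \<in> extensional (carrier H)" using c by (simp_all add: chars_def)
      fix h assume h: "h \<in> carrier H"
      \<comment> \<open>Surjectivity of \<open>\<phi>\<close>: two linear functionals that agree on
        the images of the basis of the group algebra of \<open>G\<close> agree everywhere.\<close>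
      have "basis_elt H h \<in> \<phi> ` carrier ?A"
        unfolding bij_betw_imp_surj_on [OF bij] by (rule basis_elt_closed)
      then obtain x where x: "x \<in> carrier ?A" "\<phi> x = basis_elt H h" by (elim imageE) simp
      have "extend_linearly H \<chi> (\<phi> x) = extend_linearly H \<chi>' (\<phi> x)"
      proof (rule linear_functionals_eqI [OF G(2) x(1)])
        fix g assume "g \<in> carrier G"
        then show "extend_linearly H \<chi> (\<phi> (basis_elt G g)) = extend_linearly H \<chi>' (\<phi> (basis_elt G g))"
          using fun_cong [OF e, of g] by (simp add: \<Phi>_def)
      qed (simp_all only: ring_hom_add [OF hom] s extend_linearly_add extend_linearly_smult simp_thms)
      then show "\<chi> h = \<chi>' h" unfolding x(2) extend_linearly_basis [OF H(2) h] .
    qed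
  qed
  ultimately show ?thesis using finX by (intro card_inj_on_le [of \<Phi>]) auto
qed

text \<open>The number of characters is the index of the derived subgroup, so fewer characters mean
  a larger derived subgroup.\<close>

lemma card_derived_le:
  assumes "p_group G p n" "p_group H p n" and iso: "algebra_isomorphic (group_algebra G) (group_algebra H)"
  shows "card (derived G (carrier G)) \<le> card (derived H (carrier H))"
proof -
  interpret G: p_group G p n by fact
  interpret H: p_group H p n by fact
  note cG = G.card_chars [OF G.subgroup_derived subset_refl] and cH = H.card_chars [OF H.subgroup_derived subset_refl]
  let ?x = "card (chars G (derived G (carrier G)) (carrier G))" and ?y = "card (chars H (derived H (carrier H)) (carrier H))"
  have "?y \<le> ?x"
    using cG by (intro card_chars_le [OF G.is_group G.finite_carrier H.is_group H.finite_carrier iso]) simp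
  have "?y > 0" using cH H.p_pos by (intro gr0I) simp
  have "?y * card (derived G (carrier G)) \<le> ?x * card (derived G (carrier G))" using \<open>?y \<le> ?x\<close> by simp
  also have "\<dots> = ?y * card (derived H (carrier H))" using cG cH by simp
  finally show ?thesis using \<open>?y > 0\<close> by simp
qed

lemma trivial_cocycle_in_one:
  assumes "group G" shows "(\<lambda>q\<in>carrier G \<times> carrier G. 1) \<in> \<one>\<^bsub>H2 G\<^esub>"
proof -
  interpret group G by fact
  have "coboundary G (\<lambda>g\<in>carrier G. 1) = (\<lambda>q\<in>carrier G \<times> carrier G. 1)"
    by (auto simp: coboundary_def)
  moreover have "(\<lambda>g\<in>carrier G. 1) \<in> carrier (cochains1 G)" by (simp add: cochains1_def)
  ultimately show ?thesis unfolding H2_def one_FactGroup coboundaries2_def by (metis imageI)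
qed

text \<open>The isomorphism of multipliers maps the trivial class to the trivial class, and the
  constant cocycle 1 represents both.\<close>

lemma twist_isomorphic_imp_group_algebras:
  assumes "group G" "group H" "twist_isomorphic G H"
  shows "algebra_isomorphic (group_algebra G) (group_algebra H)" "order (H2 H) = order (H2 G)"
proof -
  interpret HG: comm_group "H2 G" by (rule comm_group_H2 [OF assms(1)])
  interpret HH: comm_group "H2 H" by (rule comm_group_H2 [OF assms(2)])
  obtain \<psi> where \<psi>: "\<psi> \<in> iso (H2 G) (H2 H)"
    and tw: "\<And>c \<alpha> \<beta>. c \<in> carrier (H2 G) \<Longrightarrow> \<alpha> \<in> c \<Longrightarrow> \<beta> \<in> \<psi> c \<Longrightarrow>
      algebra_isomorphic (twisted_group_algebra G \<alpha>) (twisted_group_algebra H \<beta>)"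
    using assms(3) unfolding twist_isomorphic_def by blast
  have "\<psi> \<one>\<^bsub>H2 G\<^esub> = \<one>\<^bsub>H2 H\<^esub>"
    using \<psi> hom_one [of \<psi> "H2 G" "H2 H"] HG.is_group HH.is_group by (simp add: iso_def)
  then show "algebra_isomorphic (group_algebra G) (group_algebra H)"
    using tw [OF HG.one_closed trivial_cocycle_in_one [OF assms(1)]] trivial_cocycle_in_one [OF assms(2)] by simp
  show "order (H2 H) = order (H2 G)"
    using \<psi> bij_betw_same_card unfolding iso_def order_def by fastforce
qed

lemma multiplier_ge:
  assumes p: "p > 0" and n: "n > 0" and c: "is_generalized_corank p n G s" and s: "s \<in> {0, 1}"
  shows "p ^ (n - 1 choose 2) \<le> order (H2 G)"
proof -
  obtain m where m: "n = Suc m" using n gr0_implies_Suc by blast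
  \<comment> \<open>Integer and natural subtraction have to be reconciled: for \<open>n = 1\<close>
    the integer product contains the factor 0, and the binomial coefficient vanishes too.\<close>
  have e: "(int n - 1) * (int n - 2) div 2 = int (n - 1 choose 2)"
    unfolding m choose_two by (cases m) (simp_all add: zdiv_int algebra_simps)
  have "(int n - 1) * (int n - 2) div 2 + 1 - s = int ((n - 1 choose 2) + nat (1 - s))"
    using s e by auto
  then have "real (order (H2 G)) = real p ^ ((n - 1 choose 2) + nat (1 - s))"
    using c unfolding is_generalized_corank_def by (simp only: power_int_of_nat)
  then have "order (H2 G) = p ^ ((n - 1 choose 2) + nat (1 - s))" by (metis of_nat_eq_iff of_nat_power)
  also have "p ^ (n - 1 choose 2) \<le> \<dots>" using p by (intro power_increasing) auto
  finally show ?thesis by simp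
qed

text \<open>Both groups have the same multiplier order and derived subgroups of the same order, so
  they fall into the same case of the classification.\<close>

theorem lemma1p1:
  fixes p n :: nat and s :: int
    and G :: "('a, 'm) monoid_scheme" and H :: "('b, 'n) monoid_scheme"
  assumes "Factorial_Ring.prime p" and "n > 0"
    and "group G" and "\<not> comm_group G" and "order G = p ^ n"
    and "is_generalized_corank p n G s" and "s \<in> {0, 1}"
    and "group H" and "order H = p ^ n"
    and "twist_isomorphic G H"
  shows "H \<cong> G"
proof -
  have pG: "p_group G p n" and pH: "p_group H p n"
    using assms by (auto intro!: p_group.intro p_group_axioms.intro)
  interpret G: p_group G p n by (rule pG)
  interpret H: p_group H p n by (rule pH)
  interpret pair: p_group_pair G H p n by (intro p_group_pair.intro pG pH)
  note tw = twist_isomorphic_imp_group_algebras [OF assms(3,8,10)]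
  have cD: "card (derived H (carrier H)) = card (derived G (carrier G))"
    using card_derived_le [OF pG pH tw(1)]
      card_derived_le [OF pH pG algebra_isomorphic_sym [OF assms(3) G.finite_carrier tw(1)]] by simp
  have big: "p ^ (n - 1 choose 2) \<le> order (H2 G)" by (rule multiplier_ge [OF G.p_pos assms(2,6,7)])
  then have bigH: "p ^ (n - 1 choose 2) \<le> order (H2 H)" unfolding tw(2) .
  \<comment> \<open>The order of the derived subgroup detects that \<open>H\<close> is nonabelian,
    as the classification requires.\<close>
  have nH: "\<not> comm_group H"
  proof
    assume "comm_group H"
    then have "card (derived G (carrier G)) = 1" using comm_group.derived_eq_singleton cD by force
    then show False using G.noncomm_facts(1) [OF assms(4)] prime_gt_1_nat [OF assms(1)] by simp
  qed
  show ?thesis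
  proof (cases "card (derived G (carrier G)) = p")
    case True
    then have d: "prime_derived G p n" "prime_derived H p n"
      using pG pH cD by (auto intro!: prime_derived.intro prime_derived_axioms.intro)
    show ?thesis
      by (rule pair.heisenberg_like_unique [OF prime_derived.heisenberg_like [OF d(1) big]
            prime_derived.heisenberg_like [OF d(2) bigH]])
  next
    case False
    have "square_derived G p n" by (rule G.square_derivedI [OF assms(4) False big])
    moreover have "square_derived H p n" using H.square_derivedI [OF nH _ bigH] False cD by simp
    ultimately show ?thesis
      by (intro pair.two_block_like_unique square_derived.two_block_like)
  qed
qed

end
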